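(* Let $0<c<1$, let $G_n=G(n,c/n)$, and let $\overline{L_c}$ be the closure in $[0,1]$ of the set $L_c=\{\lim_{n\to\infty}\mathbf{P}(G_n\models\phi)\colon\phi\text{ a first order sentence in the language of graphs}\}$. For $H\in\mathcal U$ let $p_H(c)=\lim_{n\to\infty}\mathbf{P}(\mathrm{Frag}_n\simeq H)$, and let $$S_c=\Big\{\sum_{H\in\mathcal T}p_H(c)\colon \mathcal T\subseteq\mathcal U\Big\}.$$ Then $\overline{L_c}=S_c$.
   Context: $G(n,p)$ is the binomial random graph on $\{1,\dots,n\}$ with each edge present independently with probability $p$. The FO language of graphs is first order logic with a symmetric antireflexive binary adjacency relation; a sentence has no free variables. A unicycle is a connected graph with exactly one cycle. $\mathcal U$ is the family of unlabeled finite graphs all of whose components are unicycles (including the empty graph). $\mathrm{Frag}_n$ is the union of all unicyclic components of $G_n$. (Explicitly, $p_H(c)=e^{-f(c)}(ce^{-c})^{|H|}/\mathrm{aut}(H)$ with $f(c)=\frac12\ln\frac1{1-c}-\frac c2-\frac{c^2}4$, $|H|$ the number of edges and $\mathrm{aut}(H)$ the number of automorphisms.) *)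

theory Defs
  imports "HOL-Probability.Probability" "HOL-Probability.Product_PMF"
begin

datatype 'a ugraph = UGraph (verts: "'a set") (edges: "'a set set")

definition simple_graph :: "'a ugraph \<Rightarrow> bool" where
  "simple_graph G \<longleftrightarrow> finite (verts G) \<and> (\<forall>e\<in>edges G. e \<subseteq> verts G \<and> card e = 2)"

definition adj :: "'a ugraph \<Rightarrow> ('a \<times> 'a) set" where
  "adj G = {(u, v). {u, v} \<in> edges G}"

definition graph_connected :: "'a ugraph \<Rightarrow> bool" where
  "graph_connected G \<longleftrightarrow> verts G \<noteq> {} \<and> (\<forall>u\<in>verts G. \<forall>v\<in>verts G. (u, v) \<in> (adj G)\<^sup>*)"

definition induced_subgraph :: "'a ugraph \<Rightarrow> 'a set \<Rightarrow> 'a ugraph" where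
  "induced_subgraph G W = UGraph (verts G \<inter> W) {e \<in> edges G. e \<subseteq> W}"

definition graph_components :: "'a ugraph \<Rightarrow> 'a ugraph set" where
  "graph_components G = (\<lambda>u. induced_subgraph G {v. (u, v) \<in> (adj G)\<^sup>*}) ` verts G"

text \<open>A cycle is listed by its vertices in cyclic order. Lists that differ by a rotation or a
  reflection describe the same cycle, so cycles are identified with their edge sets.\<close>

definition cycle_edges :: "'a list \<Rightarrow> 'a set set" where
  "cycle_edges xs = {{xs ! i, xs ! (Suc i mod length xs)} | i. i < length xs}"

definition graph_cycles :: "'a ugraph \<Rightarrow> 'a set set set" where
  "graph_cycles G =
     cycle_edges ` {xs. length xs \<ge> 3 \<and> distinct xs \<and> set xs \<subseteq> verts G \<and> cycle_edges xs \<subseteq> edges G}"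

definition unicycle :: "'a ugraph \<Rightarrow> bool" where
  "unicycle G \<longleftrightarrow> graph_connected G \<and> (\<exists>!C. C \<in> graph_cycles G)"

definition Frag :: "'a ugraph \<Rightarrow> 'a ugraph" where
  "Frag G = UGraph (\<Union>K\<in>{K \<in> graph_components G. unicycle K}. verts K)
                   (\<Union>K\<in>{K \<in> graph_components G. unicycle K}. edges K)"

definition graph_iso :: "'a ugraph \<Rightarrow> 'b ugraph \<Rightarrow> bool" where
  "graph_iso G H \<longleftrightarrow> (\<exists>f. bij_betw f (verts G) (verts H) \<and>
     (\<forall>u\<in>verts G. \<forall>v\<in>verts G. {u, v} \<in> edges G \<longleftrightarrow> {f u, f v} \<in> edges H))"

text \<open>Unlabeled finite graphs are isomorphism classes of finite simple graphs with vertices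
  in \<^typ>\<open>nat\<close>; thus, for a finite simple graph \<open>G\<close> on naturals and an unlabeled graph \<open>H\<close>,
  \<open>G \<in> H\<close> says that \<open>G\<close> is isomorphic to \<open>H\<close>.\<close>

definition iso_class :: "nat ugraph \<Rightarrow> nat ugraph set" where
  "iso_class G = {G'. simple_graph G' \<and> graph_iso G G'}"

definition unicyclic_family :: "nat ugraph set set" where
  "unicyclic_family = iso_class ` {G. simple_graph G \<and> (\<forall>K\<in>graph_components G. unicycle K)}"

datatype fo =
    Eq nat nat
  | Adj nat nat
  | Neg fo
  | Conj fo fo
  | Ex nat fo

fun free_vars :: "fo \<Rightarrow> nat set" where
  "free_vars (Eq x y) = {x, y}"
| "free_vars (Adj x y) = {x, y}"
| "free_vars (Neg \<phi>) = free_vars \<phi>"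
| "free_vars (Conj \<phi> \<psi>) = free_vars \<phi> \<union> free_vars \<psi>"
| "free_vars (Ex x \<phi>) = free_vars \<phi> - {x}"

definition sentence :: "fo \<Rightarrow> bool" where
  "sentence \<phi> \<longleftrightarrow> free_vars \<phi> = {}"

fun sat :: "'a ugraph \<Rightarrow> (nat \<Rightarrow> 'a) \<Rightarrow> fo \<Rightarrow> bool" where
  "sat G s (Eq x y) \<longleftrightarrow> s x = s y"
| "sat G s (Adj x y) \<longleftrightarrow> {s x, s y} \<in> edges G"
| "sat G s (Neg \<phi>) \<longleftrightarrow> \<not> sat G s \<phi>"
| "sat G s (Conj \<phi> \<psi>) \<longleftrightarrow> sat G s \<phi> \<and> sat G s \<psi>"
| "sat G s (Ex x \<phi>) \<longleftrightarrow> (\<exists>v\<in>verts G. sat G (s(x := v)) \<phi>)"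

text \<open>For a sentence the truth value does not depend on the assignment.\<close>

definition models :: "'a ugraph \<Rightarrow> fo \<Rightarrow> bool" where
  "models G \<phi> \<longleftrightarrow> (\<forall>s. sat G s \<phi>)"

definition all_edges :: "nat \<Rightarrow> nat set set" where
  "all_edges n = {e. e \<subseteq> {1..n} \<and> card e = 2}"

definition gnp :: "nat \<Rightarrow> real \<Rightarrow> nat ugraph pmf" where
  "gnp n p = map_pmf (\<lambda>b. UGraph {1..n} {e \<in> all_edges n. b e})
               (Pi_pmf (all_edges n) False (\<lambda>_. bernoulli_pmf p))"

definition fo_limits :: "real \<Rightarrow> real set" where
  "fo_limits c = {lim (\<lambda>n. measure_pmf.prob (gnp n (c / real n)) {G. models G \<phi>}) | \<phi>. sentence \<phi>}"

definition frag_prob :: "real \<Rightarrow> nat ugraph set \<Rightarrow> real" where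
  "frag_prob c H = lim (\<lambda>n. measure_pmf.prob (gnp n (c / real n)) {G. Frag G \<in> H})"

definition frag_sums :: "real \<Rightarrow> real set" where
  "frag_sums c = {(\<Sum>\<^sub>\<infinity>H\<in>\<T>. frag_prob c H) | \<T>. \<T> \<subseteq> unicyclic_family}"

end

theory Submission
  imports Defs "HOL-Real_Asymp.Real_Asymp"
begin

text \<open>
  For \<open>c < 1\<close> almost surely every component of \<open>G\<^sub>n\<close> has at most one cycle: a component with two cycles
  contains a path with two further edges inside its vertex set, and the expected number of such
  configurations is \<open>O(1/n)\<close>. By a first moment bound the size of the unicyclic part is tight, and by
  a second moment bound every fixed tree occurs as a component arbitrarily often. In an
  Ehrenfeucht--Fraisse game of fixed length two such graphs with isomorphic unicyclic parts cannot
  be told apart, because there are only finitely many types of trees. Hence the probability of a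
  sentence converges to \<open>\<Sum>H\<in>\<T>. p\<^sub>H\<close>, where \<open>\<T>\<close> consists of the unicyclic parts that
  force the sentence. Conversely, for a finite set \<open>\<T>\<close> of unicyclic parts the sentence
  ``for some \<open>H \<in> \<T>\<close> there is an isolated copy of \<open>H\<close> that meets all cycles shorter than \<open>k\<close>''
  has a limit that differs from \<open>\<Sum>H\<in>\<T>. p\<^sub>H\<close> by at most the probability of a cycle of length at
  least \<open>k\<close>. Finally, the set of all subsums of a convergent series of nonnegative terms is compact.
\<close>



subsection \<open>Components, paths and cycles\<close>

text \<open>\<open>lim\<close> is total, so \<open>fo_limits\<close> and \<open>frag_prob\<close>
  carry information only after convergence is established; it is proved for every sentence and every
  class. The values of the limits are never computed. The probability that the unicyclic part lies
  in a class is squeezed around the product of an explicit convergent factor and the probability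
  that the whole graph is a forest. In the game the obstacle is that the tree part is unbounded. The
  duplicator therefore matches components rather than vertices, answers inside matched components,
  and opens a new pair of trees only when the spoiler enters an unmatched component. Each round
  opens at most one pair, so \<open>k\<close> components of each \<open>k\<close>-round tree type
  suffice. All first moments count lists of distinct vertices: at most n^m lists have length m, so a
  structure with m vertices and m edges costs c^m, and every further edge costs another factor c/n.
  That is why cycles and lollipops have bounded expectation while double chords disappear.\<close>

definition reach :: "'a ugraph \<Rightarrow> 'a \<Rightarrow> 'a set" where
  "reach G u = {v. (u, v) \<in> (adj G)\<^sup>*}"

definition component :: "'a ugraph \<Rightarrow> 'a \<Rightarrow> 'a ugraph" where
  "component G u = induced_subgraph G (reach G u)"

text \<open>In a simple graph the closed subsets of the vertex set are the unions of components, so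
  isolation is expressed by edges alone.\<close>

definition closed_in :: "'a ugraph \<Rightarrow> 'a set \<Rightarrow> bool" where
  "closed_in G S \<longleftrightarrow> (\<forall>u\<in>S. \<forall>v. {u, v} \<in> edges G \<longrightarrow> v \<in> S)"

definition is_cycle :: "'a ugraph \<Rightarrow> 'a list \<Rightarrow> bool" where
  "is_cycle G xs \<longleftrightarrow> length xs \<ge> 3 \<and> distinct xs \<and> set xs \<subseteq> verts G \<and> cycle_edges xs \<subseteq> edges G"

definition cycle_free :: "'a ugraph \<Rightarrow> bool" where
  "cycle_free G \<longleftrightarrow> (\<forall>xs. \<not> is_cycle G xs)"

fun path_edges :: "'a list \<Rightarrow> 'a set set" where
  "path_edges (x # y # xs) = insert {x, y} (path_edges (y # xs))"
| "path_edges xs = {}"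

definition is_path :: "'a ugraph \<Rightarrow> 'a list \<Rightarrow> bool" where
  "is_path G xs \<longleftrightarrow> xs \<noteq> [] \<and> distinct xs \<and> set xs \<subseteq> verts G \<and> path_edges xs \<subseteq> edges G"

text \<open>A path on m vertices with two further edges has m + 1 edges, one more than vertices. As
  a witness for two cycles it has the advantage of being coded by one vertex list and two pairs,
  which makes its copies easy to count.\<close>

definition double_chorded :: "'a ugraph \<Rightarrow> bool" where
  "double_chorded G \<longleftrightarrow> (\<exists>xs e e'. is_path G xs \<and> e \<noteq> e' \<and> e \<in> edges G - path_edges xs \<and>
     e' \<in> edges G - path_edges xs \<and> e \<subseteq> set xs \<and> e' \<subseteq> set xs)"

lemma sym_adj: "sym (adj G)"
  by (auto simp: sym_def adj_def insert_commute)

lemma reach_refl [simp]: "u \<in> reach G u"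
  by (simp add: reach_def)

lemma reach_sym: "v \<in> reach G u \<Longrightarrow> u \<in> reach G v"
  unfolding reach_def using sym_rtrancl[OF sym_adj] by (metis mem_Collect_eq symD)

lemma reach_trans: "v \<in> reach G u \<Longrightarrow> w \<in> reach G v \<Longrightarrow> w \<in> reach G u"
  unfolding reach_def by (auto intro: rtrancl_trans)

lemma reach_eq: "v \<in> reach G u \<Longrightarrow> reach G v = reach G u"
  by (blast intro: reach_trans reach_sym)

lemma edge_reach: "{u, v} \<in> edges G \<Longrightarrow> v \<in> reach G u"
  by (auto simp: reach_def adj_def)

lemma closed_in_reach: "closed_in G (reach G u)"
  unfolding closed_in_def by (blast intro: reach_trans edge_reach)

lemma closed_in_imp_reach_subset:
  assumes "closed_in G S" "u \<in> S" shows "reach G u \<subseteq> S"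
proof
  fix v assume "v \<in> reach G u"
  then have "(u, v) \<in> (adj G)\<^sup>*" by (simp add: reach_def)
  then show "v \<in> S" using assms
    by (induction rule: rtrancl_induct) (auto simp: closed_in_def adj_def)
qed

lemma reach_mono: "edges G \<subseteq> edges G' \<Longrightarrow> reach G u \<subseteq> reach G' u"
proof -
  assume "edges G \<subseteq> edges G'"
  then have "adj G \<subseteq> adj G'" by (auto simp: adj_def)
  then show ?thesis unfolding reach_def using rtrancl_mono by blast
qed

lemma induced_subgraph_simps [simp]:
  "verts (induced_subgraph G W) = verts G \<inter> W"
  "edges (induced_subgraph G W) = {e \<in> edges G. e \<subseteq> W}"
  by (simp_all add: induced_subgraph_def)

lemma simple_graph_induced: "simple_graph G \<Longrightarrow> simple_graph (induced_subgraph G W)"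
  by (auto simp: simple_graph_def)

lemma simple_graph_edgeD:
  "simple_graph G \<Longrightarrow> {u, v} \<in> edges G \<Longrightarrow> u \<in> verts G \<and> v \<in> verts G \<and> u \<noteq> v"
  by (force simp: simple_graph_def card_2_iff)

lemma simple_graph_edgeE:
  assumes "simple_graph G" "e \<in> edges G"
  obtains u v where "e = {u, v}" "u \<noteq> v" "u \<in> verts G" "v \<in> verts G"
  using assms by (fastforce simp: simple_graph_def card_2_iff)

lemma simple_graph_finite_edges: "simple_graph G \<Longrightarrow> finite (edges G)"
  by (rule finite_subset[of _ "Pow (verts G)"]) (auto simp: simple_graph_def)

lemma reach_subset_verts: "simple_graph G \<Longrightarrow> u \<in> verts G \<Longrightarrow> reach G u \<subseteq> verts G"
  by (rule closed_in_imp_reach_subset) (auto simp: closed_in_def dest: simple_graph_edgeD)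

text \<open>A walk that starts in a closed set never leaves it, so components can be computed inside
  the induced subgraph.\<close>

lemma reach_induced_closed:
  assumes "closed_in G S" "u \<in> S"
  shows "reach (induced_subgraph G S) u = reach G u"
proof
  show "reach (induced_subgraph G S) u \<subseteq> reach G u" by (rule reach_mono) auto
  show "reach G u \<subseteq> reach (induced_subgraph G S) u"
  proof
    fix v assume "v \<in> reach G u"
    then have "(u, v) \<in> (adj G)\<^sup>*" by (simp add: reach_def)
    then have "v \<in> S \<and> v \<in> reach (induced_subgraph G S) u"
    proof (induction rule: rtrancl_induct)
      case base show ?case using assms by simp
    next
      case (step y z)
      then have "{y, z} \<in> edges G" "y \<in> S" "z \<in> S"
        using assms by (auto simp: adj_def closed_in_def)
      then have "z \<in> reach (induced_subgraph G S) y" by (intro edge_reach) simp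
      then show ?case using step \<open>z \<in> S\<close> by (blast intro: reach_trans)
    qed
    then show "v \<in> reach (induced_subgraph G S) u" ..
  qed
qed

lemma graph_components_eq: "graph_components G = component G ` verts G"
  by (auto simp: graph_components_def component_def reach_def)

lemma component_simps:
  "verts (component G u) = verts G \<inter> reach G u"
  "edges (component G u) = {e \<in> edges G. e \<subseteq> reach G u}"
  by (simp_all add: component_def)

lemma verts_component: "simple_graph G \<Longrightarrow> u \<in> verts G \<Longrightarrow> verts (component G u) = reach G u"
  using reach_subset_verts[of G u] by (auto simp: component_simps)

lemma simple_graph_component: "simple_graph G \<Longrightarrow> simple_graph (component G u)"
  by (simp add: component_def simple_graph_induced)

lemma component_eq: "v \<in> reach G u \<Longrightarrow> component G v = component G u"
  by (simp add: component_def reach_eq)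

lemma component_eq_iff:
  assumes "simple_graph G" "u \<in> verts G" "v \<in> verts G"
  shows "component G u = component G v \<longleftrightarrow> v \<in> reach G u"
  using assms by (metis component_eq verts_component reach_refl)

lemma graph_connected_component:
  assumes "simple_graph G" "u \<in> verts G" shows "graph_connected (component G u)"
proof -
  have "w \<in> reach (component G u) v" if "v \<in> reach G u" "w \<in> reach G u" for v w
  proof -
    have "reach (component G u) v = reach G v"
      unfolding component_def by (rule reach_induced_closed[OF closed_in_reach that(1)])
    then show ?thesis using that reach_eq by metis
  qed
  moreover have "reach G u \<noteq> {}" using reach_refl[of u G] by blast
  ultimately show ?thesis using assms
    by (auto simp: graph_connected_def verts_component reach_def[of "component G u"])
qed

lemma component_induced_closed:
  assumes "closed_in G S" "u \<in> S"
  shows "component (induced_subgraph G S) u = component G u"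
proof -
  have "reach G u \<subseteq> S" by (rule closed_in_imp_reach_subset[OF assms])
  then show ?thesis
    unfolding component_def reach_induced_closed[OF assms] by (auto simp: induced_subgraph_def)
qed

subsection \<open>Paths and cycles as lists\<close>

lemma path_edges_subset_Pow: "e \<in> path_edges xs \<Longrightarrow> e \<subseteq> set xs"
  by (induction xs rule: path_edges.induct) auto

lemma finite_path_edges [simp]: "finite (path_edges xs)"
  by (induction xs rule: path_edges.induct) auto

lemma path_edges_nth: "path_edges xs = {{xs ! i, xs ! Suc i} | i. Suc i < length xs}"
proof (induction xs rule: path_edges.induct)
  case (1 x y xs)
  have "{{(x # y # xs) ! i, (x # y # xs) ! Suc i} | i. Suc i < length (x # y # xs)}
     = insert {x, y} {{(y # xs) ! i, (y # xs) ! Suc i} | i. Suc i < length (y # xs)}"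
    (is "?L = insert _ ?R")
  proof -
    have "e \<in> ?L \<longleftrightarrow> e \<in> insert {x, y} ?R" for e
    proof
      assume "e \<in> ?L"
      then obtain i where i: "e = {(x # y # xs) ! i, (x # y # xs) ! Suc i}" "Suc i < length (x # y # xs)"
        by blast
      show "e \<in> insert {x, y} ?R"
      proof (cases i)
        case 0 then show ?thesis using i by simp
      next
        case (Suc j)
        then have "e = {(y # xs) ! j, (y # xs) ! Suc j}" "Suc j < length (y # xs)" using i by auto
        then show ?thesis by blast
      qed
    next
      assume "e \<in> insert {x, y} ?R"
      then consider "e = {x, y}" | i where "e = {(y # xs) ! i, (y # xs) ! Suc i}" "Suc i < length (y # xs)"
        by blast
      then show "e \<in> ?L"
      proof cases
        case 1
        then have "e = {(x # y # xs) ! 0, (x # y # xs) ! Suc 0}" "Suc 0 < length (x # y # xs)" by auto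
        then show ?thesis by blast
      next
        case 2
        then have "e = {(x # y # xs) ! Suc i, (x # y # xs) ! Suc (Suc i)}"
          "Suc (Suc i) < length (x # y # xs)" by auto
        then show ?thesis by blast
      qed
    qed
    then show ?thesis by (rule set_eqI)
  qed
  then show ?case using 1 by simp
qed auto

lemma cycle_edges_eq:
  assumes "xs \<noteq> []"
  shows "cycle_edges xs = insert {last xs, hd xs} (path_edges xs)"
proof -
  let ?n = "length xs"
  have n: "?n > 0" using assms by simp
  have "e \<in> cycle_edges xs \<longleftrightarrow> e \<in> insert {last xs, hd xs} (path_edges xs)" for e
  proof
    assume "e \<in> cycle_edges xs"
    then obtain i where i: "e = {xs ! i, xs ! (Suc i mod ?n)}" "i < ?n"
      by (auto simp: cycle_edges_def)
    show "e \<in> insert {last xs, hd xs} (path_edges xs)"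
    proof (cases "Suc i = ?n")
      case True
      then have "i = ?n - 1" by simp
      then show ?thesis using i True n assms by (simp add: last_conv_nth hd_conv_nth)
    next
      case False
      then have "Suc i < ?n" using i by simp
      then have "e = {xs ! i, xs ! Suc i}" using i by simp
      then show ?thesis using \<open>Suc i < ?n\<close> path_edges_nth by blast
    qed
  next
    assume "e \<in> insert {last xs, hd xs} (path_edges xs)"
    then consider "e = {last xs, hd xs}" | i where "e = {xs ! i, xs ! Suc i}" "Suc i < ?n"
      unfolding path_edges_nth by blast
    then show "e \<in> cycle_edges xs"
    proof cases
      case 1
      then have "e = {xs ! (?n - 1), xs ! (Suc (?n - 1) mod ?n)}"
        using n assms by (simp add: last_conv_nth hd_conv_nth)
      moreover have "?n - 1 < ?n" using n by simp
      ultimately show ?thesis unfolding cycle_edges_def by blast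
    next
      case 2
      then have "e = {xs ! i, xs ! (Suc i mod ?n)}" "i < ?n" by auto
      then show ?thesis unfolding cycle_edges_def by blast
    qed
  qed
  then show ?thesis by (rule set_eqI)
qed

lemma path_edges_append:
  "xs \<noteq> [] \<Longrightarrow> ys \<noteq> [] \<Longrightarrow>
    path_edges (xs @ ys) = insert {last xs, hd ys} (path_edges xs \<union> path_edges ys)"
proof (induction xs rule: path_edges.induct)
  case ("2_2" x)
  then show ?case by (cases ys) auto
qed auto

lemma path_edges_rev: "path_edges (rev xs) = path_edges xs"
proof (induction xs rule: path_edges.induct)
  case (1 x y xs)
  have "path_edges (rev (x # y # xs)) = path_edges (rev (y # xs) @ [x])" by simp
  also have "\<dots> = insert {y, x} (path_edges (rev (y # xs)))"
    by (subst path_edges_append) (auto simp: last_rev)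
  finally show ?case using 1 by (simp add: insert_commute)
qed auto

lemma card_path_edges: "distinct xs \<Longrightarrow> card (path_edges xs) = length xs - 1"
proof (induction xs rule: path_edges.induct)
  case (1 x y xs)
  then have "{x, y} \<notin> path_edges (y # xs)" using path_edges_subset_Pow by fastforce
  then show ?case using 1 by simp
qed auto

text \<open>Used wherever a cycle has to be cut open at a prescribed vertex: to prolong a path, to
  attach a tail, or to count the cycles through a given vertex.\<close>

lemma cycle_rotate_hd:
  assumes "distinct xs" "x \<in> set xs"
  obtains ys where "hd ys = x" "set ys = set xs" "distinct ys" "length ys = length xs"
    "cycle_edges ys = cycle_edges xs" "ys \<noteq> []"
proof -
  obtain as bs where xs: "xs = as @ x # bs" using assms(2) by (meson split_list)
  let ?ys = "x # bs @ as"
  have "cycle_edges ?ys = cycle_edges xs"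
  proof (cases "as = []")
    case True then show ?thesis using xs by simp
  next
    case False
    have "cycle_edges ?ys = insert {last as, x} (path_edges ((x # bs) @ as))"
      using False by (simp add: cycle_edges_eq)
    also have "\<dots> = insert {last as, x} (insert {last (x # bs), hd as} (path_edges (x # bs) \<union> path_edges as))"
      using False by (subst path_edges_append) auto
    also have "\<dots> = cycle_edges xs"
      using False unfolding xs by (subst cycle_edges_eq) (auto simp: path_edges_append)
    finally show ?thesis .
  qed
  moreover have "set ?ys = set xs" "distinct ?ys" "length ?ys = length xs" using assms xs by auto
  ultimately show thesis using that[of ?ys] by simp
qed

text \<open>With two vertices the closing edge would be the path edge itself; from three vertices
  on, the ends of the list are not consecutive.\<close>

lemma closing_edge_notin_path_edges:
  assumes "distinct xs" "length xs \<ge> 3" shows "{last xs, hd xs} \<notin> path_edges xs"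
proof -
  obtain x y z zs where xs: "xs = x # y # z # zs"
    using assms(2) by (auto simp: numeral_3_eq_3 Suc_le_length_iff)
  let ?l = "last (z # zs)"
  have l: "?l \<in> set (z # zs)" by (rule last_in_set) simp
  then have "?l \<noteq> x" "?l \<noteq> y" using assms(1) xs by auto
  then have "{?l, x} \<noteq> {x, y}" by (auto simp: doubleton_eq_iff)
  moreover have "{?l, x} \<notin> path_edges (y # z # zs)"
    using path_edges_subset_Pow[of "{?l, x}" "y # z # zs"] assms(1) xs by auto
  ultimately show ?thesis by (simp add: xs)
qed

lemma card_cycle_edges:
  assumes "distinct xs" "length xs \<ge> 3" shows "card (cycle_edges xs) = length xs"
proof -
  have "xs \<noteq> []" using assms by auto
  then have "card (cycle_edges xs) = Suc (card (path_edges xs))"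
    using closing_edge_notin_path_edges[OF assms] by (simp add: cycle_edges_eq)
  then show ?thesis using assms by (simp add: card_path_edges)
qed

lemma Union_cycle_edges: "xs \<noteq> [] \<Longrightarrow> \<Union> (cycle_edges xs) = set xs"
proof
  assume ne: "xs \<noteq> []"
  then show "\<Union> (cycle_edges xs) \<subseteq> set xs"
    using path_edges_subset_Pow[of _ xs] by (auto simp: cycle_edges_eq)
  show "set xs \<subseteq> \<Union> (cycle_edges xs)"
  proof
    fix x assume "x \<in> set xs"
    then obtain i where "i < length xs" "x = xs ! i" by (auto simp: in_set_conv_nth)
    then have "{x, xs ! (Suc i mod length xs)} \<in> cycle_edges xs" by (auto simp: cycle_edges_def)
    then show "x \<in> \<Union> (cycle_edges xs)" by blast
  qed
qed

lemma cycle_edges_subset_Pow: "e \<in> cycle_edges xs \<Longrightarrow> e \<subseteq> set xs"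
  using Union_cycle_edges[of xs] by (cases "xs = []") (auto simp: cycle_edges_def)

lemma finite_cycle_edges [simp]: "finite (cycle_edges xs)"
  by (cases "xs = []") (auto simp: cycle_edges_eq, auto simp: cycle_edges_def)

lemma graph_cycles_eq: "graph_cycles G = cycle_edges ` Collect (is_cycle G)"
  unfolding graph_cycles_def is_cycle_def by (rule refl)

lemma is_cycle_induced:
  "is_cycle (induced_subgraph G W) xs \<longleftrightarrow> is_cycle G xs \<and> set xs \<subseteq> W"
proof -
  have "cycle_edges xs \<subseteq> {e \<in> edges G. e \<subseteq> W} \<longleftrightarrow> cycle_edges xs \<subseteq> edges G" if "set xs \<subseteq> W"
    using that cycle_edges_subset_Pow by fastforce
  then show ?thesis by (auto simp: is_cycle_def)
qed

lemma path_edges_reach: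
  "path_edges xs \<subseteq> edges G \<Longrightarrow> x \<in> set xs \<Longrightarrow> x \<in> reach G (hd xs)"
proof (induction xs rule: path_edges.induct)
  case (1 y z xs)
  then show ?case using edge_reach[of y z G] by (auto intro: reach_trans)
qed auto

lemma cycle_reach:
  assumes "is_cycle G xs" "x \<in> set xs" "y \<in> set xs" shows "y \<in> reach G x"
proof -
  have "xs \<noteq> []" using assms by auto
  then have "path_edges xs \<subseteq> edges G" using assms by (auto simp: is_cycle_def cycle_edges_eq)
  then have "x \<in> reach G (hd xs)" "y \<in> reach G (hd xs)" using assms by (simp_all add: path_edges_reach)
  then show ?thesis using reach_eq[of x G "hd xs"] by simp
qed

lemma cycle_subset_reach_iff:
  assumes "is_cycle G xs" shows "set xs \<subseteq> reach G u \<longleftrightarrow> (\<exists>x\<in>set xs. x \<in> reach G u)"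
proof
  have "xs \<noteq> []" using assms by (auto simp: is_cycle_def)
  then show "set xs \<subseteq> reach G u \<Longrightarrow> \<exists>x\<in>set xs. x \<in> reach G u"
    using hd_in_set by blast
  show "\<exists>x\<in>set xs. x \<in> reach G u \<Longrightarrow> set xs \<subseteq> reach G u"
    using cycle_reach[OF assms] by (blast intro: reach_trans)
qed

subsection \<open>Edge counts\<close>

lemma double_chorded_mono:
  assumes "double_chorded G" "verts G \<subseteq> verts G'" "edges G \<subseteq> edges G'"
  shows "double_chorded G'"
proof -
  obtain xs e e' where *: "is_path G xs" "e \<noteq> e'" "e \<in> edges G - path_edges xs"
    "e' \<in> edges G - path_edges xs" "e \<subseteq> set xs" "e' \<subseteq> set xs"
    using assms(1) unfolding double_chorded_def by blast
  moreover have "is_path G' xs" using * assms(2,3) by (auto simp: is_path_def)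
  ultimately show ?thesis using assms(3) unfolding double_chorded_def by blast
qed

section \<open>Longest paths, and what many edges force\<close>

lemma longest_path:
  assumes "simple_graph G" "verts G \<noteq> {}"
  obtains xs where "is_path G xs" "\<And>ys. is_path G ys \<Longrightarrow> length ys \<le> length xs"
proof -
  obtain v where "v \<in> verts G" using assms by blast
  then have "is_path G [v]" by (simp add: is_path_def)
  moreover have "length ys < Suc (card (verts G))" if "is_path G ys" for ys
    using that assms by (auto simp: is_path_def simple_graph_def less_Suc_eq_le
        simp flip: distinct_card intro: card_mono)
  ultimately show thesis using that ex_has_greatest_nat[of "is_path G" "[v]" length] by blast
qed

text \<open>Hypothesis \<open>deg\<close> expresses minimum degree two. By maximality all neighbours
  of the end of a longest path lie on the path, and one of them is not its successor.\<close>

lemma longest_path_end_chord: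
  assumes G: "simple_graph G" and deg: "\<And>v w. v \<in> verts G \<Longrightarrow> \<exists>u. {v, u} \<in> edges G \<and> u \<noteq> w"
    and xs: "is_path G xs" and longest: "\<And>ys. is_path G ys \<Longrightarrow> length ys \<le> length xs"
  obtains u where "u \<in> set xs" "{hd xs, u} \<in> edges G" "{hd xs, u} \<notin> path_edges xs" "u \<noteq> hd xs"
proof -
  have nb: "u \<in> set xs" if "{hd xs, u} \<in> edges G" for u
  proof (rule ccontr)
    assume "u \<notin> set xs"
    moreover obtain y ys where "xs = y # ys" using xs by (cases xs) (auto simp: is_path_def)
    ultimately have "is_path G (u # xs)"
      using xs that simple_graph_edgeD[OF G that] by (auto simp: is_path_def insert_commute)
    then show False using longest by fastforce
  qed
  have h: "hd xs \<in> verts G" using xs by (auto simp: is_path_def)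
  have irr: "u \<noteq> hd xs" if "{hd xs, u} \<in> edges G" for u
    using simple_graph_edgeD[OF G that] by auto
  obtain x ys where x: "xs = x # ys" using xs by (cases xs) (auto simp: is_path_def)
  show thesis
  proof (cases ys)
    case Nil
    obtain u where "{hd xs, u} \<in> edges G" using deg h by blast
    then show thesis using nb[of u] irr[of u] x Nil by simp
  next
    case (Cons y zs)
    obtain u where u: "{hd xs, u} \<in> edges G" "u \<noteq> y" using deg h by blast
    have "x \<notin> set (y # zs)" using xs x Cons by (auto simp: is_path_def)
    then have "{x, u} \<notin> path_edges (y # zs)" using path_edges_subset_Pow by fastforce
    then have "{hd xs, u} \<notin> path_edges xs" using u x Cons by (auto simp: doubleton_eq_iff)
    then show thesis using that[of u] nb u irr by blast
  qed
qed

text \<open>The reduction step of the two inductions below: one vertex and at most one edge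
  disappear, so the number of edges minus the number of vertices does not decrease.\<close>

lemma remove_low_degree_vertex:
  assumes "simple_graph G" "v \<in> verts G" "\<And>u. {v, u} \<in> edges G \<Longrightarrow> u = w"
  shows "card (edges G) \<le> Suc (card (edges (induced_subgraph G (- {v}))))"
    and "card (verts (induced_subgraph G (- {v}))) = card (verts G) - 1"
proof -
  have "edges G \<subseteq> insert {v, w} (edges (induced_subgraph G (- {v})))"
  proof
    fix e assume e: "e \<in> edges G"
    obtain a b where ab: "e = {a, b}" using e assms(1) by (auto elim: simple_graph_edgeE)
    show "e \<in> insert {v, w} (edges (induced_subgraph G (- {v})))"
      using e ab assms(3)[of a] assms(3)[of b] by (auto simp: insert_commute)
  qed
  then have "card (edges G) \<le> card (insert {v, w} (edges (induced_subgraph G (- {v}))))"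
    by (intro card_mono finite.insertI simple_graph_finite_edges simple_graph_induced assms(1))
  also have "\<dots> \<le> Suc (card (edges (induced_subgraph G (- {v}))))"
    by (rule card_insert_le_m1) simp_all
  finally show "card (edges G) \<le> Suc (card (edges (induced_subgraph G (- {v}))))" .
  show "card (verts (induced_subgraph G (- {v}))) = card (verts G) - 1"
    using assms by (simp add: simple_graph_def flip: Diff_eq)
qed

text \<open>Vertices with at most one neighbour are deleted inductively; once there are none, the
  chord at the end of a longest path closes a cycle.\<close>

lemma cycle_if_edges_ge_verts:
  assumes "simple_graph G" "verts G \<noteq> {}" "card (verts G) \<le> card (edges G)"
  shows "\<exists>xs. is_cycle G xs"
  using assms
proof (induction "card (verts G)" arbitrary: G rule: less_induct)
  case less
  note G = \<open>simple_graph G\<close>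
  have fin: "finite (verts G)" using G by (simp add: simple_graph_def)
  show ?case
  proof (cases "\<forall>v\<in>verts G. \<forall>w. \<exists>u. {v, u} \<in> edges G \<and> u \<noteq> w")
    case True
    obtain xs where xs: "is_path G xs" "\<And>ys. is_path G ys \<Longrightarrow> length ys \<le> length xs"
      using longest_path less by metis
    obtain u where u: "u \<in> set xs" "{hd xs, u} \<in> edges G" "{hd xs, u} \<notin> path_edges xs" "u \<noteq> hd xs"
      using longest_path_end_chord[OF G _ xs] True by metis
    obtain as bs where ab: "xs = as @ u # bs" using u(1) by (meson split_list)
    have "as \<noteq> []" using u(4) ab by auto
    then have hd: "hd (as @ [u]) = hd xs" using ab by simp
    have sub: "path_edges (as @ [u]) \<subseteq> path_edges xs"
      unfolding ab using \<open>as \<noteq> []\<close> by (auto simp: path_edges_append)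
    have "length as \<noteq> 1"
    proof
      assume "length as = 1"
      then obtain a where "as = [a]" by (auto simp: length_Suc_conv)
      then show False using u(3) ab by simp
    qed
    moreover have "length as \<noteq> 0" using \<open>as \<noteq> []\<close> by simp
    ultimately have "length as \<ge> 2" by linarith
    then have "length (as @ [u]) \<ge> 3" by simp
    then have "is_cycle G (as @ [u])"
      using sub xs(1) hd u(2) ab by (auto simp: is_cycle_def is_path_def cycle_edges_eq insert_commute)
    then show ?thesis by blast
  next
    case False
    then obtain v w where v: "v \<in> verts G" "\<And>u. {v, u} \<in> edges G \<Longrightarrow> u = w" by blast
    let ?G = "induced_subgraph G (- {v})"
    note r = remove_low_degree_vertex[OF G v]
    have pos: "card (verts G) > 0" using fin less.prems by (simp add: card_gt_0_iff)
    have lt: "card (verts ?G) < card (verts G)" using r(2) pos by simp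
    have "verts ?G \<noteq> {}"
    proof
      assume "verts ?G = {}"
      then have V: "verts G = {v}" using v(1) by auto
      have "edges G = {}"
      proof (rule ccontr)
        assume "edges G \<noteq> {}"
        then obtain e where "e \<in> edges G" by blast
        then show False using V by (metis simple_graph_edgeE[OF G] singletonD)
      qed
      then show False using less.prems(3) pos by simp
    qed
    moreover have "card (verts ?G) \<le> card (edges ?G)" using r less.prems(3) pos by linarith
    ultimately obtain xs where "is_cycle ?G xs"
      using less.hyps[OF lt simple_graph_induced[OF G]] by blast
    then show ?thesis using is_cycle_induced by blast
  qed
qed

text \<open>After the deletion of low-degree vertices both ends of a longest path have chords. If
  these coincide, the path closes to a cycle that no edge leaves. Either the cycle has a chord,
  which together with the closing edge gives the claim, or it is a component whose removal deletes
  equally many vertices and edges.\<close>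

lemma double_chorded_if_edges_gt_verts:
  assumes "simple_graph G" "card (verts G) < card (edges G)"
  shows "double_chorded G"
  using assms
proof (induction "card (verts G)" arbitrary: G rule: less_induct)
  case less
  note G = \<open>simple_graph G\<close>
  have fin: "finite (verts G)" using G by (simp add: simple_graph_def)
  have ne: "verts G \<noteq> {}"
  proof
    assume "verts G = {}"
    then have "edges G = {}" using simple_graph_edgeE[OF G] by blast
    then show False using less.prems by simp
  qed
  then have pos: "card (verts G) > 0" using fin by (simp add: card_gt_0_iff)
  show ?case
  proof (cases "\<forall>v\<in>verts G. \<forall>w. \<exists>u. {v, u} \<in> edges G \<and> u \<noteq> w")
    case False
    then obtain v w where v: "v \<in> verts G" "\<And>u. {v, u} \<in> edges G \<Longrightarrow> u = w" by blast
    let ?G = "induced_subgraph G (- {v})"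
    note r = remove_low_degree_vertex[OF G v]
    have lt: "card (verts ?G) < card (verts G)" using r(2) pos by simp
    have "double_chorded ?G" using less.hyps[OF lt simple_graph_induced[OF G]] r less.prems(2) pos by linarith
    then show ?thesis by (rule double_chorded_mono) auto
  next
    case True
    obtain xs where xs: "is_path G xs" "\<And>ys. is_path G ys \<Longrightarrow> length ys \<le> length xs"
      using longest_path[OF G ne] by metis
    have rev: "is_path G (rev xs)" using xs(1) by (auto simp: is_path_def path_edges_rev)
    obtain u where u: "u \<in> set xs" "{hd xs, u} \<in> edges G" "{hd xs, u} \<notin> path_edges xs" "u \<noteq> hd xs"
      using longest_path_end_chord[OF G _ xs] True by metis
    obtain w where w: "w \<in> set (rev xs)" "{hd (rev xs), w} \<in> edges G" "{hd (rev xs), w} \<notin> path_edges (rev xs)"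
      "w \<noteq> hd (rev xs)"
      using longest_path_end_chord[OF G _ rev] True xs(2) by (metis length_rev)
    have xne: "xs \<noteq> []" "distinct xs" "set xs \<subseteq> verts G" using xs(1) by (auto simp: is_path_def)
    have w': "w \<in> set xs" "{last xs, w} \<in> edges G" "{last xs, w} \<notin> path_edges xs" "w \<noteq> last xs"
      using w xne by (auto simp: hd_rev path_edges_rev)
    show ?thesis
    proof (cases "{hd xs, u} = {last xs, w}")
      case False
      then show ?thesis using xs(1) u w' xne unfolding double_chorded_def
        by (intro exI[of _ xs] exI[of _ "{hd xs, u}"] exI[of _ "{last xs, w}"]) auto
    next
      case True
      have "hd xs \<noteq> last xs"
      proof
        assume "hd xs = last xs"
        then have "length xs \<le> 1" using xne by (cases xs) (auto split: if_splits)
        then show False using u xne by (cases xs) auto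
      qed
      then have ulast: "u = last xs" using True by (auto simp: doubleton_eq_iff)
      have len: "length xs \<ge> 3"
      proof (rule ccontr)
        assume "\<not> ?thesis"
        then obtain x y where "xs = [x] \<or> xs = [x, y]" using xne
          by (cases xs rule: path_edges.cases) (auto simp: not_less_eq_eq)
        then show False using u ulast by auto
      qed
      have cyc: "cycle_edges xs \<subseteq> edges G"
        using xs(1) u ulast by (auto simp: is_path_def cycle_edges_eq insert_commute)
      \<comment> \<open>Cutting the cycle open at \<open>a\<close> and prepending an outside
        neighbour of \<open>a\<close> would give a longer path.\<close>
      have cl: "b \<in> set xs" if e: "{a, b} \<in> edges G" and a: "a \<in> set xs" for a b
      proof (rule ccontr)
        assume b: "b \<notin> set xs"
        obtain ys where ys: "hd ys = a" "set ys = set xs" "distinct ys" "length ys = length xs"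
          "cycle_edges ys = cycle_edges xs" "ys \<noteq> []" using cycle_rotate_hd xne a by metis
        obtain zs where zs: "ys = a # zs" using ys by (cases ys) auto
        have "path_edges ys \<subseteq> edges G" using ys(5,6) cycle_edges_eq[of ys] cyc by blast
        then have "is_path G (b # ys)" using ys b xne e simple_graph_edgeD[OF G e] zs
          by (auto simp: is_path_def insert_commute)
        then show False using xs(2) ys by fastforce
      qed
      show ?thesis
      proof (cases "\<exists>e\<in>edges G. e \<subseteq> set xs \<and> e \<notin> cycle_edges xs")
        case True
        then obtain e where "e \<in> edges G" "e \<subseteq> set xs" "e \<notin> cycle_edges xs" by blast
        then show ?thesis using xs(1) u xne ulast unfolding double_chorded_def
          by (intro exI[of _ xs] exI[of _ e] exI[of _ "{hd xs, u}"]) (auto simp: cycle_edges_eq insert_commute)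
      next
        case False
        then have no_chord: "\<forall>e\<in>edges G. e \<subseteq> set xs \<longrightarrow> e \<in> cycle_edges xs" by simp
        let ?G = "induced_subgraph G (- set xs)"
        have "edges ?G = edges G - cycle_edges xs"
        proof (intro set_eqI iffI)
          fix e assume "e \<in> edges ?G"
          then have e: "e \<in> edges G" "e \<subseteq> - set xs" by auto
          then obtain a b where "e = {a, b}" using simple_graph_edgeE[OF G] by metis
          then show "e \<in> edges G - cycle_edges xs" using e cycle_edges_subset_Pow[of e xs] by auto
        next
          fix e assume e: "e \<in> edges G - cycle_edges xs"
          then obtain a b where ab: "e = {a, b}" using simple_graph_edgeE[OF G] by (metis DiffD1)
          have "\<not> e \<subseteq> set xs" using bspec[OF no_chord, of e] e by simp
          moreover have "a \<in> set xs \<longleftrightarrow> b \<in> set xs"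
            using e ab cl[of a b] cl[of b a] insert_commute[of a b "{}"] by (metis DiffD1)
          ultimately show "e \<in> edges ?G" using e ab by simp
        qed
        then have "card (edges ?G) = card (edges G) - length xs"
          using cyc card_cycle_edges[OF xne(2) len] by (simp add: card_Diff_subset)
        moreover have "card (verts ?G) = card (verts G) - length xs"
          using xne fin by (simp add: card_Diff_subset distinct_card flip: Diff_eq)
        moreover have "length xs \<le> card (verts G)" using xne fin by (metis card_mono distinct_card)
        ultimately have "double_chorded ?G"
          using less.hyps[OF _ simple_graph_induced[OF G]] less.prems(2) len by simp
        then show ?thesis by (rule double_chorded_mono) auto
      qed
    qed
  qed
qed

text \<open>Extremal argument: take a largest vertex set \<open>W\<close> that spans at least as
  many edges as it has vertices. No edge joins \<open>W\<close> to its complement, since its outer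
  end could be added to \<open>W\<close>. A vertex outside \<open>W\<close> would then reach a cycle
  disjoint from \<open>W\<close>, and that cycle could be added.\<close>

lemma verts_le_edges_if_reach_cycle:
  assumes G: "simple_graph G"
    and cyc: "\<And>v. v \<in> verts G \<Longrightarrow> \<exists>xs. is_cycle G xs \<and> (\<exists>x\<in>set xs. x \<in> reach G v)"
  shows "card (verts G) \<le> card (edges G)"
proof -
  define P where "P W \<longleftrightarrow> W \<subseteq> verts G \<and> card W \<le> card {e \<in> edges G. e \<subseteq> W}" for W
  have fin: "finite (verts G)" "finite (edges G)"
    using G simple_graph_finite_edges by (auto simp: simple_graph_def)
  have "P {}" by (simp add: P_def)
  moreover have "card W < Suc (card (verts G))" if "P W" for W
    using that fin by (simp add: P_def card_mono less_Suc_eq_le)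
  ultimately obtain W where W: "P W" "\<And>W'. P W' \<Longrightarrow> card W' \<le> card W"
    using ex_has_greatest_nat[of P "{}" card] by blast
  have finW: "finite W" using W(1) fin by (auto simp: P_def intro: finite_subset)
  \<comment> \<open>Enlarging \<open>W\<close> by \<open>X\<close> together with at least
    \<open>card X\<close> new edges contradicts the choice of \<open>W\<close>.\<close>
  have extend: False if "X \<noteq> {}" "finite X" "X \<inter> W = {}" "X \<subseteq> verts G" "F \<subseteq> edges G" "card X \<le> card F"
    "\<And>e. e \<in> F \<Longrightarrow> e \<subseteq> X \<union> W \<and> \<not> e \<subseteq> W" for X F
  proof -
    have "finite F" using that fin by (blast intro: finite_subset)
    then have "card {e \<in> edges G. e \<subseteq> W} + card F = card ({e \<in> edges G. e \<subseteq> W} \<union> F)"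
      using that fin by (subst card_Un_disjoint) auto
    also have "\<dots> \<le> card {e \<in> edges G. e \<subseteq> X \<union> W}"
    proof (rule card_mono)
      show "{e \<in> edges G. e \<subseteq> W} \<union> F \<subseteq> {e \<in> edges G. e \<subseteq> X \<union> W}" using that(5,7) by blast
    qed (use fin in simp)
    finally have "P (X \<union> W)" using W(1) that finW by (auto simp: P_def card_Un_disjoint)
    then have "card (X \<union> W) \<le> card W" by (rule W(2))
    then show False using that finW by (simp add: card_Un_disjoint)
  qed
  have "closed_in G (- W)"
    unfolding closed_in_def
  proof (intro ballI allI impI, rule ccontr)
    fix u v assume u: "u \<in> - W" and e: "{u, v} \<in> edges G" and v: "v \<notin> - W"
    show False
      by (rule extend[of "{u}" "{{u, v}}"]) (use u v e simple_graph_edgeD[OF G e] in auto)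
  qed
  have "verts G \<subseteq> W"
  proof (rule ccontr)
    assume "\<not> verts G \<subseteq> W"
    then obtain v where v: "v \<in> verts G" "v \<in> - W" by blast
    obtain xs where xs: "is_cycle G xs" "\<exists>x\<in>set xs. x \<in> reach G v" using cyc v by blast
    then have "set xs \<subseteq> reach G v" by (simp add: cycle_subset_reach_iff)
    also have "\<dots> \<subseteq> - W" by (rule closed_in_imp_reach_subset) fact+
    finally have sub: "set xs \<subseteq> - W" .
    have "xs \<noteq> []" using xs(1) by (auto simp: is_cycle_def)
    have "\<not> e \<subseteq> W" if "e \<in> cycle_edges xs" for e
      using that sub cycle_edges_subset_Pow[OF that] by (auto simp: cycle_edges_def)
    then show False
      using xs(1) sub cycle_edges_subset_Pow[of _ xs] \<open>xs \<noteq> []\<close>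
      by (intro extend[of "set xs" "cycle_edges xs"])
        (auto simp: is_cycle_def card_cycle_edges distinct_card)
  qed
  then have "W = verts G" using W(1) by (auto simp: P_def)
  then show ?thesis using W(1) fin card_mono[of "edges G" "{e \<in> edges G. e \<subseteq> W}"] by (auto simp: P_def)
qed

text \<open>Delete an edge of one cycle that is not on the other. The rest of its cycle bypasses it,
  so the graph stays connected, and the other cycle survives. Hence even after the deletion there
  are at least as many edges as vertices.\<close>

lemma double_chorded_if_two_cycles:
  assumes G: "simple_graph G" and conn: "graph_connected G"
    and c1: "is_cycle G xs" and c2: "is_cycle G ys" and ne: "cycle_edges xs \<noteq> cycle_edges ys"
  shows "double_chorded G"
proof -
  have main: "double_chorded G"
    if c1: "is_cycle G xs" and c2: "is_cycle G ys" and e: "e \<in> cycle_edges ys" "e \<notin> cycle_edges xs" for xs ys e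
  proof -
    obtain i where i: "e = {ys ! i, ys ! (Suc i mod length ys)}" "i < length ys"
      using e by (auto simp: cycle_edges_def)
    have y: "distinct ys" "3 \<le> length ys" "ys \<noteq> []" using c2 by (auto simp: is_cycle_def)
    obtain zs where zs: "set zs = set ys" "distinct zs" "length zs = length ys"
      "cycle_edges zs = cycle_edges ys" "zs \<noteq> []" "e = {last zs, hd zs}"
    proof -
      \<comment> \<open>This rotation makes \<open>e\<close> the closing edge, so the path edges of
        the rotated list form the detour around \<open>e\<close>.\<close>
      let ?z = "rotate (Suc i) ys"
      have "{last ?z, hd ?z} = e"
      proof -
        have "hd ?z = ys ! (Suc i mod length ys)" using y by (rule_tac hd_rotate_conv_nth) auto
        moreover have "last ?z = ys ! ((Suc i + (length ys - 1)) mod length ys)"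
          using y by (simp add: last_conv_nth nth_rotate del: rotate_Suc)
        moreover have "(Suc i + (length ys - 1)) mod length ys = i" using i y by simp
        ultimately show ?thesis using i by simp
      qed
      moreover have "cycle_edges ?z = cycle_edges ys"
      proof -
        have "cycle_edges (rotate1 us) = cycle_edges us" for us :: "'a list"
        proof (cases us)
          case (Cons a as)
          then show ?thesis
            by (cases "as = []") (auto simp: cycle_edges_eq path_edges_append neq_Nil_conv insert_commute)
        qed simp
        then have "cycle_edges (rotate m ys) = cycle_edges ys" for m by (induction m) simp_all
        then show ?thesis .
      qed
      ultimately show thesis using that[of ?z] y by simp
    qed
    let ?G = "UGraph (verts G) (edges G - {e})"
    have sG: "simple_graph ?G" using G by (simp add: simple_graph_def)
    have "path_edges zs \<subseteq> cycle_edges ys" using zs(4,5) cycle_edges_eq[of zs] by blast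
    moreover have "e \<notin> path_edges zs" using closing_edge_notin_path_edges[of zs] zs y by simp
    moreover have "cycle_edges ys \<subseteq> edges G" using c2 by (simp add: is_cycle_def)
    ultimately have "path_edges zs \<subseteq> edges ?G" by (simp add: subset_Diff_insert subset_trans)
    then have detour: "last zs \<in> reach ?G (hd zs)" using zs(5) path_edges_reach[of zs ?G "last zs"] by simp
    have reach_eq': "reach G v \<subseteq> reach ?G v" for v
    proof (rule closed_in_imp_reach_subset)
      show "closed_in G (reach ?G v)"
        unfolding closed_in_def
      proof (intro ballI allI impI)
        fix a b assume a: "a \<in> reach ?G v" and ab: "{a, b} \<in> edges G"
        have "b \<in> reach ?G a"
        proof (cases "{a, b} = e")
          case True
          then have "a = last zs \<and> b = hd zs \<or> a = hd zs \<and> b = last zs"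
            using zs(6) by (simp add: doubleton_eq_iff)
          then show ?thesis using detour reach_sym[OF detour] by auto
        next
          case False
          then show ?thesis using ab by (intro edge_reach) auto
        qed
        then show "b \<in> reach ?G v" by (rule reach_trans[OF a])
      qed
    qed simp
    have cyc: "is_cycle ?G xs" using c1 e by (auto simp: is_cycle_def)
    have "card (verts ?G) \<le> card (edges ?G)"
    proof (rule verts_le_edges_if_reach_cycle[OF sG])
      fix v assume "v \<in> verts ?G"
      moreover obtain x where x: "x \<in> set xs" "x \<in> verts G" using c1 by (cases xs) (auto simp: is_cycle_def)
      ultimately have "x \<in> reach G v" using conn by (auto simp: graph_connected_def reach_def)
      then show "\<exists>xs. is_cycle ?G xs \<and> (\<exists>x\<in>set xs. x \<in> reach ?G v)" using cyc x(1) reach_eq'[of v] by (meson subsetD)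
    qed
    moreover have "e \<in> edges G" using e c2 by (auto simp: is_cycle_def)
    ultimately have "card (verts G) < card (edges G)"
      using simple_graph_finite_edges[OF G]
      by (metis card_Diff1_less order_le_less_trans ugraph.sel)
    then show ?thesis by (rule double_chorded_if_edges_gt_verts[OF G])
  qed
  show ?thesis using main[OF c1 c2] main[OF c2 c1] ne by blast
qed


subsection \<open>Ehrenfeucht--Fraisse games\<close>

text \<open>A position is a relation between vertices; the equality clause makes it the graph of an
  injective partial map.\<close>

definition partial_iso :: "'a ugraph \<Rightarrow> 'b ugraph \<Rightarrow> ('a \<times> 'b) set \<Rightarrow> bool" where
  "partial_iso G G' R \<longleftrightarrow> (\<forall>(a, a')\<in>R. \<forall>(b, b')\<in>R.
     (a = b \<longleftrightarrow> a' = b') \<and> ({a, b} \<in> edges G \<longleftrightarrow> {a', b'} \<in> edges G'))"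

text \<open>\<open>ef k G G' R\<close>: the duplicator wins the \<open>k\<close>-round game from the position in which the pairs
  in \<open>R\<close> have been chosen.\<close>

fun ef :: "nat \<Rightarrow> 'a ugraph \<Rightarrow> 'b ugraph \<Rightarrow> ('a \<times> 'b) set \<Rightarrow> bool" where
  "ef 0 G G' R \<longleftrightarrow> partial_iso G G' R"
| "ef (Suc k) G G' R \<longleftrightarrow> partial_iso G G' R \<and>
     (\<forall>v\<in>verts G. \<exists>v'\<in>verts G'. ef k G G' (insert (v, v') R)) \<and>
     (\<forall>v'\<in>verts G'. \<exists>v\<in>verts G. ef k G G' (insert (v, v') R))"

lemma partial_isoD:
  assumes "partial_iso G G' R" "(a, a') \<in> R" "(b, b') \<in> R"
  shows "a = b \<longleftrightarrow> a' = b'" "{a, b} \<in> edges G \<longleftrightarrow> {a', b'} \<in> edges G'"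
  using assms unfolding partial_iso_def by fast+

lemma partial_isoI:
  assumes "\<And>a a' b b'. (a, a') \<in> R \<Longrightarrow> (b, b') \<in> R \<Longrightarrow> a = b \<longleftrightarrow> a' = b'"
    "\<And>a a' b b'. (a, a') \<in> R \<Longrightarrow> (b, b') \<in> R \<Longrightarrow> {a, b} \<in> edges G \<longleftrightarrow> {a', b'} \<in> edges G'"
  shows "partial_iso G G' R"
  unfolding partial_iso_def using assms by fast

lemma partial_iso_mono: "partial_iso G G' R \<Longrightarrow> R' \<subseteq> R \<Longrightarrow> partial_iso G G' R'"
  by (rule partial_isoI) (simp_all add: partial_isoD subset_iff)

lemma partial_iso_converse: "partial_iso G G' R \<Longrightarrow> partial_iso G' G (R\<inverse>)"
  by (rule partial_isoI) (simp_all add: partial_isoD)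

lemma ef_partial_iso: "ef k G G' R \<Longrightarrow> partial_iso G G' R"
  by (cases k) auto

lemma ef_mono: "ef k G G' R \<Longrightarrow> R' \<subseteq> R \<Longrightarrow> ef k G G' R'"
proof (induction k arbitrary: R R')
  case 0
  then show ?case by (simp add: partial_iso_mono)
next
  case (Suc k)
  have "partial_iso G G' R'" by (rule partial_iso_mono[OF ef_partial_iso[OF Suc.prems(1)] Suc.prems(2)])
  moreover have "insert p R' \<subseteq> insert p R" for p using Suc.prems by blast
  ultimately show ?case using Suc by (metis ef.simps(2))
qed

lemma ef_Suc_imp: "ef (Suc k) G G' R \<Longrightarrow> ef k G G' R"
proof (induction k arbitrary: R)
  case (Suc k)
  show ?case
    unfolding ef.simps(2)[of k]
    using Suc.prems Suc.IH unfolding ef.simps(2)[of "Suc k"] by meson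
qed simp

lemma ef_le: "ef k G G' R \<Longrightarrow> j \<le> k \<Longrightarrow> ef j G G' R"
  by (induction k) (auto simp: le_Suc_eq simp del: ef.simps(2) dest: ef_Suc_imp)

lemma ef_sym: "ef k G G' R \<Longrightarrow> ef k G' G (R\<inverse>)"
proof (induction k arbitrary: R)
  case 0
  then show ?case by (simp add: partial_iso_converse)
next
  case (Suc k)
  have "partial_iso G' G (R\<inverse>)" by (rule partial_iso_converse[OF ef_partial_iso[OF Suc.prems]])
  moreover have "insert (v', v) (R\<inverse>) = (insert (v, v') R)\<inverse>" for v v' by auto
  ultimately show ?case using Suc by (metis ef.simps(2))
qed

lemma ef_trans: "ef k G G' R \<Longrightarrow> ef k G' G'' R' \<Longrightarrow> ef k G G'' (R O R')"
proof (induction k arbitrary: R R')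
  case 0
  show ?case
    unfolding ef.simps
  proof (rule partial_isoI)
    fix a c b d assume "(a, c) \<in> R O R'" "(b, d) \<in> R O R'"
    then obtain x y where *: "(a, x) \<in> R" "(x, c) \<in> R'" "(b, y) \<in> R" "(y, d) \<in> R'" by blast
    show "a = b \<longleftrightarrow> c = d" "{a, b} \<in> edges G \<longleftrightarrow> {c, d} \<in> edges G''"
      using partial_isoD[OF 0(1)[unfolded ef.simps] *(1) *(3)]
        partial_isoD[OF 0(2)[unfolded ef.simps] *(2) *(4)] by auto
  qed
next
  case (Suc k)
  have pi: "partial_iso G G'' (R O R')"
  proof (rule partial_isoI)
    fix a c b d assume "(a, c) \<in> R O R'" "(b, d) \<in> R O R'"
    then obtain x y where *: "(a, x) \<in> R" "(x, c) \<in> R'" "(b, y) \<in> R" "(y, d) \<in> R'" by blast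
    show "a = b \<longleftrightarrow> c = d" "{a, b} \<in> edges G \<longleftrightarrow> {c, d} \<in> edges G''"
      using partial_isoD[OF ef_partial_iso[OF Suc.prems(1)] *(1) *(3)]
        partial_isoD[OF ef_partial_iso[OF Suc.prems(2)] *(2) *(4)] by auto
  qed
  \<comment> \<open>Composing the enlarged positions may also relate older vertices through
    \<open>v'\<close>; such extra pairs are forgotten with \<open>ef_mono\<close>.\<close>
  have step: "ef k G G'' (insert (v, v'') (R O R'))"
    if "ef k G G' (insert (v, v') R)" "ef k G' G'' (insert (v', v'') R')" for v v' v''
    by (rule ef_mono[OF Suc.IH[OF that]]) auto
  show ?case
    unfolding ef.simps
  proof (intro conjI pi ballI)
    fix v assume "v \<in> verts G"
    then obtain v' where v': "v' \<in> verts G'" "ef k G G' (insert (v, v') R)" using Suc.prems(1) by auto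
    then obtain v'' where v'': "v'' \<in> verts G''" "ef k G' G'' (insert (v', v'') R')" using Suc.prems(2) by auto
    then show "\<exists>v''\<in>verts G''. ef k G G'' (insert (v, v'') (R O R'))" using step v'(2) by blast
  next
    fix v'' assume "v'' \<in> verts G''"
    then obtain v' where v': "v' \<in> verts G'" "ef k G' G'' (insert (v', v'') R')" using Suc.prems(2) by auto
    then obtain v where v: "v \<in> verts G" "ef k G G' (insert (v, v') R)" using Suc.prems(1) by auto
    then show "\<exists>v\<in>verts G. ef k G G'' (insert (v, v'') (R O R'))" using step v'(2) by blast
  qed
qed

text \<open>The duplicator answers along \<open>f\<close> in every round.\<close>

lemma ef_bij:
  assumes f: "bij_betw f (verts G) (verts G')"
    and e: "\<And>u v. u \<in> verts G \<Longrightarrow> v \<in> verts G \<Longrightarrow> {u, v} \<in> edges G \<longleftrightarrow> {f u, f v} \<in> edges G'"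
  shows "R \<subseteq> (\<lambda>u. (u, f u)) ` verts G \<Longrightarrow> ef k G G' R"
proof (induction k arbitrary: R)
  case 0
  show ?case
    unfolding ef.simps
  proof (rule partial_isoI)
    fix a a' b b' assume "(a, a') \<in> R" "(b, b') \<in> R"
    then have *: "a \<in> verts G" "a' = f a" "b \<in> verts G" "b' = f b" using 0 by auto
    then show "a = b \<longleftrightarrow> a' = b'" using f by (auto simp: bij_betw_def inj_on_def)
    show "{a, b} \<in> edges G \<longleftrightarrow> {a', b'} \<in> edges G'" using * e by simp
  qed
next
  case (Suc k)
  have pi: "partial_iso G G' R"
  proof (rule partial_isoI)
    fix a a' b b' assume "(a, a') \<in> R" "(b, b') \<in> R"
    then have *: "a \<in> verts G" "a' = f a" "b \<in> verts G" "b' = f b" using Suc.prems by auto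
    then show "a = b \<longleftrightarrow> a' = b'" using f by (auto simp: bij_betw_def inj_on_def)
    show "{a, b} \<in> edges G \<longleftrightarrow> {a', b'} \<in> edges G'" using * e by simp
  qed
  have step: "ef k G G' (insert (v, f v) R)" "f v \<in> verts G'" if "v \<in> verts G" for v
    using Suc.IH[of "insert (v, f v) R"] Suc.prems that f by (auto simp: bij_betw_def)
  show ?case
    unfolding ef.simps
  proof (intro conjI pi ballI)
    fix v assume "v \<in> verts G"
    then show "\<exists>v'\<in>verts G'. ef k G G' (insert (v, v') R)" using step by blast
  next
    fix v' assume "v' \<in> verts G'"
    then obtain v where "v \<in> verts G" "v' = f v" using f by (auto simp: bij_betw_def)
    then show "\<exists>v\<in>verts G. ef k G G' (insert (v, v') R)" using step by blast
  qed
qed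

lemma graph_iso_imp_ef: "graph_iso G G' \<Longrightarrow> ef k G G' {}"
  unfolding graph_iso_def using ef_bij[of _ G G' "{}" k] by blast

lemma ef_refl: "ef k G G {}"
  by (rule ef_bij[of id]) auto

section \<open>Game equivalence preserves the truth of sentences\<close>

fun quantifier_rank :: "fo \<Rightarrow> nat" where
  "quantifier_rank (Eq x y) = 0"
| "quantifier_rank (Adj x y) = 0"
| "quantifier_rank (Neg \<phi>) = quantifier_rank \<phi>"
| "quantifier_rank (Conj \<phi> \<psi>) = max (quantifier_rank \<phi>) (quantifier_rank \<psi>)"
| "quantifier_rank (Ex x \<phi>) = Suc (quantifier_rank \<phi>)"

text \<open>Only the values of the free variables have to form pairs of \<open>R\<close>. Older
  choices may stay in the position when a variable is bound again, which lets the quantifier step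
  add a pair without removing one.\<close>

lemma sat_ef:
  "ef k G G' R \<Longrightarrow> quantifier_rank \<phi> \<le> k \<Longrightarrow> (\<And>x. x \<in> free_vars \<phi> \<Longrightarrow> (s x, s' x) \<in> R) \<Longrightarrow>
    sat G s \<phi> \<longleftrightarrow> sat G' s' \<phi>"
proof (induction \<phi> arbitrary: k R s s')
  case (Eq x y)
  show ?case using partial_isoD(1)[OF ef_partial_iso[OF Eq.prems(1)] Eq.prems(3) Eq.prems(3), of x y] by simp
next
  case (Adj x y)
  show ?case using partial_isoD(2)[OF ef_partial_iso[OF Adj.prems(1)] Adj.prems(3) Adj.prems(3), of x y] by simp
next
  case (Neg \<phi>)
  show ?case using Neg.IH[OF Neg.prems(1)] Neg.prems by simp
next
  case (Conj \<phi> \<psi>)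
  have "sat G s \<phi> \<longleftrightarrow> sat G' s' \<phi>" by (rule Conj.IH(1)[OF Conj.prems(1)]) (use Conj.prems in simp_all)
  moreover have "sat G s \<psi> \<longleftrightarrow> sat G' s' \<psi>" by (rule Conj.IH(2)[OF Conj.prems(1)]) (use Conj.prems in simp_all)
  ultimately show ?case by simp
next
  case (Ex x \<phi>)
  obtain j where j: "k = Suc j" "quantifier_rank \<phi> \<le> j" using Ex.prems(2) by (cases k) auto
  have step: "sat G (s(x := v)) \<phi> \<longleftrightarrow> sat G' (s'(x := v')) \<phi>" if "ef j G G' (insert (v, v') R)" for v v'
    by (rule Ex.IH[OF that j(2)]) (use Ex.prems(3) in auto)
  have *: "\<forall>v\<in>verts G. \<exists>v'\<in>verts G'. ef j G G' (insert (v, v') R)"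
    "\<forall>v'\<in>verts G'. \<exists>v\<in>verts G. ef j G G' (insert (v, v') R)"
    using Ex.prems(1) unfolding j ef.simps by simp_all
  show ?case
  proof
    assume "sat G s (Ex x \<phi>)"
    then obtain v where v: "v \<in> verts G" "sat G (s(x := v)) \<phi>" by auto
    then obtain v' where "v' \<in> verts G'" "ef j G G' (insert (v, v') R)" using * by blast
    then show "sat G' s' (Ex x \<phi>)" using step v by auto
  next
    assume "sat G' s' (Ex x \<phi>)"
    then obtain v' where v': "v' \<in> verts G'" "sat G' (s'(x := v')) \<phi>" by auto
    then obtain v where "v \<in> verts G" "ef j G G' (insert (v, v') R)" using * by blast
    then show "sat G s (Ex x \<phi>)" using step v' by auto
  qed
qed

text \<open>Independence of the assignment comes from playing \<open>G\<close> against itself from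
  the empty position.\<close>

lemma models_iff_sat:
  assumes "sentence \<phi>" shows "models G \<phi> \<longleftrightarrow> sat G s \<phi>"
  unfolding models_def using sat_ef[OF ef_refl, of \<phi> "quantifier_rank \<phi>"] assms
  by (metis empty_iff order_refl sentence_def)

lemma models_ef:
  assumes "sentence \<phi>" "ef k G G' {}" "quantifier_rank \<phi> \<le> k"
  shows "models G \<phi> \<longleftrightarrow> models G' \<phi>"
  using sat_ef[OF assms(2,3), of undefined undefined] assms(1)
  by (auto simp: models_iff_sat[OF assms(1), of _ undefined] sentence_def)

section \<open>Finiteness of the number of game types\<close>

lemma finite_nat_code:
  assumes "finite S"
  shows "x \<in> S \<Longrightarrow> to_nat_on S x < Suc (Max (to_nat_on S ` S))"
    and "x \<in> S \<Longrightarrow> y \<in> S \<Longrightarrow> to_nat_on S x = to_nat_on S y \<Longrightarrow> x = y"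
  using assms inj_on_to_nat_on[OF countable_finite[OF assms]] by (auto simp: less_Suc_eq_le dest: inj_onD)

text \<open>For 0 rounds the type of a tuple is its atomic diagram; for one round more it is the
  diagram together with the set of types of all extensions by one vertex. The bound \<open>N\<close>
  does not depend on the graph. Types are coded as numbers so that the induction keeps the same kind
  of \<open>\<tau>\<close> for every \<open>k\<close>.\<close>

lemma finitely_many_types:
  "\<exists>\<tau> N. (\<forall>G l. \<tau> G l < (N :: nat)) \<and>
     (\<forall>(G :: 'a ugraph) l (G' :: 'a ugraph) l'. length l = r \<longrightarrow> length l' = r \<longrightarrow>
        \<tau> G l = \<tau> G' l' \<longrightarrow> ef k G G' (set (zip l l')))"
proof (induction k arbitrary: r)
  \<comment> \<open>The atomic diagram of the first \<open>r\<close> entries: which of them coincide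
    and which are adjacent.\<close>
  define atm where "atm G l r = ({(i, j). i < r \<and> j < r \<and> l ! i = l ! j},
     {(i, j). i < r \<and> j < r \<and> {l ! i, l ! j} \<in> edges G})" for G :: "'a ugraph" and l r
  define A where "A = (\<lambda>r :: nat. Pow ({..<r} \<times> {..<r}) \<times> Pow ({..<r} \<times> {..<r}))"
  have at_in: "atm G l r \<in> A r" for G l r by (auto simp: atm_def A_def)
  have finA: "finite (A r)" for r by (simp add: A_def)
  have at_pi: "partial_iso G G' (set (zip l l'))"
    if at: "atm G l r = atm G' l' r" and len: "length l = r" "length l' = r" for G G' l l' r
  proof (rule partial_isoI)
    fix a a' b b' assume "(a, a') \<in> set (zip l l')" "(b, b') \<in> set (zip l l')"
    then obtain i j where ij: "i < r" "a = l ! i" "a' = l' ! i" "j < r" "b = l ! j" "b' = l' ! j"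
      using len by (auto simp: in_set_zip)
    have "(i, j) \<in> fst (atm G l r) \<longleftrightarrow> (i, j) \<in> fst (atm G' l' r)"
      "(i, j) \<in> snd (atm G l r) \<longleftrightarrow> (i, j) \<in> snd (atm G' l' r)" using at by simp_all
    then show "a = b \<longleftrightarrow> a' = b'" "{a, b} \<in> edges G \<longleftrightarrow> {a', b'} \<in> edges G'"
      using ij by (simp_all add: atm_def)
  qed
  {
    case 0
    show ?case
    proof (intro exI conjI allI impI)
      show "to_nat_on (A r) (atm G l r) < Suc (Max (to_nat_on (A r) ` A r))" for G l
        by (rule finite_nat_code(1)[OF finA at_in])
      fix G G' :: "'a ugraph" and l l'
      assume *: "length l = r" "length l' = r" "to_nat_on (A r) (atm G l r) = to_nat_on (A r) (atm G' l' r)"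
      have "atm G l r = atm G' l' r" by (rule finite_nat_code(2)[OF finA at_in at_in *(3)])
      then show "ef 0 G G' (set (zip l l'))" unfolding ef.simps by (rule at_pi[OF _ *(1,2)])
    qed
  next
    case (Suc k)
    obtain \<tau> N where \<tau>: "\<And>G l. \<tau> G l < (N :: nat)"
      "\<And>(G :: 'a ugraph) l (G' :: 'a ugraph) l'. length l = Suc r \<Longrightarrow> length l' = Suc r \<Longrightarrow>
        \<tau> G l = \<tau> G' l' \<Longrightarrow> ef k G G' (set (zip l l'))"
      using Suc.IH[of "Suc r"] by metis
    define S where "S G l = (atm G l r, (\<lambda>v. \<tau> G (l @ [v])) ` verts G)" for G l
    have S_in: "S G l \<in> A r \<times> Pow {..<N}" for G l using at_in \<tau>(1) by (auto simp: S_def)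
    define U where "U = A r \<times> Pow {..<N}"
    have finU: "finite U" using finA by (simp add: U_def)
    show ?case
    proof (intro exI conjI allI impI)
      show "to_nat_on U (S G l) < Suc (Max (to_nat_on U ` U))" for G l
        by (rule finite_nat_code(1)[OF finU S_in[folded U_def]])
      fix G G' :: "'a ugraph" and l l'
      assume len: "length l = r" "length l' = r" and "to_nat_on U (S G l) = to_nat_on U (S G' l')"
      then have eq: "S G l = S G' l'" using finite_nat_code(2)[OF finU S_in[folded U_def] S_in[folded U_def]] by simp
      have step: "ef k G G' (insert (v, v') (set (zip l l')))" if "\<tau> G (l @ [v]) = \<tau> G' (l' @ [v'])" for v v'
        using \<tau>(2)[of "l @ [v]" "l' @ [v']" G G'] that len by simp
      have im: "(\<lambda>v. \<tau> G (l @ [v])) ` verts G = (\<lambda>v. \<tau> G' (l' @ [v])) ` verts G'"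
        using eq by (simp add: S_def)
      show "ef (Suc k) G G' (set (zip l l'))"
        unfolding ef.simps
      proof (intro conjI ballI)
        show "partial_iso G G' (set (zip l l'))" by (rule at_pi[OF _ len]) (use eq in \<open>simp add: S_def\<close>)
      next
        fix v assume "v \<in> verts G"
        then have "\<tau> G (l @ [v]) \<in> (\<lambda>v. \<tau> G' (l' @ [v])) ` verts G'" using im by blast
        then show "\<exists>v'\<in>verts G'. ef k G G' (insert (v, v') (set (zip l l')))" using step by blast
      next
        fix v' assume "v' \<in> verts G'"
        then have "\<tau> G' (l' @ [v']) \<in> (\<lambda>v. \<tau> G (l @ [v])) ` verts G" using im by blast
        then obtain v where v: "v \<in> verts G" "\<tau> G' (l' @ [v']) = \<tau> G (l @ [v])" by auto
        show "\<exists>v\<in>verts G. ef k G G' (insert (v, v') (set (zip l l')))"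
          by (rule bexI[OF _ v(1)]) (rule step[OF v(2)[symmetric]])
      qed
    qed
  }
qed

subsection \<open>Playing the game component by component\<close>

lemma component_in_graph_components: "v \<in> verts G \<Longrightarrow> component G v \<in> graph_components G"
  by (simp add: graph_components_eq)

lemma in_verts_component: "v \<in> verts G \<Longrightarrow> v \<in> verts (component G v)"
  by (simp add: component_simps)

lemma graph_components_memD:
  assumes "simple_graph G" "K \<in> graph_components G" "a \<in> verts K"
  shows "K = component G a" "a \<in> verts G"
proof -
  obtain u where u: "u \<in> verts G" "K = component G u" using assms(2) by (auto simp: graph_components_eq)
  then have "a \<in> reach G u" "a \<in> verts G" using assms(3) by (auto simp: component_simps)
  then show "K = component G a" "a \<in> verts G" using u component_eq by metis+
qed

lemma edge_component_iff:
  assumes "simple_graph G" "K \<in> graph_components G" "a \<in> verts K"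
  shows "{a, b} \<in> edges K \<longleftrightarrow> {a, b} \<in> edges G" "{a, b} \<in> edges G \<Longrightarrow> b \<in> verts K"
proof -
  have K: "K = component G a" "a \<in> verts G" using graph_components_memD[OF assms] by auto
  show "{a, b} \<in> edges K \<longleftrightarrow> {a, b} \<in> edges G" using edge_reach[of a b G] by (auto simp: K(1) component_simps)
  show "{a, b} \<in> edges G \<Longrightarrow> b \<in> verts K"
    using edge_reach[of a b G] simple_graph_edgeD[OF assms(1), of a b] by (auto simp: K(1) component_simps)
qed

text \<open>Components are counted up to \<open>k\<close>-round equivalence with \<open>T\<close>,
  not up to isomorphism, so finitely many trees stand for all of them. The same \<open>k\<close>
  bounds rounds and copies because a round opens at most one new component.\<close>

definition tree_rich :: "nat \<Rightarrow> nat ugraph \<Rightarrow> bool" where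
  "tree_rich k G \<longleftrightarrow> (\<forall>T :: nat ugraph. simple_graph T \<and> graph_connected T \<and> cycle_free T \<longrightarrow>
     k \<le> card {K \<in> graph_components G. cycle_free K \<and> ef k K T {}})"

text \<open>The invariant of the duplicator with \<open>j\<close> rounds left: a finite partial
  bijection \<open>\<pi>\<close> between components, where the vertices played inside each matched
  pair form a position still won for \<open>j\<close> rounds and all unmatched components are trees.
  The last clause is a budget: matched trees plus remaining rounds stay at most \<open>k\<close>, so
  a \<open>tree_rich\<close> graph always has a fresh tree to offer.\<close>

definition ef_matching :: "nat \<Rightarrow> nat \<Rightarrow> nat ugraph \<Rightarrow> nat ugraph \<Rightarrow> (nat \<times> nat) set \<Rightarrow>
    (nat ugraph \<times> nat ugraph) set \<Rightarrow> bool" where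
  "ef_matching k j G G' R \<pi> \<longleftrightarrow>
     simple_graph G \<and> simple_graph G' \<and> tree_rich k G \<and> tree_rich k G' \<and>
     finite \<pi> \<and> \<pi> \<subseteq> graph_components G \<times> graph_components G' \<and>
     (\<forall>K K' L L'. (K, K') \<in> \<pi> \<longrightarrow> (L, L') \<in> \<pi> \<longrightarrow> (K = L \<longleftrightarrow> K' = L')) \<and>
     (\<forall>K K'. (K, K') \<in> \<pi> \<longrightarrow> ef j K K' (R \<inter> verts K \<times> verts K') \<and> (cycle_free K \<longleftrightarrow> cycle_free K')) \<and>
     (\<forall>a a'. (a, a') \<in> R \<longrightarrow> (\<exists>K K'. (K, K') \<in> \<pi> \<and> a \<in> verts K \<and> a' \<in> verts K')) \<and>
     (\<forall>K\<in>graph_components G. K \<notin> Domain \<pi> \<longrightarrow> cycle_free K) \<and>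
     (\<forall>K'\<in>graph_components G'. K' \<notin> Range \<pi> \<longrightarrow> cycle_free K') \<and>
     card {p \<in> \<pi>. cycle_free (fst p)} + j \<le> k"

text \<open>Reduces the moves of the spoiler in \<open>G'\<close> to moves in
  \<open>G\<close>.\<close>

lemma ef_matching_sym:
  assumes "ef_matching k j G G' R \<pi>" shows "ef_matching k j G' G (R\<inverse>) (\<pi>\<inverse>)"
proof -
  have *: "ef j K' K (R\<inverse> \<inter> verts K' \<times> verts K)" if "ef j K K' (R \<inter> verts K \<times> verts K')" for K K'
  proof -
    have "(R \<inter> verts K \<times> verts K')\<inverse> = R\<inverse> \<inter> verts K' \<times> verts K" by auto
    then show ?thesis using ef_sym[OF that] by simp
  qed
  have "{p \<in> \<pi>\<inverse>. cycle_free (fst p)} = prod.swap ` {p \<in> \<pi>. cycle_free (fst p)}"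
  proof (rule set_eqI)
    fix p :: "nat ugraph \<times> nat ugraph"
    obtain K K' where p: "p = (K', K)" by (cases p)
    have "(K, K') \<in> \<pi> \<Longrightarrow> cycle_free K \<longleftrightarrow> cycle_free K'" using assms by (simp add: ef_matching_def)
    then show "p \<in> {p \<in> \<pi>\<inverse>. cycle_free (fst p)} \<longleftrightarrow> p \<in> prod.swap ` {p \<in> \<pi>. cycle_free (fst p)}"
      by (auto simp: p)
  qed
  then have "card {p \<in> \<pi>\<inverse>. cycle_free (fst p)} = card {p \<in> \<pi>. cycle_free (fst p)}"
    by (simp add: card_image)
  moreover have "\<pi> \<subseteq> graph_components G \<times> graph_components G'"
    "\<forall>K K' L L'. (K, K') \<in> \<pi> \<longrightarrow> (L, L') \<in> \<pi> \<longrightarrow> (K = L \<longleftrightarrow> K' = L')"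
    "\<forall>K K'. (K, K') \<in> \<pi> \<longrightarrow> ef j K K' (R \<inter> verts K \<times> verts K') \<and> (cycle_free K \<longleftrightarrow> cycle_free K')"
    "\<forall>a a'. (a, a') \<in> R \<longrightarrow> (\<exists>K K'. (K, K') \<in> \<pi> \<and> a \<in> verts K \<and> a' \<in> verts K')"
    using assms unfolding ef_matching_def by simp_all
  then have "\<pi>\<inverse> \<subseteq> graph_components G' \<times> graph_components G"
    "\<forall>K K' L L'. (K, K') \<in> \<pi>\<inverse> \<longrightarrow> (L, L') \<in> \<pi>\<inverse> \<longrightarrow> (K = L \<longleftrightarrow> K' = L')"
    "\<forall>K K'. (K, K') \<in> \<pi>\<inverse> \<longrightarrow> ef j K K' (R\<inverse> \<inter> verts K \<times> verts K') \<and> (cycle_free K \<longleftrightarrow> cycle_free K')"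
    "\<forall>a a'. (a, a') \<in> R\<inverse> \<longrightarrow> (\<exists>K K'. (K, K') \<in> \<pi>\<inverse> \<and> a \<in> verts K \<and> a' \<in> verts K')"
    using * by (blast, metis converse_iff, metis converse_iff, metis converse_iff)
  ultimately show ?thesis using assms unfolding ef_matching_def by simp
qed

text \<open>A move in a matched component is answered in its partner by the local game. A move in an
  unmatched component is a move in a tree; the budget leaves an unmatched tree of the same
  \<open>k\<close>-round type on the other side. Nothing has been played in either tree, so their
  equivalence covers the remaining \<open>Suc j\<close> rounds.\<close>

lemma ef_matching_forth:
  assumes inv: "ef_matching k (Suc j) G G' R \<pi>" and v: "v \<in> verts G"
  shows "\<exists>v'\<in>verts G'. \<exists>\<pi>'. ef_matching k j G G' (insert (v, v') R) \<pi>'"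
proof -
  have G: "simple_graph G" "simple_graph G'" and rich: "tree_rich k G" "tree_rich k G'" and fin: "finite \<pi>"
    and comps: "\<And>K K'. (K, K') \<in> \<pi> \<Longrightarrow> K \<in> graph_components G \<and> K' \<in> graph_components G'"
    and inj: "\<And>K K' L L'. (K, K') \<in> \<pi> \<Longrightarrow> (L, L') \<in> \<pi> \<Longrightarrow> K = L \<longleftrightarrow> K' = L'"
    and efj: "\<And>K K'. (K, K') \<in> \<pi> \<Longrightarrow> ef (Suc j) K K' (R \<inter> verts K \<times> verts K')"
    and cf: "\<And>K K'. (K, K') \<in> \<pi> \<Longrightarrow> cycle_free K \<longleftrightarrow> cycle_free K'"
    and cover: "\<And>a a'. (a, a') \<in> R \<Longrightarrow> \<exists>K K'. (K, K') \<in> \<pi> \<and> a \<in> verts K \<and> a' \<in> verts K'"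
    and un: "\<And>K. K \<in> graph_components G \<Longrightarrow> K \<notin> Domain \<pi> \<Longrightarrow> cycle_free K"
    and un': "\<And>K. K \<in> graph_components G' \<Longrightarrow> K \<notin> Range \<pi> \<Longrightarrow> cycle_free K"
    and cnt: "card {p \<in> \<pi>. cycle_free (fst p)} + Suc j \<le> k"
    using inv unfolding ef_matching_def by (simp, simp, simp, simp, simp, fast, fast, fast, fast, fast, fast, fast, simp)
  define K where "K = component G v"
  have K: "K \<in> graph_components G" "v \<in> verts K"
    using v by (simp_all add: K_def component_in_graph_components in_verts_component)
  have notin: "v \<notin> verts L" if "L \<in> graph_components G" "L \<noteq> K" for L
    using graph_components_memD[OF G(1) that(1)] that(2) K_def by metis
  show ?thesis
  proof (cases "K \<in> Domain \<pi>")
    case True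
    then obtain K' where K': "(K, K') \<in> \<pi>" by blast
    obtain v' where v': "v' \<in> verts K'" "ef j K K' (insert (v, v') (R \<inter> verts K \<times> verts K'))"
      using efj[OF K'] K(2) by auto
    have "v' \<in> verts G'" using graph_components_memD(2)[OF G(2) _ v'(1)] comps[OF K'] by simp
    moreover have "ef j L L' (insert (v, v') R \<inter> verts L \<times> verts L')" if L: "(L, L') \<in> \<pi>" for L L'
    proof (cases "L = K")
      case True
      then have "L' = K'" using inj[OF L K'] by simp
      then show ?thesis by (intro ef_mono[OF v'(2)[folded \<open>L = K\<close> \<open>L' = K'\<close>]]) auto
    next
      case False
      then have "v \<notin> verts L" using notin comps[OF L] by simp
      then have "insert (v, v') R \<inter> verts L \<times> verts L' = R \<inter> verts L \<times> verts L'" by auto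
      then show ?thesis using ef_Suc_imp[OF efj[OF L]] by simp
    qed
    moreover have "\<exists>K K'. (K, K') \<in> \<pi> \<and> a \<in> verts K \<and> a' \<in> verts K'" if "(a, a') \<in> insert (v, v') R" for a a'
      using that cover K' K(2) v'(1) by (metis insert_iff prod.inject)
    moreover have "\<pi> \<subseteq> graph_components G \<times> graph_components G'" using comps by auto
    ultimately have "ef_matching k j G G' (insert (v, v') R) \<pi>"
      unfolding ef_matching_def using G rich fin inj cf un un' cnt by simp
    then show ?thesis using \<open>v' \<in> verts G'\<close> by blast
  next
    case False
    have tree: "cycle_free K" "simple_graph K" "graph_connected K"
      using un[OF K(1) False] simple_graph_component[OF G(1)] graph_connected_component[OF G(1) v]
      by (simp_all add: K_def)
    \<comment> \<open>\<open>A\<close> collects the suitable trees of \<open>G'\<close>,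
      \<open>B\<close> the trees that are already matched; the budget makes \<open>B\<close> smaller
      than \<open>A\<close>.\<close>
    define A where "A = {L \<in> graph_components G'. cycle_free L \<and> ef k L K {}}"
    define B where "B = snd ` {p \<in> \<pi>. cycle_free (fst p)}"
    have "k \<le> card A" using rich(2) tree unfolding tree_rich_def A_def by blast
    moreover have "card B \<le> card {p \<in> \<pi>. cycle_free (fst p)}"
      unfolding B_def by (rule card_image_le) (use fin in simp)
    ultimately have "card B < card A" using cnt by linarith
    moreover have "finite B" using fin by (simp add: B_def)
    ultimately have "\<not> A \<subseteq> B" using card_mono[of B A] by linarith
    then obtain K' where K': "K' \<in> graph_components G'" "cycle_free K'" "ef k K' K {}" "K' \<notin> B"
      by (auto simp: A_def)
    have nR: "K' \<notin> Range \<pi>"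
    proof
      assume "K' \<in> Range \<pi>"
      then obtain L where L: "(L, K') \<in> \<pi>" by blast
      then have "cycle_free L" using cf K' by blast
      then have "K' \<in> B" using L by (force simp: B_def)
      then show False using K' by simp
    qed
    have "ef k K K' {}" using ef_sym[OF K'(3)] by simp
    then have "ef (Suc j) K K' {}" by (rule ef_le) (use cnt in simp)
    then obtain v' where v': "v' \<in> verts K'" "ef j K K' {(v, v')}" using K(2) by auto
    let ?\<pi> = "insert (K, K') \<pi>"
    have "v' \<in> verts G'" using graph_components_memD(2)[OF G(2) K'(1) v'(1)] .
    have efj': "ef j L L' (insert (v, v') R \<inter> verts L \<times> verts L')" if L: "(L, L') \<in> ?\<pi>" for L L'
    proof (cases "L = K")
      case True
      then have "L' = K'" using L False by blast
      have "(a, a') \<notin> R" if "a \<in> verts K" for a a'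
      proof
        assume "(a, a') \<in> R"
        then obtain M M' where M: "(M, M') \<in> \<pi>" "a \<in> verts M" using cover by blast
        then have "M = K" using graph_components_memD(1)[OF G(1)] comps[OF M(1)] K(1) that by metis
        then show False using M False by blast
      qed
      then show ?thesis by (intro ef_mono[OF v'(2)[folded \<open>L = K\<close> \<open>L' = K'\<close>]]) (use \<open>L = K\<close> in auto)
    next
      case False
      then have L: "(L, L') \<in> \<pi>" using L by simp
      have "v \<notin> verts L" using notin comps[OF L] False by simp
      then have "insert (v, v') R \<inter> verts L \<times> verts L' = R \<inter> verts L \<times> verts L'" by auto
      then show ?thesis using ef_Suc_imp[OF efj[OF L]] by simp
    qed
    have cover': "\<exists>K K'. (K, K') \<in> ?\<pi> \<and> a \<in> verts K \<and> a' \<in> verts K'" if "(a, a') \<in> insert (v, v') R" for a a'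
      using that cover K(2) v'(1) by (metis insert_iff prod.inject)
    have inj': "M = L \<longleftrightarrow> M' = L'" if "(M, M') \<in> ?\<pi>" "(L, L') \<in> ?\<pi>" for M M' L L'
      using that inj False nR by blast
    have cf': "cycle_free M \<longleftrightarrow> cycle_free M'" if "(M, M') \<in> ?\<pi>" for M M'
      using that cf tree(1) K'(2) by blast
    have "{p \<in> ?\<pi>. cycle_free (fst p)} \<subseteq> insert (K, K') {p \<in> \<pi>. cycle_free (fst p)}" by auto
    then have "card {p \<in> ?\<pi>. cycle_free (fst p)} \<le> card (insert (K, K') {p \<in> \<pi>. cycle_free (fst p)})"
      by (intro card_mono) (use fin in auto)
    also have "\<dots> \<le> Suc (card {p \<in> \<pi>. cycle_free (fst p)})" by (rule card_insert_le_m1) simp_all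
    finally have cnt': "card {p \<in> ?\<pi>. cycle_free (fst p)} + j \<le> k" using cnt by linarith
    have sub: "?\<pi> \<subseteq> graph_components G \<times> graph_components G'" using comps K(1) K'(1) by auto
    have "ef_matching k j G G' (insert (v, v') R) ?\<pi>"
      unfolding ef_matching_def
    proof (intro conjI)
      show "\<forall>K\<in>graph_components G. K \<notin> Domain ?\<pi> \<longrightarrow> cycle_free K" using un by blast
      show "\<forall>K\<in>graph_components G'. K \<notin> Range ?\<pi> \<longrightarrow> cycle_free K" using un' by blast
      show "\<forall>a a'. (a, a') \<in> insert (v, v') R \<longrightarrow> (\<exists>K K'. (K, K') \<in> ?\<pi> \<and> a \<in> verts K \<and> a' \<in> verts K')"
        using cover' by metis
      show "\<forall>K K'. (K, K') \<in> ?\<pi> \<longrightarrow>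
        ef j K K' (insert (v, v') R \<inter> verts K \<times> verts K') \<and> (cycle_free K \<longleftrightarrow> cycle_free K')"
        using efj' cf' by metis
      show "\<forall>K K' L L'. (K, K') \<in> ?\<pi> \<longrightarrow> (L, L') \<in> ?\<pi> \<longrightarrow> (K = L \<longleftrightarrow> K' = L')"
        using inj' by metis
    qed (use G rich fin sub cnt' in simp_all)
    then show ?thesis using \<open>v' \<in> verts G'\<close> by blast
  qed
qed

text \<open>Two pairs in the same matched component are compared by its local game; vertices in
  different components are distinct and non-adjacent on both sides.\<close>

lemma ef_matching_partial_iso:
  assumes inv: "ef_matching k j G G' R \<pi>" shows "partial_iso G G' R"
proof -
  have G: "simple_graph G" "simple_graph G'"
    and comps: "\<And>K K'. (K, K') \<in> \<pi> \<Longrightarrow> K \<in> graph_components G \<and> K' \<in> graph_components G'"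
    and inj: "\<And>K K' L L'. (K, K') \<in> \<pi> \<Longrightarrow> (L, L') \<in> \<pi> \<Longrightarrow> K = L \<longleftrightarrow> K' = L'"
    and efj: "\<And>K K'. (K, K') \<in> \<pi> \<Longrightarrow> ef j K K' (R \<inter> verts K \<times> verts K')"
    and cover: "\<And>a a'. (a, a') \<in> R \<Longrightarrow> \<exists>K K'. (K, K') \<in> \<pi> \<and> a \<in> verts K \<and> a' \<in> verts K'"
    using inv unfolding ef_matching_def by (simp, simp, fast, fast, fast, fast)
  have "(a = b \<longleftrightarrow> a' = b') \<and> ({a, b} \<in> edges G \<longleftrightarrow> {a', b'} \<in> edges G')"
    if R: "(a, a') \<in> R" "(b, b') \<in> R" for a a' b b'
  proof -
    obtain K K' where K: "(K, K') \<in> \<pi>" "a \<in> verts K" "a' \<in> verts K'" using cover[OF R(1)] by blast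
    obtain L L' where L: "(L, L') \<in> \<pi>" "b \<in> verts L" "b' \<in> verts L'" using cover[OF R(2)] by blast
    have KL: "K \<in> graph_components G" "K' \<in> graph_components G'"
      "L \<in> graph_components G" "L' \<in> graph_components G'" using comps K(1) L(1) by blast+
    note e = edge_component_iff[OF G(1) KL(1) K(2), of b]
    note e' = edge_component_iff[OF G(2) KL(2) K(3), of b']
    show ?thesis
    proof (cases "K = L")
      case True
      then have "K' = L'" using inj[OF K(1) L(1)] by simp
      then have "(a, a') \<in> R \<inter> verts K \<times> verts K'" "(b, b') \<in> R \<inter> verts K \<times> verts K'"
        using R K L True by auto
      from partial_isoD[OF ef_partial_iso[OF efj[OF K(1)]] this] show ?thesis using e(1) e'(1) by simp
    next
      case False
      then have "K' \<noteq> L'" using inj[OF K(1) L(1)] by simp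
      have "b \<notin> verts K" using False graph_components_memD(1)[OF G(1)] KL L(2) by metis
      moreover have "b' \<notin> verts K'" using \<open>K' \<noteq> L'\<close> graph_components_memD(1)[OF G(2)] KL L(3) by metis
      ultimately show ?thesis using e(2) e'(2) K by metis
    qed
  qed
  then show ?thesis unfolding partial_iso_def by fast
qed

lemma ef_matching_imp_ef: "ef_matching k j G G' R \<pi> \<Longrightarrow> ef j G G' R"
proof (induction j arbitrary: R \<pi>)
  case 0
  then show ?case by (simp add: ef_matching_partial_iso)
next
  case (Suc j)
  show ?case
    unfolding ef.simps
  proof (intro conjI ballI)
    show "partial_iso G G' R" by (rule ef_matching_partial_iso[OF Suc.prems])
  next
    fix v assume "v \<in> verts G"
    then show "\<exists>v'\<in>verts G'. ef j G G' (insert (v, v') R)"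
      using ef_matching_forth[OF Suc.prems] Suc.IH by metis
  next
    fix v' assume "v' \<in> verts G'"
    then obtain v \<pi>' where v: "v \<in> verts G" "ef_matching k j G' G (insert (v', v) (R\<inverse>)) \<pi>'"
      using ef_matching_forth[OF ef_matching_sym[OF Suc.prems]] by metis
    have "(insert (v', v) (R\<inverse>))\<inverse> = insert (v, v') R" by auto
    then have "ef_matching k j G G' (insert (v, v') R) (\<pi>'\<inverse>)" using ef_matching_sym[OF v(2)] by simp
    then show "\<exists>v\<in>verts G. ef j G G' (insert (v, v') R)" using Suc.IH v(1) by blast
  qed
qed


subsection \<open>Isomorphisms\<close>

definition iso_on :: "('a \<Rightarrow> 'b) \<Rightarrow> 'a ugraph \<Rightarrow> 'b ugraph \<Rightarrow> bool" where
  "iso_on f G H \<longleftrightarrow> bij_betw f (verts G) (verts H) \<and>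
     (\<forall>u\<in>verts G. \<forall>v\<in>verts G. {u, v} \<in> edges G \<longleftrightarrow> {f u, f v} \<in> edges H)"

lemma graph_iso_iff: "graph_iso G H \<longleftrightarrow> (\<exists>f. iso_on f G H)"
  by (simp add: graph_iso_def iso_on_def)

lemma iso_on_verts: "iso_on f G H \<Longrightarrow> u \<in> verts G \<Longrightarrow> f u \<in> verts H"
  by (auto simp: iso_on_def bij_betw_def)

lemma iso_on_edge:
  "iso_on f G H \<Longrightarrow> u \<in> verts G \<Longrightarrow> v \<in> verts G \<Longrightarrow> {u, v} \<in> edges G \<longleftrightarrow> {f u, f v} \<in> edges H"
  by (simp add: iso_on_def)

lemma iso_on_inv:
  assumes "iso_on f G H"
  shows "iso_on (the_inv_into (verts G) f) H G"
    and "\<And>u. u \<in> verts G \<Longrightarrow> the_inv_into (verts G) f (f u) = u"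
    and "\<And>v. v \<in> verts H \<Longrightarrow> f (the_inv_into (verts G) f v) = v"
proof -
  let ?g = "the_inv_into (verts G) f"
  have f: "bij_betw f (verts G) (verts H)" using assms by (simp add: iso_on_def)
  have g: "bij_betw ?g (verts H) (verts G)" by (rule bij_betw_the_inv_into[OF f])
  show 1: "\<And>u. u \<in> verts G \<Longrightarrow> ?g (f u) = u" using f by (simp add: bij_betw_def the_inv_into_f_f)
  show 2: "\<And>v. v \<in> verts H \<Longrightarrow> f (?g v) = v"
    using f by (simp add: bij_betw_def f_the_inv_into_f)
  have "?g v \<in> verts G" if "v \<in> verts H" for v using g that by (auto simp: bij_betw_def)
  then show "iso_on ?g H G" using g iso_on_edge[OF assms] 2 by (simp add: iso_on_def)
qed

lemma iso_on_id: "iso_on id G G"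
  by (simp add: iso_on_def)

lemma iso_on_comp: "iso_on f G H \<Longrightarrow> iso_on g H K \<Longrightarrow> iso_on (g \<circ> f) G K"
  using iso_on_verts[of f G H] unfolding iso_on_def by (auto intro: bij_betw_trans)

lemma graph_iso_refl: "graph_iso G G" and
  graph_iso_sym: "graph_iso G H \<Longrightarrow> graph_iso H G" and
  graph_iso_trans: "graph_iso G H \<Longrightarrow> graph_iso H K \<Longrightarrow> graph_iso G K"
  unfolding graph_iso_iff by (blast intro: iso_on_id iso_on_inv(1) iso_on_comp)+

lemma iso_on_reach:
  assumes G: "simple_graph G" and f: "iso_on f G H" and u: "u \<in> verts G" and v: "v \<in> reach G u"
  shows "f v \<in> reach H (f u)"
proof -
  have "(u, v) \<in> (adj G)\<^sup>*" using v by (simp add: reach_def)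
  then show ?thesis
  proof (induction rule: rtrancl_induct)
    case (step y z)
    then have yz: "{y, z} \<in> edges G" by (simp add: adj_def)
    then have "{f y, f z} \<in> edges H" using simple_graph_edgeD[OF G yz] iso_on_edge[OF f] by simp
    then show ?case using step.IH edge_reach reach_trans by metis
  qed simp
qed

lemma iso_on_reach_iff:
  assumes G: "simple_graph G" "simple_graph H" and f: "iso_on f G H"
    and u: "u \<in> verts G" and v: "v \<in> verts G"
  shows "f v \<in> reach H (f u) \<longleftrightarrow> v \<in> reach G u"
  using iso_on_reach[OF G(1) f u] iso_on_reach[OF G(2) iso_on_inv(1)[OF f] iso_on_verts[OF f u], of "f v"]
    iso_on_inv(2)[OF f] u v by auto

lemma iso_on_component:
  assumes G: "simple_graph G" "simple_graph H" and f: "iso_on f G H" and u: "u \<in> verts G"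
  shows "iso_on f (component G u) (component H (f u))"
proof -
  note R = iso_on_reach_iff[OF G f u]
  have sub: "reach G u \<subseteq> verts G" by (rule reach_subset_verts[OF G(1) u])
  have sub': "reach H (f u) \<subseteq> verts H" by (rule reach_subset_verts[OF G(2) iso_on_verts[OF f u]])
  have "f ` reach G u = reach H (f u)"
  proof
    show "f ` reach G u \<subseteq> reach H (f u)" using R sub by auto
    show "reach H (f u) \<subseteq> f ` reach G u"
    proof
      fix w assume w: "w \<in> reach H (f u)"
      let ?v = "the_inv_into (verts G) f w"
      have "w \<in> verts H" using w sub' by blast
      then have "?v \<in> verts G" "f ?v = w" using iso_on_verts[OF iso_on_inv(1)[OF f]] iso_on_inv(3)[OF f] by auto
      then have "?v \<in> reach G u" using R[of ?v] w by simp
      then show "w \<in> f ` reach G u" using \<open>f ?v = w\<close> by (metis imageI)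
    qed
  qed
  moreover have "inj_on f (reach G u)"
    using f sub by (auto simp: iso_on_def bij_betw_def intro: inj_on_subset)
  ultimately have "bij_betw f (verts (component G u)) (verts (component H (f u)))"
    using sub sub' by (simp add: component_simps bij_betw_def Int_absorb1)
  moreover have "{a, b} \<in> edges (component G u) \<longleftrightarrow> {f a, f b} \<in> edges (component H (f u))"
    if "a \<in> verts (component G u)" "b \<in> verts (component G u)" for a b
    using that iso_on_edge[OF f, of a b] R[of a] R[of b] by (auto simp: component_simps)
  ultimately show ?thesis by (simp add: iso_on_def)
qed

lemma path_edges_map: "path_edges (map f xs) = (`) f ` path_edges xs"
  by (induction xs rule: path_edges.induct) auto

lemma cycle_edges_map: "xs \<noteq> [] \<Longrightarrow> cycle_edges (map f xs) = (`) f ` cycle_edges xs"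
  by (simp add: cycle_edges_eq path_edges_map last_map hd_map)

lemma iso_on_is_cycle:
  assumes f: "iso_on f G H" and c: "is_cycle G xs"
  shows "is_cycle H (map f xs)"
proof -
  have xs: "length xs \<ge> 3" "distinct xs" "set xs \<subseteq> verts G" "cycle_edges xs \<subseteq> edges G" "xs \<noteq> []"
    using c by (auto simp: is_cycle_def)
  have "inj_on f (set xs)" using f xs(3) by (auto simp: iso_on_def bij_betw_def intro: inj_on_subset)
  moreover have "f ` set xs \<subseteq> verts H" using iso_on_verts[OF f] xs(3) by auto
  moreover have "(`) f ` cycle_edges xs \<subseteq> edges H"
  proof
    fix e assume "e \<in> (`) f ` cycle_edges xs"
    then obtain d where d: "d \<in> cycle_edges xs" "e = f ` d" by blast
    then obtain i where i: "d = {xs ! i, xs ! (Suc i mod length xs)}" "i < length xs"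
      by (auto simp: cycle_edges_def)
    have "Suc i mod length xs < length xs" using xs by simp
    then have "xs ! i \<in> verts G" "xs ! (Suc i mod length xs) \<in> verts G" using i xs(3) by (auto dest: nth_mem)
    moreover have "d \<in> edges G" using d xs(4) by blast
    ultimately show "e \<in> edges H" using iso_on_edge[OF f] i d by simp
  qed
  ultimately show ?thesis
    using xs by (simp add: is_cycle_def distinct_map cycle_edges_map)
qed

lemma iso_on_cycle_free:
  assumes "iso_on f G H" shows "cycle_free G \<longleftrightarrow> cycle_free H"
  unfolding cycle_free_def
  using iso_on_is_cycle[OF assms] iso_on_is_cycle[OF iso_on_inv(1)[OF assms]] by meson

lemma iso_on_graph_connected:
  assumes G: "simple_graph G" and f: "iso_on f G H" and c: "graph_connected G"
  shows "graph_connected H"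
  unfolding graph_connected_def
proof (intro conjI ballI)
  have b: "f ` verts G = verts H" using f by (auto simp: iso_on_def bij_betw_def)
  then show "verts H \<noteq> {}" using c by (auto simp: graph_connected_def)
  fix a b' assume "a \<in> verts H" "b' \<in> verts H"
  then obtain u v where uv: "a = f u" "b' = f v" "u \<in> verts G" "v \<in> verts G" using b by blast
  then have "v \<in> reach G u" using c by (simp add: graph_connected_def reach_def)
  then have "f v \<in> reach H (f u)" using iso_on_reach[OF G f uv(3)] by simp
  then show "(a, b') \<in> (adj H)\<^sup>*" using uv by (simp add: reach_def)
qed

lemma unicycle_iff:
  "unicycle G \<longleftrightarrow> graph_connected G \<and> \<not> cycle_free G \<and>
     (\<forall>xs ys. is_cycle G xs \<longrightarrow> is_cycle G ys \<longrightarrow> cycle_edges xs = cycle_edges ys)"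
proof -
  have "(\<exists>!C. C \<in> f ` A) \<longleftrightarrow> (\<exists>x. x \<in> A) \<and> (\<forall>x y. x \<in> A \<longrightarrow> y \<in> A \<longrightarrow> f x = f y)"
    for f :: "'a list \<Rightarrow> 'a set set" and A by blast
  then show ?thesis by (simp add: unicycle_def graph_cycles_eq cycle_free_def)
qed

lemma iso_on_unicycle:
  assumes G: "simple_graph G" and f: "iso_on f G H" and c: "unicycle G"
  shows "unicycle H"
proof -
  let ?g = "the_inv_into (verts G) f"
  have "cycle_edges xs = cycle_edges ys" if "is_cycle H xs" "is_cycle H ys" for xs ys
  proof -
    have pull_back: "cycle_edges zs = (`) f ` cycle_edges (map ?g zs)" if z: "is_cycle H zs" for zs
    proof -
      have zs: "zs \<noteq> []" "set zs \<subseteq> verts H" using z by (auto simp: is_cycle_def)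
      have "map f (map ?g zs) = zs" using zs(2) iso_on_inv(3)[OF f] by (simp add: map_idI subset_iff)
      then show ?thesis using cycle_edges_map[of "map ?g zs" f] zs(1) by simp
    qed
    have "cycle_edges (map ?g xs) = cycle_edges (map ?g ys)"
      using c that iso_on_is_cycle[OF iso_on_inv(1)[OF f]] by (simp add: unicycle_iff)
    then show ?thesis using pull_back[OF that(1)] pull_back[OF that(2)] by simp
  qed
  moreover have "graph_connected H" "\<not> cycle_free H"
    using c iso_on_graph_connected[OF G f] iso_on_cycle_free[OF f] by (simp_all add: unicycle_iff)
  ultimately show ?thesis unfolding unicycle_iff by blast
qed

lemma iso_on_all_unicyclic:
  assumes G: "simple_graph G" "simple_graph H" and f: "iso_on f G H"
    and c: "\<forall>K\<in>graph_components G. unicycle K"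
  shows "\<forall>K\<in>graph_components H. unicycle K"
proof
  fix K assume "K \<in> graph_components H"
  then obtain w where "w \<in> verts H" "K = component H w" by (auto simp: graph_components_eq)
  moreover have "verts H = f ` verts G" using f by (simp add: iso_on_def bij_betw_def)
  ultimately obtain u where u: "u \<in> verts G" "K = component H (f u)" by auto
  have "unicycle (component G u)" by (rule bspec[OF c component_in_graph_components[OF u(1)]])
  then show "unicycle K"
    using iso_on_unicycle[OF simple_graph_component[OF G(1)] iso_on_component[OF G f u(1)]] u by simp
qed

subsection \<open>The unicyclic part\<close>

definition frag_verts :: "'a ugraph \<Rightarrow> 'a set" where
  "frag_verts G = {u \<in> verts G. unicycle (component G u)}"

text \<open>The union of components becomes an induced subgraph on a single closed vertex set, the
  form to which the lemmas on \<open>closed_in\<close> apply.\<close>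

lemma Frag_eq:
  assumes G: "simple_graph G" shows "Frag G = induced_subgraph G (frag_verts G)"
proof -
  let ?U = "{K \<in> graph_components G. unicycle K}"
  have V: "(\<Union>K\<in>?U. verts K) = frag_verts G"
  proof (rule set_eqI)
    fix u
    show "u \<in> (\<Union>K\<in>?U. verts K) \<longleftrightarrow> u \<in> frag_verts G"
    proof
      assume "u \<in> (\<Union>K\<in>?U. verts K)"
      then obtain K where K: "K \<in> graph_components G" "unicycle K" "u \<in> verts K" by blast
      then show "u \<in> frag_verts G" using graph_components_memD[OF G K(1,3)] by (simp add: frag_verts_def)
    next
      assume "u \<in> frag_verts G"
      then show "u \<in> (\<Union>K\<in>?U. verts K)"
        using component_in_graph_components[of u G] in_verts_component[of u G] by (auto simp: frag_verts_def)
    qed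
  qed
  have E: "(\<Union>K\<in>?U. edges K) = {e \<in> edges G. e \<subseteq> frag_verts G}"
  proof (rule set_eqI)
    fix e
    show "e \<in> (\<Union>K\<in>?U. edges K) \<longleftrightarrow> e \<in> {e \<in> edges G. e \<subseteq> frag_verts G}"
    proof
      assume "e \<in> (\<Union>K\<in>?U. edges K)"
      then obtain K where K: "K \<in> ?U" "e \<in> edges K" by blast
      then obtain u where u: "u \<in> verts G" "K = component G u" by (auto simp: graph_components_eq)
      then have "e \<subseteq> verts K"
        using simple_graph_component[OF G, of u] K(2) by (simp add: simple_graph_def)
      then have "e \<subseteq> (\<Union>K\<in>?U. verts K)" using K(1) by blast
      moreover have "e \<in> edges G" using K(2) u by (simp add: component_simps)
      ultimately show "e \<in> {e \<in> edges G. e \<subseteq> frag_verts G}" using V by simp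
    next
      assume e: "e \<in> {e \<in> edges G. e \<subseteq> frag_verts G}"
      then obtain a b where ab: "e = {a, b}" using simple_graph_edgeE[OF G] by (metis mem_Collect_eq)
      then have a: "a \<in> frag_verts G" "{a, b} \<in> edges G" using e by auto
      then have "component G a \<in> ?U" using component_in_graph_components[of a G] by (simp add: frag_verts_def)
      moreover have "e \<in> edges (component G a)" using a edge_reach[of a b G] ab by (simp add: component_simps)
      ultimately show "e \<in> (\<Union>K\<in>?U. edges K)" by blast
    qed
  qed
  have "frag_verts G \<subseteq> verts G" by (auto simp: frag_verts_def)
  then show ?thesis unfolding Frag_def V E induced_subgraph_def by (simp add: Int_absorb1)
qed

lemma verts_Frag: "simple_graph G \<Longrightarrow> verts (Frag G) = frag_verts G"
  by (auto simp: Frag_eq frag_verts_def)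

lemma simple_graph_Frag: "simple_graph G \<Longrightarrow> simple_graph (Frag G)"
  by (simp add: Frag_eq simple_graph_induced)

lemma closed_in_frag_verts:
  assumes "simple_graph G" shows "closed_in G (frag_verts G)"
  unfolding closed_in_def
proof (intro ballI allI impI)
  fix u v assume u: "u \<in> frag_verts G" and e: "{u, v} \<in> edges G"
  have "component G v = component G u" by (rule component_eq[OF edge_reach[OF e]])
  then show "v \<in> frag_verts G" using u simple_graph_edgeD[OF assms e] by (simp add: frag_verts_def)
qed

lemma component_Frag:
  assumes "simple_graph G" "u \<in> frag_verts G"
  shows "component (Frag G) u = component G u" "reach (Frag G) u = reach G u"
  unfolding Frag_eq[OF assms(1)]
  by (rule component_induced_closed reach_induced_closed; rule closed_in_frag_verts assms; fact)+

lemma all_unicyclic_Frag: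
  assumes "simple_graph G" shows "\<forall>K\<in>graph_components (Frag G). unicycle K"
  using component_Frag(1)[OF assms] by (auto simp: graph_components_eq verts_Frag[OF assms] frag_verts_def)

text \<open>Two different cycles in a component would create a double chord.\<close>

lemma component_dichotomy:
  assumes G: "simple_graph G" and nd: "\<not> double_chorded G" and u: "u \<in> verts G"
    and nf: "\<not> cycle_free (component G u)"
  shows "unicycle (component G u)"
proof -
  have "\<not> double_chorded (component G u)"
    using nd double_chorded_mono[of "component G u" G] by (auto simp: component_simps)
  then show ?thesis
    unfolding unicycle_iff
    using nf graph_connected_component[OF G u]
      double_chorded_if_two_cycles[OF simple_graph_component[OF G] graph_connected_component[OF G u]]
    by blast
qed

lemma closed_in_Compl: "closed_in G S \<Longrightarrow> closed_in G (- S)"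
  unfolding closed_in_def by (metis Compl_iff insert_commute)

text \<open>The unicyclic part is the only closed set with unicyclic components inside and no cycle
  outside: a unicyclic component outside \<open>S\<close> would bring its cycle along. This makes
  the events for different \<open>S\<close> disjoint and is also what the constructed sentences
  verify.\<close>

lemma Frag_eq_if_decomposition:
  assumes G: "simple_graph G" and S: "S \<subseteq> verts G" "closed_in G S"
    and uni: "\<forall>K\<in>graph_components (induced_subgraph G S). unicycle K"
    and free: "cycle_free (induced_subgraph G (- S))"
  shows "frag_verts G = S" "Frag G = induced_subgraph G S"
proof -
  have "unicycle (component G u) \<longleftrightarrow> u \<in> S" if u: "u \<in> verts G" for u
  proof
    assume "u \<in> S"
    then have "component G u = component (induced_subgraph G S) u" using component_induced_closed[OF S(2)] by simp
    also have "\<dots> \<in> graph_components (induced_subgraph G S)"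
      by (rule component_in_graph_components) (use u \<open>u \<in> S\<close> in simp)
    finally show "unicycle (component G u)" using uni by simp
  next
    assume uc: "unicycle (component G u)"
    show "u \<in> S"
    proof (rule ccontr)
      assume "u \<notin> S"
      then have "reach G u \<subseteq> - S" using closed_in_imp_reach_subset[OF closed_in_Compl[OF S(2)]] by simp
      moreover obtain xs where "is_cycle (component G u) xs"
        using uc by (auto simp: unicycle_iff cycle_free_def)
      then have "is_cycle G xs" "set xs \<subseteq> reach G u" by (auto simp: component_def is_cycle_induced)
      ultimately have "is_cycle (induced_subgraph G (- S)) xs" by (auto simp: is_cycle_induced)
      then show False using free by (simp add: cycle_free_def)
    qed
  qed
  then show fv: "frag_verts G = S" using S(1) by (auto simp: frag_verts_def)
  then show "Frag G = induced_subgraph G S" using Frag_eq[OF G] by simp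
qed

lemma cycle_free_outside_frag:
  assumes G: "simple_graph G" and nd: "\<not> double_chorded G"
  shows "cycle_free (induced_subgraph G (- frag_verts G))"
  unfolding cycle_free_def
proof (intro allI notI)
  fix xs assume "is_cycle (induced_subgraph G (- frag_verts G)) xs"
  then have xs: "is_cycle G xs" "set xs \<subseteq> - frag_verts G" by (auto simp: is_cycle_induced)
  have "xs \<noteq> []" using xs(1) by (auto simp: is_cycle_def)
  then have h: "hd xs \<in> set xs" by simp
  then have V: "hd xs \<in> verts G" using xs(1) by (auto simp: is_cycle_def)
  have "set xs \<subseteq> reach G (hd xs)" using cycle_reach[OF xs(1) h] by blast
  then have "is_cycle (component G (hd xs)) xs" using xs(1) by (simp add: component_def is_cycle_induced)
  then have "unicycle (component G (hd xs))"
    using component_dichotomy[OF G nd V] by (auto simp: cycle_free_def)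
  then show False using xs(2) h V by (auto simp: frag_verts_def)
qed

text \<open>The initial matching pairs the unicyclic components along the isomorphism. The remaining
  components are trees by \<open>component_dichotomy\<close>, and since no tree is matched yet the
  full budget of \<open>k\<close> rounds is available.\<close>

lemma ef_if_iso_Frag:
  fixes G G' :: "nat ugraph"
  assumes G: "simple_graph G" "\<not> double_chorded G" "tree_rich k G"
    and G': "simple_graph G'" "\<not> double_chorded G'" "tree_rich k G'"
    and iso: "graph_iso (Frag G) (Frag G')"
  shows "ef k G G' {}"
proof -
  obtain f where f: "iso_on f (Frag G) (Frag G')" using iso by (auto simp: graph_iso_iff)
  have bij: "f ` frag_verts G = frag_verts G'"
    using f G(1) G'(1) by (simp add: iso_on_def bij_betw_def verts_Frag)
  define \<pi> where "\<pi> = (\<lambda>u. (component G u, component G' (f u))) ` frag_verts G"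
  have fv: "u \<in> verts G" "unicycle (component G u)" if "u \<in> frag_verts G" for u
    using that by (simp_all add: frag_verts_def)
  have fv': "u \<in> verts G'" "unicycle (component G' u)" if "u \<in> frag_verts G'" for u
    using that by (simp_all add: frag_verts_def)
  have f_in: "f u \<in> frag_verts G'" if "u \<in> frag_verts G" for u using imageI[OF that, of f] bij by simp
  have ef: "ef k (component G u) (component G' (f u)) {}" if u: "u \<in> frag_verts G" for u
  proof -
    have "iso_on f (component (Frag G) u) (component (Frag G') (f u))"
      by (rule iso_on_component[OF simple_graph_Frag[OF G(1)] simple_graph_Frag[OF G'(1)] f])
        (use u G(1) in \<open>simp add: verts_Frag\<close>)
    then have "graph_iso (component G u) (component G' (f u))"
      using component_Frag(1)[OF G(1) u] component_Frag(1)[OF G'(1) f_in[OF u]] by (auto simp: graph_iso_iff)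
    then show ?thesis by (rule graph_iso_imp_ef)
  qed
  have inj: "component G u = component G w \<longleftrightarrow> component G' (f u) = component G' (f w)"
    if u: "u \<in> frag_verts G" and w: "w \<in> frag_verts G" for u w
  proof -
    have "component G u = component G w \<longleftrightarrow> w \<in> reach G u"
      by (rule component_eq_iff) (use G fv u w in simp_all)
    also have "\<dots> \<longleftrightarrow> w \<in> reach (Frag G) u" using component_Frag(2)[OF G(1) u] by simp
    also have "\<dots> \<longleftrightarrow> f w \<in> reach (Frag G') (f u)"
      by (rule iso_on_reach_iff[OF simple_graph_Frag[OF G(1)] simple_graph_Frag[OF G'(1)] f, symmetric])
        (use u w G(1) in \<open>simp_all add: verts_Frag\<close>)
    also have "\<dots> \<longleftrightarrow> f w \<in> reach G' (f u)" using component_Frag(2)[OF G'(1) f_in[OF u]] by simp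
    also have "\<dots> \<longleftrightarrow> component G' (f u) = component G' (f w)"
      by (rule component_eq_iff[symmetric]) (use G' fv' f_in u w in simp_all)
    finally show ?thesis .
  qed
  have "finite (frag_verts G)" using G(1) by (simp add: frag_verts_def simple_graph_def)
  then have "finite \<pi>" by (simp add: \<pi>_def)
  moreover have "\<pi> \<subseteq> graph_components G \<times> graph_components G'"
    using fv(1) fv'(1) f_in by (auto simp: \<pi>_def graph_components_eq)
  moreover have "\<forall>K K' L L'. (K, K') \<in> \<pi> \<longrightarrow> (L, L') \<in> \<pi> \<longrightarrow> (K = L \<longleftrightarrow> K' = L')"
    unfolding \<pi>_def using inj by force
  moreover have "\<forall>K K'. (K, K') \<in> \<pi> \<longrightarrow> ef k K K' ({} \<inter> verts K \<times> verts K') \<and> (cycle_free K \<longleftrightarrow> cycle_free K')"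
  proof (intro allI impI)
    fix K K' assume "(K, K') \<in> \<pi>"
    then obtain u where u: "u \<in> frag_verts G" "K = component G u" "K' = component G' (f u)"
      by (auto simp: \<pi>_def)
    then show "ef k K K' ({} \<inter> verts K \<times> verts K') \<and> (cycle_free K \<longleftrightarrow> cycle_free K')"
      using ef[OF u(1)] fv(2)[OF u(1)] fv'(2)[OF f_in[OF u(1)]] by (simp add: unicycle_iff)
  qed
  moreover have "\<forall>K\<in>graph_components G. K \<notin> Domain \<pi> \<longrightarrow> cycle_free K"
  proof (intro ballI impI)
    fix K assume K: "K \<in> graph_components G" "K \<notin> Domain \<pi>"
    then obtain u where u: "u \<in> verts G" "K = component G u" by (auto simp: graph_components_eq)
    then have "u \<notin> frag_verts G" using K(2) by (force simp: \<pi>_def)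
    then show "cycle_free K" using component_dichotomy[OF G(1,2) u(1)] u by (auto simp: frag_verts_def)
  qed
  moreover have "\<forall>K\<in>graph_components G'. K \<notin> Range \<pi> \<longrightarrow> cycle_free K"
  proof (intro ballI impI)
    fix K assume K: "K \<in> graph_components G'" "K \<notin> Range \<pi>"
    then obtain u where u: "u \<in> verts G'" "K = component G' u" by (auto simp: graph_components_eq)
    then have "u \<notin> f ` frag_verts G" using K(2) by (force simp: \<pi>_def)
    then show "cycle_free K"
      using component_dichotomy[OF G'(1,2) u(1)] u bij by (auto simp: frag_verts_def)
  qed
  moreover have "{p \<in> \<pi>. cycle_free (fst p)} = {}"
    using fv(2) by (auto simp: \<pi>_def unicycle_iff)
  ultimately have "ef_matching k k G G' {} \<pi>" using G G' by (simp add: ef_matching_def)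
  then show ?thesis by (rule ef_matching_imp_ef)
qed

subsection \<open>Isomorphism classes\<close>

lemma iso_class_self: "simple_graph G \<Longrightarrow> G \<in> iso_class G"
  by (simp add: iso_class_def graph_iso_refl)

lemma iso_class_eqI: "graph_iso G G' \<Longrightarrow> iso_class G = iso_class G'"
  unfolding iso_class_def using graph_iso_sym graph_iso_trans by blast

lemma iso_class_memD:
  assumes "H \<in> unicyclic_family" "G \<in> H"
  shows "simple_graph G" "\<forall>K\<in>graph_components G. unicycle K" "H = iso_class G"
proof -
  obtain G0 where G0: "H = iso_class G0" "simple_graph G0" "\<forall>K\<in>graph_components G0. unicycle K"
    using assms(1) by (auto simp: unicyclic_family_def)
  then show G: "simple_graph G" using assms(2) by (simp add: iso_class_def)
  have iso: "graph_iso G0 G" using G0 assms(2) by (simp add: iso_class_def)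
  then show "H = iso_class G" using G0 iso_class_eqI by simp
  show "\<forall>K\<in>graph_components G. unicycle K" using iso iso_on_all_unicyclic[OF G0(2) G] G0(3) by (auto simp: graph_iso_iff)
qed

lemma iso_class_Frag: "simple_graph G \<Longrightarrow> iso_class (Frag G) \<in> unicyclic_family"
  unfolding unicyclic_family_def by (simp add: all_unicyclic_Frag simple_graph_Frag)

text \<open>Supplies the factor (c/n)^h that balances the choice of h vertices in
  \<open>class_mass\<close>.\<close>

lemma unicyclic_verts_le_edges:
  assumes G: "simple_graph G" and uni: "\<forall>K\<in>graph_components G. unicycle K"
  shows "card (verts G) \<le> card (edges G)"
proof (rule verts_le_edges_if_reach_cycle[OF G])
  fix v assume "v \<in> verts G"
  then have "unicycle (component G v)" using bspec[OF uni component_in_graph_components] by simp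
  then obtain xs where "is_cycle (component G v) xs" by (auto simp: unicycle_iff cycle_free_def)
  then have xs: "is_cycle G xs" "set xs \<subseteq> reach G v" by (auto simp: component_def is_cycle_induced)
  then have "hd xs \<in> set xs" by (auto simp: is_cycle_def intro!: hd_in_set)
  then show "\<exists>xs. is_cycle G xs \<and> (\<exists>x\<in>set xs. x \<in> reach G v)" using xs by blast
qed

subsection \<open>Lollipops\<close>

text \<open>A cycle \<open>xs\<close> with a possibly empty tail \<open>ys\<close> attached at
  \<open>hd xs\<close>. It has as many edges as vertices, which keeps the expected number of
  lollipops bounded.\<close>

definition lollipop :: "'a ugraph \<Rightarrow> 'a list \<Rightarrow> 'a list \<Rightarrow> bool" where
  "lollipop G xs ys \<longleftrightarrow> length xs \<ge> 3 \<and> distinct (xs @ ys) \<and> set (xs @ ys) \<subseteq> verts G \<and>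
     cycle_edges xs \<union> path_edges (hd xs # ys) \<subseteq> edges G"

lemma lollipop_Nil:
  assumes "is_cycle G xs" "x \<in> set xs"
  obtains xs' where "lollipop G xs' []" "hd xs' = x"
proof -
  have xs: "distinct xs" "length xs \<ge> 3" "set xs \<subseteq> verts G" "cycle_edges xs \<subseteq> edges G"
    using assms by (auto simp: is_cycle_def)
  obtain ys where "hd ys = x" "set ys = set xs" "distinct ys" "length ys = length xs"
    "cycle_edges ys = cycle_edges xs" by (rule cycle_rotate_hd[OF xs(1) assms(2)])
  then show thesis using that[of ys] xs by (simp add: lollipop_def)
qed

text \<open>Induction along a walk from the cycle to \<open>u\<close>. The next vertex lies on the
  cycle, which is then rotated and loses its tail; or on the tail, which is truncated there; or it
  is new and prolongs the tail.\<close>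

lemma lollipop_ex:
  assumes G: "simple_graph G" and xs: "is_cycle G xs" "x \<in> set xs" and u: "u \<in> reach G x"
  shows "\<exists>xs ys. lollipop G xs ys \<and> last (hd xs # ys) = u"
proof -
  have "(x, u) \<in> (adj G)\<^sup>*" using u by (simp add: reach_def)
  then show ?thesis
  proof (induction rule: rtrancl_induct)
    case base
    show ?case using lollipop_Nil[OF xs] by (metis last.simps)
  next
    case (step y z)
    then obtain cs ps where l: "lollipop G cs ps" "last (hd cs # ps) = y" by blast
    have yz: "{y, z} \<in> edges G" using step.hyps by (simp add: adj_def)
    have z: "z \<in> verts G" using simple_graph_edgeD[OF G yz] by simp
    have cs: "is_cycle G cs" using l(1) by (simp add: lollipop_def is_cycle_def)
    consider "z \<in> set cs" | "z \<in> set ps" | "z \<notin> set cs" "z \<notin> set ps" by blast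
    then show ?case
    proof cases
      case 1
      show ?thesis using lollipop_Nil[OF cs 1] by (metis last.simps)
    next
      case 2
      then obtain as bs where ps: "ps = as @ z # bs" by (meson split_list)
      have "path_edges (hd cs # as @ [z]) \<subseteq> path_edges (hd cs # ps)"
      proof (cases "bs = []")
        case False
        then show ?thesis unfolding ps
          using path_edges_append[of "hd cs # as @ [z]" bs] by auto
      qed (simp add: ps)
      then have "lollipop G cs (as @ [z])" using l(1) ps by (auto simp: lollipop_def)
      moreover have "last (hd cs # as @ [z]) = z" by simp
      ultimately show ?thesis by blast
    next
      case 3
      have "path_edges (hd cs # ps @ [z]) = insert {y, z} (path_edges (hd cs # ps))"
        using path_edges_append[of "hd cs # ps" "[z]"] l(2) by simp
      then have "lollipop G cs (ps @ [z])" using l(1) 3 z yz by (auto simp: lollipop_def)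
      moreover have "last (hd cs # ps @ [z]) = z" by simp
      ultimately show ?thesis by blast
    qed
  qed
qed

lemma frag_verts_lollipop:
  assumes G: "simple_graph G" and u: "u \<in> frag_verts G"
  shows "\<exists>xs ys. lollipop G xs ys \<and> last (hd xs # ys) = u"
proof -
  have "unicycle (component G u)" using u by (simp add: frag_verts_def)
  then obtain xs where "is_cycle (component G u) xs" by (auto simp: unicycle_iff cycle_free_def)
  then have xs: "is_cycle G xs" "set xs \<subseteq> reach G u" by (auto simp: component_def is_cycle_induced)
  then have "hd xs \<in> set xs" by (auto simp: is_cycle_def intro!: hd_in_set)
  then show ?thesis using lollipop_ex[OF G xs(1)] xs(2) reach_sym by (metis subsetD)
qed

lemma card_lollipop_edges:
  assumes "length xs \<ge> 3" "distinct (xs @ ys)"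
  shows "card (cycle_edges xs \<union> path_edges (hd xs # ys)) = length xs + length ys"
proof -
  have "xs \<noteq> []" using assms by auto
  have disj: "cycle_edges xs \<inter> path_edges (hd xs # ys) = {}"
  proof (cases ys)
    case (Cons y zs)
    have "e \<inter> set ys \<noteq> {}" if "e \<in> path_edges (hd xs # ys)" for e
    proof (cases "e = {hd xs, y}")
      case False
      then have "e \<in> path_edges ys" using that Cons by simp
      moreover from this have "e \<noteq> {}" by (auto simp: path_edges_nth)
      ultimately show ?thesis using path_edges_subset_Pow[of e ys] by blast
    qed (simp add: Cons)
    then show ?thesis using cycle_edges_subset_Pow[of _ xs] assms(2) by fastforce
  qed simp
  have "hd xs \<notin> set ys" using assms(2) hd_in_set[OF \<open>xs \<noteq> []\<close>] by auto
  then have "distinct (hd xs # ys)" using assms(2) by simp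
  then show ?thesis
    using assms card_cycle_edges[of xs] card_path_edges[of "hd xs # ys"] disj by (simp add: card_Un_disjoint)
qed


subsection \<open>Events of the random graph\<close>

abbreviation gprob :: "nat \<Rightarrow> real \<Rightarrow> (nat ugraph \<Rightarrow> bool) \<Rightarrow> real" where
  "gprob n p P \<equiv> measure_pmf.prob (gnp n p) {G. P G}"

definition graph_on :: "nat \<Rightarrow> nat ugraph \<Rightarrow> bool" where
  "graph_on n G \<longleftrightarrow> verts G = {1..n} \<and> edges G \<subseteq> all_edges n"

lemma finite_all_edges [simp]: "finite (all_edges n)"
  by (rule finite_subset[of _ "Pow {1..n}"]) (auto simp: all_edges_def)

lemma graph_on_simple: "graph_on n G \<Longrightarrow> simple_graph G"
  by (auto simp: graph_on_def simple_graph_def all_edges_def)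

lemma set_pmf_gnp: "G \<in> set_pmf (gnp n p) \<Longrightarrow> graph_on n G"
  by (auto simp: gnp_def graph_on_def)

lemma finite_set_pmf_gnp: "finite (set_pmf (gnp n p))"
proof (rule finite_subset)
  show "set_pmf (gnp n p) \<subseteq> UGraph {1..n} ` Pow (all_edges n)"
    by (auto simp: gnp_def)
qed simp

lemma gprob_mono:
  assumes "\<And>G. graph_on n G \<Longrightarrow> P G \<Longrightarrow> Q G"
  shows "gprob n p P \<le> gprob n p Q"
proof -
  have "gprob n p P = measure_pmf.prob (gnp n p) ({G. P G} \<inter> set_pmf (gnp n p))"
    by (simp add: measure_Int_set_pmf)
  also have "\<dots> \<le> gprob n p Q"
    by (rule measure_pmf.finite_measure_mono) (use assms set_pmf_gnp in auto)
  finally show ?thesis .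
qed

lemma gprob_cong:
  assumes "\<And>G. graph_on n G \<Longrightarrow> P G \<longleftrightarrow> Q G"
  shows "gprob n p P = gprob n p Q"
  by (intro antisym gprob_mono) (use assms in auto)

lemma gprob_disj_le: "gprob n p (\<lambda>G. P G \<or> Q G) \<le> gprob n p P + gprob n p Q"
  unfolding Collect_disj_eq by (rule measure_Un_le) auto

lemma gprob_diff_le:
  assumes "\<And>G. graph_on n G \<Longrightarrow> P G \<Longrightarrow> Q G \<or> B G"
  shows "gprob n p P \<le> gprob n p Q + gprob n p B"
  by (rule order_trans[OF gprob_mono[OF assms] gprob_disj_le])

lemma gprob_Bex_le: "finite J \<Longrightarrow> gprob n p (\<lambda>G. \<exists>j\<in>J. P j G) \<le> (\<Sum>j\<in>J. gprob n p (P j))"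
  using measure_pmf.finite_measure_subadditive_finite[of J "\<lambda>j. {G. P j G}" "gnp n p"]
  by (simp add: Collect_bex_eq)

lemma gprob_Bex_eq:
  assumes "finite J" "\<And>i j G. i \<in> J \<Longrightarrow> j \<in> J \<Longrightarrow> graph_on n G \<Longrightarrow> P i G \<Longrightarrow> P j G \<Longrightarrow> i = j"
  shows "gprob n p (\<lambda>G. \<exists>j\<in>J. P j G) = (\<Sum>j\<in>J. gprob n p (P j))"
proof -
  have "gprob n p (\<lambda>G. \<exists>j\<in>J. P j G) = gprob n p (\<lambda>G. \<exists>j\<in>J. P j G \<and> graph_on n G)"
    by (rule gprob_cong) auto
  also have "\<dots> = measure_pmf.prob (gnp n p) (\<Union>j\<in>J. {G. P j G \<and> graph_on n G})"
    by (rule arg_cong[where f = "measure _"]) auto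
  also have "\<dots> = (\<Sum>j\<in>J. gprob n p (\<lambda>G. P j G \<and> graph_on n G))"
    by (rule measure_pmf.finite_measure_finite_Union)
      (use assms in \<open>auto simp: disjoint_family_on_def\<close>)
  also have "\<dots> = (\<Sum>j\<in>J. gprob n p (P j))"
    by (intro sum.cong refl gprob_cong) auto
  finally show ?thesis .
qed

lemma gprob_compl: "gprob n p (\<lambda>G. \<not> P G) = 1 - gprob n p P"
  using measure_pmf.prob_compl[of "{G. P G}" "gnp n p"] by (simp add: Compl_eq_Diff_UNIV[symmetric] Collect_neg_eq)

text \<open>The edge indicators are independent, so prescribing the state of each pair separately is
  a product event.\<close>

lemma gprob_pattern:
  assumes p: "0 \<le> p" "p \<le> 1" and AB: "A \<subseteq> all_edges n" "B \<subseteq> all_edges n" "A \<inter> B = {}"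
  shows "gprob n p (\<lambda>G. A \<subseteq> edges G \<and> B \<inter> edges G = {}) = p ^ card A * (1 - p) ^ card B"
proof -
  let ?E = "all_edges n"
  let ?X = "\<lambda>e. if e \<in> A then {True} else if e \<in> B then {False} else UNIV"
  have "gprob n p (\<lambda>G. A \<subseteq> edges G \<and> B \<inter> edges G = {}) =
    measure_pmf.prob (Pi_pmf ?E False (\<lambda>_. bernoulli_pmf p)) (Pi ?E ?X)"
    unfolding gnp_def measure_map_pmf vimage_def
    by (rule arg_cong[where f = "measure _"]) (use AB in \<open>fastforce simp: Pi_def split: if_splits\<close>)
  also have "\<dots> = (\<Prod>e\<in>?E. measure_pmf.prob (bernoulli_pmf p) (?X e))"
    by (rule measure_Pi_pmf_Pi) simp
  also have "\<dots> = (\<Prod>e\<in>?E. (if e \<in> A then p else 1) * (if e \<in> B then 1 - p else 1))"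
    by (rule prod.cong) (use p AB in \<open>auto simp: measure_pmf_single\<close>)
  also have "\<dots> = p ^ card (?E \<inter> A) * (1 - p) ^ card (?E \<inter> B)"
    by (simp add: prod.distrib prod.If_cases Int_def)
  finally show ?thesis using AB by (simp add: Int_absorb1)
qed

lemma gprob_contains:
  assumes "0 \<le> p" "p \<le> 1" "A \<subseteq> all_edges n"
  shows "gprob n p (\<lambda>G. A \<subseteq> edges G) = p ^ card A"
  using gprob_pattern[OF assms(1-3), of "{}"] by simp

text \<open>The event on \<open>R\<close> is split according to the exact trace of the edge set on
  \<open>R\<close>, which reduces it to \<open>gprob_pattern\<close>. The same expansion with empty
  \<open>A\<close> and \<open>B\<close> identifies the remaining sum.\<close>

lemma gprob_pattern_indep:
  assumes p: "0 \<le> p" "p \<le> 1" and AB: "A \<subseteq> all_edges n" "B \<subseteq> all_edges n" "R \<subseteq> all_edges n"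
    "A \<inter> B = {}" "A \<inter> R = {}" "B \<inter> R = {}"
  shows "gprob n p (\<lambda>G. A \<subseteq> edges G \<and> B \<inter> edges G = {} \<and> edges G \<inter> R \<in> F) =
    p ^ card A * (1 - p) ^ card B * gprob n p (\<lambda>G. edges G \<inter> R \<in> F)"
proof -
  have fin: "finite R" "finite A" "finite B" using AB finite_all_edges finite_subset by blast+
  have expand: "gprob n p (\<lambda>G. A \<subseteq> edges G \<and> B \<inter> edges G = {} \<and> edges G \<inter> R \<in> F) =
     p ^ card A * (1 - p) ^ card B * (\<Sum>X\<in>F \<inter> Pow R. p ^ card X * (1 - p) ^ card (R - X))"
    if AB: "A \<subseteq> all_edges n" "B \<subseteq> all_edges n" "A \<inter> B = {}" "A \<inter> R = {}" "B \<inter> R = {}" for A B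
  proof -
    have finAB: "finite A" "finite B" using AB finite_all_edges finite_subset by blast+
    have "gprob n p (\<lambda>G. A \<subseteq> edges G \<and> B \<inter> edges G = {} \<and> edges G \<inter> R \<in> F) =
      gprob n p (\<lambda>G. \<exists>X\<in>F \<inter> Pow R. A \<union> X \<subseteq> edges G \<and> (B \<union> (R - X)) \<inter> edges G = {})"
    proof (rule gprob_cong)
      fix G
      have "X \<subseteq> edges G \<and> (R - X) \<inter> edges G = {} \<longleftrightarrow> X = edges G \<inter> R" if "X \<subseteq> R" for X
        using that by auto
      then show "(A \<subseteq> edges G \<and> B \<inter> edges G = {} \<and> edges G \<inter> R \<in> F) \<longleftrightarrow>
        (\<exists>X\<in>F \<inter> Pow R. A \<union> X \<subseteq> edges G \<and> (B \<union> (R - X)) \<inter> edges G = {})"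
        by (auto simp: Int_Un_distrib2)
    qed
    also have "\<dots> = (\<Sum>X\<in>F \<inter> Pow R. gprob n p (\<lambda>G. A \<union> X \<subseteq> edges G \<and> (B \<union> (R - X)) \<inter> edges G = {}))"
      by (rule gprob_Bex_eq) (use fin in auto)
    also have "\<dots> = (\<Sum>X\<in>F \<inter> Pow R. p ^ card A * (1 - p) ^ card B * (p ^ card X * (1 - p) ^ card (R - X)))"
    proof (rule sum.cong[OF refl])
      fix X assume X: "X \<in> F \<inter> Pow R"
      then have finX: "finite X" using fin by (auto intro: finite_subset)
      have "gprob n p (\<lambda>G. A \<union> X \<subseteq> edges G \<and> (B \<union> (R - X)) \<inter> edges G = {}) =
        p ^ card (A \<union> X) * (1 - p) ^ card (B \<union> (R - X))"
        by (rule gprob_pattern[OF p]) (use X AB \<open>R \<subseteq> all_edges n\<close> in auto)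
      also have "card (A \<union> X) = card A + card X"
        by (rule card_Un_disjoint) (use finX finAB X AB in auto)
      also have "card (B \<union> (R - X)) = card B + card (R - X)"
        by (rule card_Un_disjoint) (use fin finAB X AB in auto)
      finally show "gprob n p (\<lambda>G. A \<union> X \<subseteq> edges G \<and> (B \<union> (R - X)) \<inter> edges G = {}) =
        p ^ card A * (1 - p) ^ card B * (p ^ card X * (1 - p) ^ card (R - X))"
        by (simp add: power_add mult_ac)
    qed
    finally show ?thesis by (simp add: sum_distrib_left)
  qed
  show ?thesis using expand[of A B] expand[of "{}" "{}"] AB by simp
qed

lemma gprob_Markov:
  assumes p: "0 \<le> p" "p \<le> 1" and J: "finite J" "\<And>j. j \<in> J \<Longrightarrow> A j \<subseteq> all_edges n" and M: "M > 0"
  shows "gprob n p (\<lambda>G. M \<le> real (card {j \<in> J. A j \<subseteq> edges G})) \<le> (\<Sum>j\<in>J. p ^ card (A j)) / M"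
proof -
  let ?u = "\<lambda>G. \<Sum>j\<in>J. indicator {G. A j \<subseteq> edges G} G :: real"
  have u: "?u G = real (card {j \<in> J. A j \<subseteq> edges G})" for G
    using J(1) by (simp add: indicator_def sum.If_cases Int_def)
  have int: "integrable (measure_pmf (gnp n p)) f" for f :: "nat ugraph \<Rightarrow> real"
    by (rule integrable_measure_pmf_finite[OF finite_set_pmf_gnp])
  have "measure_pmf.prob (gnp n p) {G \<in> space (measure_pmf (gnp n p)). M \<le> ?u G} \<le>
      (\<integral>G. ?u G \<partial>measure_pmf (gnp n p)) / M"
    by (rule integral_Markov_inequality_measure[where A = "{}"]) (use M int in \<open>auto intro: sum_nonneg\<close>)
  also have "(\<integral>G. ?u G \<partial>measure_pmf (gnp n p)) = (\<Sum>j\<in>J. gprob n p (\<lambda>G. A j \<subseteq> edges G))"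
    by (subst Bochner_Integration.integral_sum) (auto intro: int)
  also have "\<dots> = (\<Sum>j\<in>J. p ^ card (A j))"
    by (rule sum.cong) (use gprob_contains[OF p] J in auto)
  finally show ?thesis by (simp add: u)
qed

lemma gprob_contains_some_le:
  assumes p: "0 \<le> p" "p \<le> 1" and J: "finite J" "\<And>j. j \<in> J \<Longrightarrow> A j \<subseteq> all_edges n"
  shows "gprob n p (\<lambda>G. \<exists>j\<in>J. A j \<subseteq> edges G) \<le> (\<Sum>j\<in>J. p ^ card (A j))"
proof -
  have "gprob n p (\<lambda>G. \<exists>j\<in>J. A j \<subseteq> edges G) \<le> (\<Sum>j\<in>J. gprob n p (\<lambda>G. A j \<subseteq> edges G))"
    by (rule gprob_Bex_le[OF J(1)])
  also have "\<dots> = (\<Sum>j\<in>J. p ^ card (A j))"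
    by (rule sum.cong) (use gprob_contains[OF p] J in auto)
  finally show ?thesis .
qed

subsection \<open>First moment bounds\<close>

definition vertex_lists :: "nat \<Rightarrow> nat list set" where
  "vertex_lists n = {xs. distinct xs \<and> set xs \<subseteq> {1..n}}"

lemma vertex_lists_length: "xs \<in> vertex_lists n \<Longrightarrow> length xs \<le> n"
  unfolding vertex_lists_def using card_mono[of "{1..n}" "set xs"] by (auto simp: distinct_card)

lemma finite_vertex_lists [simp]: "finite (vertex_lists n)"
proof (rule finite_subset)
  show "vertex_lists n \<subseteq> {xs. set xs \<subseteq> {1..n} \<and> length xs \<le> n}"
    using vertex_lists_length[of _ n] by (auto simp: vertex_lists_def)
qed (simp add: finite_lists_length_le)

text \<open>Lists are grouped by length. With \<open>g\<close> built from powers of c/n, the factor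
  n^m turns an expected count into a partial sum of a power series in c.\<close>

lemma sum_vertex_lists_le:
  fixes g :: "nat \<Rightarrow> real"
  assumes g: "\<And>m. 0 \<le> g m" and J: "J \<subseteq> vertex_lists n" and I: "length ` J \<subseteq> I" "finite I"
  shows "(\<Sum>xs\<in>J. g (length xs)) \<le> (\<Sum>m\<in>I. real n ^ m * g m)"
proof -
  have finJ: "finite J" using J finite_subset[OF _ finite_vertex_lists] by blast
  have "(\<Sum>xs\<in>J. g (length xs)) = (\<Sum>m\<in>I. \<Sum>xs\<in>{xs \<in> J. length xs = m}. g (length xs))"
    by (rule sum.group[OF finJ I(2,1), symmetric])
  also have "\<dots> \<le> (\<Sum>m\<in>I. real n ^ m * g m)"
  proof (rule sum_mono)
    fix m
    have "{xs \<in> J. length xs = m} \<subseteq> {xs. set xs \<subseteq> {1..n} \<and> length xs = m}"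
      using J by (auto simp: vertex_lists_def)
    then have "card {xs \<in> J. length xs = m} \<le> card {xs. set xs \<subseteq> {1..n} \<and> length xs = m}"
      by (intro card_mono finite_lists_length_eq) auto
    also have "\<dots> = n ^ m" using card_lists_length_eq[of "{1..n}" m] by simp
    finally have "real (card {xs \<in> J. length xs = m}) \<le> real n ^ m" by (metis of_nat_le_iff of_nat_power)
    moreover have "(\<Sum>xs\<in>{xs \<in> J. length xs = m}. g (length xs)) = real (card {xs \<in> J. length xs = m}) * g m"
      by simp
    ultimately show "(\<Sum>xs\<in>{xs \<in> J. length xs = m}. g (length xs)) \<le> real n ^ m * g m"
      using g[of m] by (simp add: mult_right_mono)
  qed
  finally show ?thesis .
qed

lemma geometric_partial_sum_le:
  fixes c :: real assumes "0 \<le> c" "c < 1" "finite I" "\<And>m. m \<in> I \<Longrightarrow> k \<le> m"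
  shows "(\<Sum>m\<in>I. c ^ m) \<le> c ^ k / (1 - c)"
proof -
  have s: "summable (\<lambda>m. c ^ m)" using assms by (intro summable_geometric) auto
  have "(\<Sum>m\<in>I. c ^ m) = (\<Sum>m\<in>(\<lambda>m. m - k) ` I. c ^ (m + k))"
    by (subst sum.reindex) (use assms(4) in \<open>auto simp: inj_on_def\<close>, metis le_add_diff_inverse2)
  also have "\<dots> = c ^ k * (\<Sum>m\<in>(\<lambda>m. m - k) ` I. c ^ m)"
    by (simp add: power_add sum_distrib_left mult.commute)
  also have "(\<Sum>m\<in>(\<lambda>m. m - k) ` I. c ^ m) \<le> (\<Sum>m. c ^ m)"
    by (rule sum_le_suminf[OF s]) (use assms in auto)
  also have "(\<Sum>m. c ^ m) = 1 / (1 - c)" using assms by (intro suminf_geometric) auto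
  finally show ?thesis using assms by (simp add: mult_left_mono)
qed

lemma path_edges_all_edges: "xs \<in> vertex_lists n \<Longrightarrow> path_edges xs \<subseteq> all_edges n"
proof (induction xs rule: path_edges.induct)
  case (1 x y xs)
  then have "y # xs \<in> vertex_lists n" "{x, y} \<in> all_edges n" by (auto simp: vertex_lists_def all_edges_def)
  then show ?case using 1 by simp
qed auto

lemma cycle_edges_all_edges:
  assumes "xs \<in> vertex_lists n" "length xs \<ge> 3" shows "cycle_edges xs \<subseteq> all_edges n"
proof -
  have ne: "xs \<noteq> []" using assms by auto
  have "last xs \<noteq> hd xs"
  proof
    assume "last xs = hd xs"
    then show False using assms ne by (cases xs) (auto simp: vertex_lists_def split: if_splits)
  qed
  moreover have sub: "set xs \<subseteq> {1..n}" using assms(1) by (simp add: vertex_lists_def)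
  ultimately have "{last xs, hd xs} \<in> all_edges n"
    using subsetD[OF sub last_in_set[OF ne]] subsetD[OF sub hd_in_set[OF ne]] by (simp add: all_edges_def)
  then show ?thesis using path_edges_all_edges[OF assms(1)] by (simp add: cycle_edges_eq[OF ne])
qed

section \<open>First moment estimates for c < 1\<close>

locale subcritical =
  fixes c :: real
  assumes c_pos: "0 < c" and c_less: "c < 1"
begin

lemma edge_prob: "0 \<le> c / real n" "c / real n \<le> 1"
  using c_pos c_less by (auto simp: divide_le_eq)

lemma power_edge_prob: "n > 0 \<Longrightarrow> real n ^ m * (c / real n) ^ m = c ^ m"
  by (simp add: power_divide)

text \<open>Length m contributes at most n^m (c/n)^m = c^m. Listing a cycle once for each rotation
  and reflection overcounts, which is harmless for an upper bound.\<close>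

lemma prob_long_cycle:
  assumes "n > 0"
  shows "gprob n (c / real n) (\<lambda>G. \<exists>xs. is_cycle G xs \<and> k \<le> length xs) \<le> c ^ k / (1 - c)"
proof -
  let ?p = "c / real n"
  define J where "J = {xs \<in> vertex_lists n. length xs \<ge> 3 \<and> k \<le> length xs}"
  have fin: "finite J" by (simp add: J_def)
  have "gprob n ?p (\<lambda>G. \<exists>xs. is_cycle G xs \<and> k \<le> length xs) \<le> gprob n ?p (\<lambda>G. \<exists>xs\<in>J. cycle_edges xs \<subseteq> edges G)"
    by (rule gprob_mono) (auto simp: is_cycle_def J_def vertex_lists_def graph_on_def)
  also have "\<dots> \<le> (\<Sum>xs\<in>J. ?p ^ card (cycle_edges xs))"
    by (rule gprob_contains_some_le[OF edge_prob fin], rule cycle_edges_all_edges, auto simp: J_def)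
  also have "\<dots> = (\<Sum>xs\<in>J. ?p ^ length xs)"
    by (rule sum.cong) (auto simp: J_def vertex_lists_def card_cycle_edges)
  also have "\<dots> \<le> (\<Sum>m\<in>{k..n + k}. real n ^ m * ?p ^ m)"
    by (rule sum_vertex_lists_le) (use edge_prob vertex_lists_length[of _ n] in \<open>force simp: J_def\<close>)+
  also have "\<dots> = (\<Sum>m\<in>{k..n + k}. c ^ m)" using assms by (simp add: power_edge_prob)
  also have "\<dots> \<le> c ^ k / (1 - c)" by (rule geometric_partial_sum_le) (use c_pos c_less in auto)
  finally show ?thesis .
qed

text \<open>Fixing one vertex of the cycle in \<open>S\<close> leaves m - 1 free vertices for m
  edges, hence the additional factor c/n.\<close>

lemma prob_cycle_through:
  assumes "n > 0" "finite S"
  shows "gprob n (c / real n) (\<lambda>G. \<exists>xs. is_cycle G xs \<and> set xs \<inter> S \<noteq> {})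
    \<le> real (card S) * (c / real n) / (1 - c)"
proof -
  let ?p = "c / real n"
  define L where "L = {ys \<in> vertex_lists n. length ys \<ge> 2}"
  define J where "J = {j \<in> S \<times> L. fst j # snd j \<in> vertex_lists n}"
  have fin: "finite J" using assms(2) by (simp add: J_def L_def)
  have "gprob n ?p (\<lambda>G. \<exists>xs. is_cycle G xs \<and> set xs \<inter> S \<noteq> {}) \<le>
      gprob n ?p (\<lambda>G. \<exists>j\<in>J. cycle_edges (fst j # snd j) \<subseteq> edges G)"
  proof (rule gprob_mono)
    fix G assume G: "graph_on n G" and "\<exists>xs. is_cycle G xs \<and> set xs \<inter> S \<noteq> {}"
    then obtain xs x where xs: "is_cycle G xs" "x \<in> set xs" "x \<in> S" by blast
    then have dx: "distinct xs" by (simp add: is_cycle_def)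
    obtain zs where zs: "hd zs = x" "set zs = set xs" "distinct zs" "length zs = length xs"
      "cycle_edges zs = cycle_edges xs" "zs \<noteq> []" by (rule cycle_rotate_hd[OF dx xs(2)])
    obtain ys where ys: "zs = x # ys" using zs(1,6) by (cases zs) auto
    have zl: "zs \<in> vertex_lists n" using zs xs(1) G by (auto simp: is_cycle_def vertex_lists_def graph_on_def)
    have "length zs \<ge> 3" using zs xs(1) by (simp add: is_cycle_def)
    then have "(x, ys) \<in> J" using zl xs(3) unfolding ys by (auto simp: J_def L_def vertex_lists_def)
    moreover have "cycle_edges (x # ys) \<subseteq> edges G" using zs(5) ys xs(1) by (simp add: is_cycle_def)
    ultimately show "\<exists>j\<in>J. cycle_edges (fst j # snd j) \<subseteq> edges G" by force
  qed
  also have "\<dots> \<le> (\<Sum>j\<in>J. ?p ^ card (cycle_edges (fst j # snd j)))"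
    by (rule gprob_contains_some_le[OF edge_prob fin], rule cycle_edges_all_edges)
      (auto simp: J_def L_def)
  also have "\<dots> = (\<Sum>j\<in>J. ?p * ?p ^ length (snd j))"
    by (rule sum.cong) (auto simp: J_def L_def vertex_lists_def card_cycle_edges)
  also have "\<dots> \<le> (\<Sum>j\<in>S \<times> L. ?p * ?p ^ length (snd j))"
    by (rule sum_mono2) (use assms c_pos in \<open>auto simp: J_def L_def\<close>)
  also have "\<dots> = (\<Sum>x\<in>S. \<Sum>ys\<in>L. ?p * ?p ^ length ys)"
    unfolding sum.cartesian_product by (rule sum.cong) auto
  also have "\<dots> = real (card S) * (?p * (\<Sum>ys\<in>L. ?p ^ length ys))"
    unfolding sum_distrib_left[symmetric] by simp
  also have "(\<Sum>ys\<in>L. ?p ^ length ys) \<le> (\<Sum>m\<in>{0..n}. real n ^ m * ?p ^ m)"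
    by (rule sum_vertex_lists_le) (use edge_prob vertex_lists_length[of _ n] in \<open>auto simp: L_def\<close>)
  also have "\<dots> = (\<Sum>m\<in>{0..n}. c ^ m)" using assms by (simp add: power_edge_prob)
  also have "\<dots> \<le> c ^ 0 / (1 - c)" by (rule geometric_partial_sum_le) (use c_pos c_less in auto)
  finally show ?thesis using c_pos c_less by (simp add: mult_left_mono divide_right_mono)
qed

text \<open>Each vertex of the unicyclic part is the end of a lollipop, so there are at least as
  many lollipops as such vertices. Cycle and tail each contribute at most a geometric series, which
  gives the expectation bound 1/(1-c)^2 for the inequality of Markov.\<close>

lemma prob_large_frag:
  assumes "n > 0" "M > 0"
  shows "gprob n (c / real n) (\<lambda>G. M \<le> real (card (frag_verts G))) \<le> 1 / (1 - c)\<^sup>2 / M"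
proof -
  let ?p = "c / real n"
  define J where "J = {j \<in> vertex_lists n \<times> vertex_lists n. length (fst j) \<ge> 3 \<and> distinct (fst j @ snd j)}"
  let ?A = "\<lambda>j. cycle_edges (fst j) \<union> path_edges (hd (fst j) # snd j)"
  have fin: "finite J" by (simp add: J_def)
  have "gprob n ?p (\<lambda>G. M \<le> real (card (frag_verts G))) \<le>
      gprob n ?p (\<lambda>G. M \<le> real (card {j \<in> J. ?A j \<subseteq> edges G}))"
  proof (rule gprob_mono)
    fix G assume G: "graph_on n G" and M: "M \<le> real (card (frag_verts G))"
    have "frag_verts G \<subseteq> (\<lambda>j. last (hd (fst j) # snd j)) ` {j \<in> J. ?A j \<subseteq> edges G}"
    proof
      fix u assume "u \<in> frag_verts G"
      then obtain xs ys where l: "lollipop G xs ys" "last (hd xs # ys) = u"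
        using frag_verts_lollipop[OF graph_on_simple[OF G]] by blast
      then have "(xs, ys) \<in> {j \<in> J. ?A j \<subseteq> edges G}"
        using G by (auto simp: lollipop_def J_def vertex_lists_def graph_on_def)
      then show "u \<in> (\<lambda>j. last (hd (fst j) # snd j)) ` {j \<in> J. ?A j \<subseteq> edges G}"
        using l(2) by (intro image_eqI[of _ _ "(xs, ys)"]) auto
    qed
    then have "card (frag_verts G) \<le> card {j \<in> J. ?A j \<subseteq> edges G}"
      by (rule surj_card_le[rotated]) (use fin in simp)
    then show "M \<le> real (card {j \<in> J. ?A j \<subseteq> edges G})" using M by linarith
  qed
  also have "\<dots> \<le> (\<Sum>j\<in>J. ?p ^ card (?A j)) / M"
  proof (rule gprob_Markov[OF edge_prob fin _ assms(2)])
    fix j assume j: "j \<in> J"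
    then have "hd (fst j) \<in> set (fst j)" by (intro hd_in_set) (auto simp: J_def)
    then have "hd (fst j) # snd j \<in> vertex_lists n" using j by (auto simp: J_def vertex_lists_def)
    then show "?A j \<subseteq> all_edges n"
      by (intro Un_least path_edges_all_edges cycle_edges_all_edges) (use j in \<open>auto simp: J_def\<close>)
  qed
  also have "(\<Sum>j\<in>J. ?p ^ card (?A j)) = (\<Sum>j\<in>J. ?p ^ length (fst j) * ?p ^ length (snd j))"
    by (rule sum.cong[OF refl], subst card_lollipop_edges) (auto simp: J_def power_add)
  also have "\<dots> \<le> (\<Sum>j\<in>vertex_lists n \<times> vertex_lists n. ?p ^ length (fst j) * ?p ^ length (snd j))"
    by (rule sum_mono2) (use c_pos in \<open>auto simp: J_def\<close>)
  also have "\<dots> = (\<Sum>xs\<in>vertex_lists n. ?p ^ length xs) * (\<Sum>xs\<in>vertex_lists n. ?p ^ length xs)"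
    unfolding sum_product sum.cartesian_product by (rule sum.cong) auto
  also have "\<dots> \<le> (1 / (1 - c)) * (1 / (1 - c))"
  proof -
    have "(\<Sum>xs\<in>vertex_lists n. ?p ^ length xs) \<le> (\<Sum>m\<in>{0..n}. real n ^ m * ?p ^ m)"
      by (rule sum_vertex_lists_le) (use edge_prob vertex_lists_length[of _ n] in auto)
    also have "\<dots> = (\<Sum>m\<in>{0..n}. c ^ m)" using assms by (simp add: power_edge_prob)
    also have "\<dots> \<le> c ^ 0 / (1 - c)" by (rule geometric_partial_sum_le) (use c_pos c_less in auto)
    finally show ?thesis using c_pos c_less by (intro mult_mono) (auto intro!: sum_nonneg)
  qed
  finally show ?thesis using assms(2) by (simp add: power2_eq_square divide_right_mono)
qed

text \<open>The factor m^4 will count the four ends of two chords on a path with m vertices.\<close>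

lemma summable_quartic: "summable (\<lambda>m. real m ^ 4 * c ^ m)"
proof -
  have "(\<lambda>m. ((real m + 1) / real m) ^ 4 * c) \<longlonglongrightarrow> c" by real_asymp
  \<comment> \<open>The ratio of consecutive terms tends to c; the midpoint between c and 1 serves
    as a bound below 1.\<close>
  then have "\<forall>\<^sub>F m in sequentially. ((real m + 1) / real m) ^ 4 * c < (1 + c) / 2"
    by (rule order_tendstoD(2)) (use c_less in simp)
  then obtain N where N: "\<And>m. m \<ge> N \<Longrightarrow> ((real m + 1) / real m) ^ 4 * c < (1 + c) / 2"
    by (auto simp: eventually_sequentially)
  show ?thesis
  proof (rule summable_ratio_test[where c = "(1 + c) / 2" and N = "max N 1"])
    show "(1 + c) / 2 < 1" using c_less by simp
    fix m assume m: "max N 1 \<le> m"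
    then have "m > 0" by simp
    then have "real (Suc m) ^ 4 * c ^ Suc m = ((real m + 1) / real m) ^ 4 * c * (real m ^ 4 * c ^ m)"
      by (simp add: power_divide add.commute)
    also have "\<dots> \<le> (1 + c) / 2 * (real m ^ 4 * c ^ m)"
      by (rule mult_right_mono) (use N[of m] m c_pos in auto)
    finally show "norm (real (Suc m) ^ 4 * c ^ Suc m) \<le> (1 + c) / 2 * norm (real m ^ 4 * c ^ m)"
      using c_pos by simp
  qed
qed

text \<open>A path on m vertices with two chords has m + 1 edges, so its expected number is at most
  m^4 n^m (c/n)^(m+1) = (c/n) m^4 c^m, and a factor 1/n survives the summation.\<close>

lemma prob_double_chorded: "(\<lambda>n. gprob n (c / real n) double_chorded) \<longlonglongrightarrow> 0"
proof -
  define C where "C = (\<Sum>m. real m ^ 4 * c ^ m)"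
  have bound: "gprob n (c / real n) double_chorded \<le> c * C / real n" if n: "n > 0" for n
  proof -
    let ?p = "c / real n"
    define D where "D xs = {d \<in> all_edges n \<times> all_edges n. fst d \<noteq> snd d \<and> fst d \<subseteq> set xs \<and> snd d \<subseteq> set xs \<and>
      fst d \<notin> path_edges xs \<and> snd d \<notin> path_edges xs}" for xs
    define L where "L = vertex_lists n - {[]}"
    define J where "J = Sigma L D"
    let ?A = "\<lambda>(xs, d). path_edges xs \<union> {fst d, snd d}"
    have finD: "finite (D xs)" for xs by (simp add: D_def)
    have fin: "finite J" using finD by (auto simp: J_def L_def)
    have "gprob n ?p double_chorded \<le> gprob n ?p (\<lambda>G. \<exists>j\<in>J. ?A j \<subseteq> edges G)"
    proof (rule gprob_mono)
      fix G assume G: "graph_on n G" and "double_chorded G"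
      then obtain xs e e' where *: "is_path G xs" "e \<noteq> e'" "e \<in> edges G - path_edges xs"
        "e' \<in> edges G - path_edges xs" "e \<subseteq> set xs" "e' \<subseteq> set xs" by (auto simp: double_chorded_def)
      then have "(xs, (e, e')) \<in> J"
        using G by (auto simp: J_def L_def D_def is_path_def vertex_lists_def graph_on_def)
      moreover have "?A (xs, (e, e')) \<subseteq> edges G" using * by (auto simp: is_path_def)
      ultimately show "\<exists>j\<in>J. ?A j \<subseteq> edges G" by blast
    qed
    also have "\<dots> \<le> (\<Sum>j\<in>J. ?p ^ card (?A j))"
      by (rule gprob_contains_some_le[OF edge_prob fin])
        (auto simp: J_def D_def L_def dest: path_edges_all_edges)
    also have "\<dots> = (\<Sum>j\<in>J. ?p ^ Suc (length (fst j)))"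
    proof (rule sum.cong[OF refl])
      fix j assume "j \<in> J"
      then obtain xs d where j: "j = (xs, d)" "xs \<in> L" "d \<in> D xs" by (auto simp: J_def)
      have "xs \<noteq> []" "distinct xs" using j(2) by (auto simp: L_def vertex_lists_def)
      have "card (?A j) = card (insert (fst d) (insert (snd d) (path_edges xs)))" using j by simp
      also have "\<dots> = Suc (Suc (card (path_edges xs)))" using j(3) by (simp add: D_def)
      also have "\<dots> = Suc (length xs)" using \<open>distinct xs\<close> \<open>xs \<noteq> []\<close> by (simp add: card_path_edges)
      finally show "?p ^ card (?A j) = ?p ^ Suc (length (fst j))" using j by simp
    qed
    also have "\<dots> = (\<Sum>xs\<in>L. real (card (D xs)) * ?p ^ Suc (length xs))"
    proof -
      have "(\<Sum>xs\<in>L. \<Sum>d\<in>D xs. g xs) = (\<Sum>j\<in>J. g (fst j))" for g :: "nat list \<Rightarrow> real"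
        unfolding J_def using sum.Sigma[of L D "\<lambda>xs d. g xs"] finD by (simp add: L_def split_beta)
      from this[of "\<lambda>xs. ?p ^ Suc (length xs)"] show ?thesis by (simp only: sum_constant)
    qed
    also have "\<dots> \<le> (\<Sum>xs\<in>L. real (length xs) ^ 4 * ?p ^ Suc (length xs))"
    proof (rule sum_mono)
      fix xs assume "xs \<in> L"
      \<comment> \<open>A chord is given by a pair of path vertices, so there are at most m^2
        choices for each of the two chords.\<close>
      let ?Q = "(\<lambda>q. {fst q, snd q}) ` (set xs \<times> set xs)"
      have Q: "e \<in> ?Q" if "e \<in> all_edges n" "e \<subseteq> set xs" for e
      proof -
        have "card e = 2" using that(1) by (simp add: all_edges_def)
        then obtain a b where "e = {a, b}" by (meson card_2_iff)
        then show ?thesis using that(2) by (intro image_eqI[of _ _ "(a, b)"]) auto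
      qed
      have "card ?Q \<le> length xs * length xs"
        using card_image_le[of "set xs \<times> set xs" "\<lambda>q. {fst q, snd q}"] card_length[of xs]
        by (simp add: card_cartesian_product) (meson mult_le_mono order_trans)
      then have "card (?Q \<times> ?Q) \<le> (length xs * length xs) * (length xs * length xs)"
        unfolding card_cartesian_product by (rule mult_le_mono) fact
      moreover have "D xs \<subseteq> ?Q \<times> ?Q" using Q by (auto simp: D_def)
      then have "card (D xs) \<le> card (?Q \<times> ?Q)" by (intro card_mono) auto
      ultimately have "card (D xs) \<le> length xs ^ 4" by (simp add: power4_eq_xxxx mult.assoc)
      then have "real (card (D xs)) \<le> real (length xs) ^ 4" by (metis of_nat_le_iff of_nat_power)
      then show "real (card (D xs)) * ?p ^ Suc (length xs) \<le> real (length xs) ^ 4 * ?p ^ Suc (length xs)"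
        by (rule mult_right_mono) (rule zero_le_power[OF edge_prob(1)])
    qed
    also have "\<dots> \<le> (\<Sum>m\<in>{0..n}. real n ^ m * (real m ^ 4 * ?p ^ Suc m))"
      by (rule sum_vertex_lists_le) (use c_pos vertex_lists_length[of _ n] in \<open>auto simp: L_def\<close>)
    also have "\<dots> = ?p * (\<Sum>m\<in>{0..n}. real m ^ 4 * c ^ m)"
      unfolding sum_distrib_left using power_edge_prob[OF n] by (intro sum.cong) (auto simp: mult_ac)
    also have "(\<Sum>m\<in>{0..n}. real m ^ 4 * c ^ m) \<le> C"
      unfolding C_def by (rule sum_le_suminf[OF summable_quartic]) (use c_pos in auto)
    finally show ?thesis using c_pos by (simp add: mult_left_mono divide_right_mono)
  qed
  have "(\<lambda>n. c * C / real n) \<longlonglongrightarrow> 0" by real_asymp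
  then show ?thesis
    by (rule tendsto_sandwich[of "\<lambda>_. 0", rotated 3])
      (use bound in \<open>auto simp: eventually_at_top_dense intro!: eventually_sequentiallyI[of 1]\<close>)
qed

end


subsection \<open>Splitting off a union of components\<close>

definition pairs :: "'a set \<Rightarrow> 'a set set" where
  "pairs S = {e. e \<subseteq> S \<and> card e = 2}"

text \<open>The cut between \<open>S\<close> and the rest of \<open>{1..n}\<close>.\<close>

definition cross_edges :: "nat \<Rightarrow> nat set \<Rightarrow> nat set set" where
  "cross_edges n S = {e \<in> all_edges n. e \<inter> S \<noteq> {} \<and> \<not> e \<subseteq> S}"

lemma pairs_subset_all_edges: "S \<subseteq> {1..n} \<Longrightarrow> pairs S \<subseteq> all_edges n"
  by (auto simp: pairs_def all_edges_def)

lemma cross_edges_subset: "cross_edges n S \<subseteq> all_edges n"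
  by (auto simp: cross_edges_def)

lemma finite_pairs [simp]: "finite S \<Longrightarrow> finite (pairs S)"
  by (rule finite_subset[of _ "Pow S"]) (auto simp: pairs_def)

lemma card_pairs: "finite S \<Longrightarrow> card (pairs S) = card S choose 2"
  by (simp add: pairs_def n_subsets)

lemma simple_graph_pairs: "simple_graph (UGraph S F) \<longleftrightarrow> finite S \<and> F \<subseteq> pairs S"
  by (auto simp: simple_graph_def pairs_def)

lemma cross_edges_image:
  assumes "S \<subseteq> {1..n}"
  shows "cross_edges n S = (\<lambda>q. {fst q, snd q}) ` (S \<times> ({1..n} - S))"
proof (intro set_eqI iffI)
  fix e assume e: "e \<in> cross_edges n S"
  then have "card e = 2" by (simp add: cross_edges_def all_edges_def)
  then obtain x y where xy: "e = {x, y}" "x \<noteq> y" by (meson card_2_iff)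
  have e2: "x \<in> {1..n}" "y \<in> {1..n}" "{x, y} \<inter> S \<noteq> {}" "\<not> {x, y} \<subseteq> S"
    using e xy by (auto simp: cross_edges_def all_edges_def)
  show "e \<in> (\<lambda>q. {fst q, snd q}) ` (S \<times> ({1..n} - S))"
  proof (cases "x \<in> S")
    case True
    then show ?thesis using e2 xy by (intro image_eqI[of _ _ "(x, y)"]) auto
  next
    case False
    then show ?thesis using e2 xy by (intro image_eqI[of _ _ "(y, x)"]) auto
  qed
next
  fix e assume "e \<in> (\<lambda>q. {fst q, snd q}) ` (S \<times> ({1..n} - S))"
  then obtain x y where xy: "e = {x, y}" "x \<in> S" "y \<in> {1..n} - S" by auto
  then have "x \<noteq> y" "x \<in> {1..n}" using assms by auto
  then show "e \<in> cross_edges n S" using xy by (auto simp: cross_edges_def all_edges_def)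
qed

lemma card_cross_edges:
  assumes "S \<subseteq> {1..n}" shows "card (cross_edges n S) = card S * (n - card S)"
proof -
  have "inj_on (\<lambda>q. {fst q, snd q}) (S \<times> ({1..n} - S))"
    by (rule inj_onI) (auto simp: doubleton_eq_iff)
  moreover have "finite S" using assms finite_subset by blast
  ultimately show ?thesis
    unfolding cross_edges_image[OF assms] using assms
    by (simp add: card_image card_cartesian_product card_Diff_subset)
qed

lemma closed_in_iff_cross_edges:
  assumes G: "graph_on n G" and S: "S \<subseteq> {1..n}"
  shows "closed_in G S \<longleftrightarrow> cross_edges n S \<inter> edges G = {}"
proof
  assume cl: "closed_in G S"
  show "cross_edges n S \<inter> edges G = {}"
  proof (rule ccontr)
    assume "cross_edges n S \<inter> edges G \<noteq> {}"
    then obtain e where e: "e \<in> cross_edges n S" "e \<in> edges G" by blast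
    then obtain x y where "e = {x, y}" "x \<in> S" "y \<notin> S" by (auto simp: cross_edges_image[OF S])
    then show False using cl e by (auto simp: closed_in_def)
  qed
next
  assume cr: "cross_edges n S \<inter> edges G = {}"
  show "closed_in G S"
    unfolding closed_in_def
  proof (intro ballI allI impI, rule ccontr)
    fix u v assume uv: "u \<in> S" "{u, v} \<in> edges G" "v \<notin> S"
    then have "{u, v} \<in> cross_edges n S" using G by (auto simp: graph_on_def cross_edges_def)
    then show False using uv(2) cr by blast
  qed
qed

lemma induced_subgraph_on:
  assumes "graph_on n G" "S \<subseteq> {1..n}"
  shows "induced_subgraph G S = UGraph S (edges G \<inter> pairs S)"
    "induced_subgraph G (- S) = UGraph ({1..n} - S) (edges G \<inter> pairs ({1..n} - S))"
  using assms by (auto simp: induced_subgraph_def graph_on_def pairs_def all_edges_def)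

text \<open>For a \<open>unicyclic_class\<close> it implies that \<open>S\<close> carries the
  unicyclic part. The three conditions concern the cut, the pairs inside \<open>S\<close> and the
  pairs outside \<open>S\<close>, hence disjoint sets of pairs.\<close>

definition frag_event :: "nat ugraph set \<Rightarrow> nat set \<Rightarrow> nat ugraph \<Rightarrow> bool" where
  "frag_event H S G \<longleftrightarrow>
     closed_in G S \<and> induced_subgraph G S \<in> H \<and> cycle_free (induced_subgraph G (- S))"

text \<open>The probability that the random graph induces a member of \<open>H\<close> on
  \<open>S\<close>.\<close>

definition class_weight :: "real \<Rightarrow> nat ugraph set \<Rightarrow> nat set \<Rightarrow> real" where
  "class_weight p H S = (\<Sum>F\<in>{F. F \<subseteq> pairs S \<and> UGraph S F \<in> H}.
     p ^ card F * (1 - p) ^ ((card S choose 2) - card F))"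

text \<open>The three conditions depend on disjoint sets of pairs, so their probabilities multiply.
  The first is expanded over the possible edge sets on \<open>S\<close>.\<close>

lemma prob_frag_event:
  assumes p: "0 \<le> p" "p \<le> 1" and S: "S \<subseteq> {1..n}"
  shows "gprob n p (frag_event H S) = class_weight p H S * (1 - p) ^ (card S * (n - card S)) *
    gprob n p (\<lambda>G. cycle_free (induced_subgraph G (- S)))"
proof -
  define R where "R = pairs ({1..n} - S)"
  define Free where "Free = {X. cycle_free (UGraph ({1..n} - S) X)}"
  define FF where "FF = {F. F \<subseteq> pairs S \<and> UGraph S F \<in> H}"
  let ?C = "cross_edges n S"
  have finS: "finite S" using S finite_subset by blast
  have fin: "finite FF" using finS by (simp add: FF_def)
  have sub: "pairs S \<subseteq> all_edges n" "?C \<subseteq> all_edges n" "R \<subseteq> all_edges n"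
    using pairs_subset_all_edges[OF S] cross_edges_subset pairs_subset_all_edges[of "{1..n} - S" n]
    by (auto simp: R_def)
  have PR: "pairs S \<inter> R = {}"
  proof (rule ccontr)
    assume "pairs S \<inter> R \<noteq> {}"
    then obtain e where e: "e \<subseteq> S" "e \<subseteq> {1..n} - S" "card e = 2" by (auto simp: pairs_def R_def)
    then have "e = {}" by auto
    then show False using e(3) by simp
  qed
  have PC: "pairs S \<inter> ?C = {}" by (auto simp: pairs_def cross_edges_def)
  have CR: "?C \<inter> R = {}" by (auto simp: pairs_def cross_edges_def R_def)
  have "gprob n p (frag_event H S) = gprob n p (\<lambda>G. \<exists>F\<in>FF. F \<subseteq> edges G \<and>
      ((pairs S - F) \<union> ?C) \<inter> edges G = {} \<and> edges G \<inter> R \<in> Free)"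
  proof (rule gprob_cong)
    fix G assume G: "graph_on n G"
    have *: "F \<subseteq> edges G \<and> (pairs S - F) \<inter> edges G = {} \<longleftrightarrow> F = edges G \<inter> pairs S" if "F \<subseteq> pairs S" for F
      using that by auto
    have "frag_event H S G \<longleftrightarrow> ?C \<inter> edges G = {} \<and> UGraph S (edges G \<inter> pairs S) \<in> H \<and> edges G \<inter> R \<in> Free"
      unfolding frag_event_def closed_in_iff_cross_edges[OF G S] induced_subgraph_on[OF G S]
      by (simp add: Free_def R_def)
    also have "\<dots> \<longleftrightarrow> edges G \<inter> pairs S \<in> FF \<and> ?C \<inter> edges G = {} \<and> edges G \<inter> R \<in> Free"
      by (auto simp: FF_def)
    also have "\<dots> \<longleftrightarrow> (\<exists>F\<in>FF. (F \<subseteq> edges G \<and> (pairs S - F) \<inter> edges G = {}) \<and> ?C \<inter> edges G = {} \<and> edges G \<inter> R \<in> Free)"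
      using * unfolding FF_def by (metis (no_types, lifting) mem_Collect_eq)
    also have "\<dots> \<longleftrightarrow> (\<exists>F\<in>FF. F \<subseteq> edges G \<and> ((pairs S - F) \<union> ?C) \<inter> edges G = {} \<and> edges G \<inter> R \<in> Free)"
      by (simp add: Int_Un_distrib2 conj_assoc)
    finally show "frag_event H S G \<longleftrightarrow>
      (\<exists>F\<in>FF. F \<subseteq> edges G \<and> ((pairs S - F) \<union> ?C) \<inter> edges G = {} \<and> edges G \<inter> R \<in> Free)" .
  qed
  also have "\<dots> = (\<Sum>F\<in>FF. gprob n p (\<lambda>G. F \<subseteq> edges G \<and>
      ((pairs S - F) \<union> ?C) \<inter> edges G = {} \<and> edges G \<inter> R \<in> Free))"
    by (rule gprob_Bex_eq[OF fin]) (auto simp: FF_def)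
  also have "\<dots> = (\<Sum>F\<in>FF. p ^ card F * (1 - p) ^ ((card S choose 2) - card F) *
      ((1 - p) ^ (card S * (n - card S)) * gprob n p (\<lambda>G. edges G \<inter> R \<in> Free)))"
  proof (rule sum.cong[OF refl])
    fix F assume "F \<in> FF"
    then have F: "F \<subseteq> pairs S" by (simp add: FF_def)
    then have finF: "finite F" using finS finite_subset finite_pairs by blast
    have "card ((pairs S - F) \<union> ?C) = card (pairs S - F) + card ?C"
      by (rule card_Un_disjoint) (use finS PC finite_subset[OF sub(2)] in auto)
    also have "card (pairs S - F) = (card S choose 2) - card F"
      using F finF finS by (simp add: card_Diff_subset card_pairs)
    also have "card ?C = card S * (n - card S)" by (rule card_cross_edges[OF S])
    finally have card: "card ((pairs S - F) \<union> ?C) = ((card S choose 2) - card F) + card S * (n - card S)" .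
    have "gprob n p (\<lambda>G. F \<subseteq> edges G \<and> ((pairs S - F) \<union> ?C) \<inter> edges G = {} \<and> edges G \<inter> R \<in> Free) =
      p ^ card F * (1 - p) ^ card ((pairs S - F) \<union> ?C) * gprob n p (\<lambda>G. edges G \<inter> R \<in> Free)"
      by (rule gprob_pattern_indep[OF p]) (use F sub PR PC CR in auto)
    then show "gprob n p (\<lambda>G. F \<subseteq> edges G \<and> ((pairs S - F) \<union> ?C) \<inter> edges G = {} \<and> edges G \<inter> R \<in> Free) =
      p ^ card F * (1 - p) ^ ((card S choose 2) - card F) *
      ((1 - p) ^ (card S * (n - card S)) * gprob n p (\<lambda>G. edges G \<inter> R \<in> Free))"
      unfolding card by (simp add: power_add mult_ac)
  qed
  also have "gprob n p (\<lambda>G. edges G \<inter> R \<in> Free) = gprob n p (\<lambda>G. cycle_free (induced_subgraph G (- S)))"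
    by (rule gprob_cong) (simp add: induced_subgraph_on[OF _ S] Free_def R_def)
  finally show ?thesis
    unfolding class_weight_def FF_def[symmetric] by (simp only: sum_distrib_right mult.assoc)
qed

lemma iso_on_image:
  assumes f: "inj_on f S" and F: "F \<subseteq> pairs S"
  shows "iso_on f (UGraph S F) (UGraph (f ` S) ((`) f ` F))" "(`) f ` F \<subseteq> pairs (f ` S)" "card ((`) f ` F) = card F"
proof -
  have inj: "inj_on ((`) f) (Pow S)" using f by (rule inj_on_image_Pow)
  have "F \<subseteq> Pow S" using F by (auto simp: pairs_def)
  then have "inj_on ((`) f) F" using inj inj_on_subset by blast
  then show "card ((`) f ` F) = card F" by (rule card_image)
  show "(`) f ` F \<subseteq> pairs (f ` S)"
  proof
    fix e assume "e \<in> (`) f ` F"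
    then obtain d where d: "d \<in> F" "e = f ` d" by blast
    then have "d \<subseteq> S" "card d = 2" using F by (auto simp: pairs_def)
    then show "e \<in> pairs (f ` S)"
      using d f by (auto simp: pairs_def card_image inj_on_subset)
  qed
  have "{u, v} \<in> F \<longleftrightarrow> {f u, f v} \<in> (`) f ` F" if uv: "u \<in> S" "v \<in> S" for u v
  proof
    assume "{u, v} \<in> F"
    then show "{f u, f v} \<in> (`) f ` F" by (intro image_eqI[of _ _ "{u, v}"]) auto
  next
    assume "{f u, f v} \<in> (`) f ` F"
    then obtain d where d: "d \<in> F" "f ` {u, v} = f ` d" by auto
    then have "d = {u, v}"
      using inj_onD[OF inj d(2)] uv \<open>F \<subseteq> Pow S\<close> by auto
    then show "{u, v} \<in> F" using d(1) by simp
  qed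
  then show "iso_on f (UGraph S F) (UGraph (f ` S) ((`) f ` F))"
    using f by (simp add: iso_on_def bij_betw_def)
qed

text \<open>Covers a single isomorphism class as well as the family of all unicyclic graphs on h
  vertices; the latter is used to sum probabilities over all sizes.\<close>

definition unicyclic_class :: "nat \<Rightarrow> nat ugraph set \<Rightarrow> bool" where
  "unicyclic_class h H \<longleftrightarrow>
     (\<forall>G\<in>H. simple_graph G \<and> (\<forall>K\<in>graph_components G. unicycle K) \<and> card (verts G) = h) \<and>
     (\<forall>G G'. G \<in> H \<longrightarrow> simple_graph G' \<longrightarrow> graph_iso G G' \<longrightarrow> G' \<in> H)"

text \<open>Relabelling along a bijection preserves membership in \<open>H\<close> and the number of
  edges.\<close>

lemma class_weight_cong:
  assumes H: "unicyclic_class h H" and S: "finite S" "finite S'" "card S = card S'"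
  shows "class_weight p H S = class_weight p H S'"
proof -
  obtain f where f: "bij_betw f S S'" using finite_same_card_bij[OF S] by blast
  define g where "g = the_inv_into S f"
  have inj: "inj_on f S" "f ` S = S'" using f by (auto simp: bij_betw_def)
  have g: "bij_betw g S' S" unfolding g_def by (rule bij_betw_the_inv_into[OF f])
  then have ginj: "inj_on g S'" "g ` S' = S" by (auto simp: bij_betw_def)
  have gf: "g (f x) = x" if "x \<in> S" for x using that inj by (simp add: g_def the_inv_into_f_f)
  have fg: "f (g x) = x" if "x \<in> S'" for x using that inj by (auto simp: g_def f_the_inv_into_f)
  have transfer: "(`) k ` F \<in> {F. F \<subseteq> pairs U' \<and> UGraph U' F \<in> H}"
    if F: "F \<in> {F. F \<subseteq> pairs U \<and> UGraph U F \<in> H}" and k: "inj_on k U" "k ` U = U'" "finite U'" for k U U' F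
  proof -
    have F: "F \<subseteq> pairs U" "UGraph U F \<in> H" using F by auto
    note im = iso_on_image[OF k(1) F(1), unfolded k(2)]
    have "simple_graph (UGraph U' ((`) k ` F))" using im(2) k(3) by (simp add: simple_graph_pairs)
    moreover have "graph_iso (UGraph U F) (UGraph U' ((`) k ` F))" using im(1) by (auto simp: graph_iso_iff)
    ultimately have "UGraph U' ((`) k ` F) \<in> H" using H F(2) unfolding unicyclic_class_def by blast
    then show ?thesis using im(2) by simp
  qed
  show ?thesis
    unfolding class_weight_def
  proof (rule sum.reindex_bij_witness[where i = "(`) ((`) g)" and j = "(`) ((`) f)"])
    fix F assume F: "F \<in> {F. F \<subseteq> pairs S \<and> UGraph S F \<in> H}"
    have "g ` f ` d = d" if "d \<in> F" for d
    proof -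
      have "d \<subseteq> S" using F that by (auto simp: pairs_def)
      then have "(\<lambda>x. g (f x)) ` d = (\<lambda>x. x) ` d" by (intro image_cong refl gf) auto
      then show ?thesis by (simp add: image_image)
    qed
    then have "(\<lambda>d. g ` f ` d) ` F = (\<lambda>d. d) ` F" by (rule image_cong[OF refl])
    then show "(`) g ` (`) f ` F = F" by (simp add: image_image)
    show "(`) f ` F \<in> {F. F \<subseteq> pairs S' \<and> UGraph S' F \<in> H}" by (rule transfer[OF F inj S(2)])
    show "p ^ card ((`) f ` F) * (1 - p) ^ ((card S' choose 2) - card ((`) f ` F)) =
      p ^ card F * (1 - p) ^ ((card S choose 2) - card F)"
      using iso_on_image(3)[OF inj(1), of F] F S(3) by simp
  next
    fix F assume F: "F \<in> {F. F \<subseteq> pairs S' \<and> UGraph S' F \<in> H}"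
    have "f ` g ` d = d" if "d \<in> F" for d
    proof -
      have "d \<subseteq> S'" using F that by (auto simp: pairs_def)
      then have "(\<lambda>x. f (g x)) ` d = (\<lambda>x. x) ` d" by (intro image_cong refl fg) auto
      then show ?thesis by (simp add: image_image)
    qed
    then have "(\<lambda>d. f ` g ` d) ` F = (\<lambda>d. d) ` F" by (rule image_cong[OF refl])
    then show "(`) f ` (`) g ` F = F" by (simp add: image_image)
    show "(`) g ` F \<in> {F. F \<subseteq> pairs S \<and> UGraph S F \<in> H}" by (rule transfer[OF F ginj S(1)])
  qed
qed

lemma frag_eventD:
  assumes G: "graph_on n G" and H: "unicyclic_class h H" and S: "S \<subseteq> {1..n}" and ev: "frag_event H S G"
  shows "frag_verts G = S" "Frag G \<in> H"
proof -
  have ev: "closed_in G S" "induced_subgraph G S \<in> H" "cycle_free (induced_subgraph G (- S))"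
    using ev by (auto simp: frag_event_def)
  have uni: "\<forall>K\<in>graph_components (induced_subgraph G S). unicycle K"
    using H ev(2) unfolding unicyclic_class_def by blast
  have SV: "S \<subseteq> verts G" using G S by (simp add: graph_on_def)
  note d = Frag_eq_if_decomposition[OF graph_on_simple[OF G] SV ev(1) uni ev(3)]
  show "frag_verts G = S" "Frag G \<in> H" using d ev(2) by simp_all
qed

text \<open>The converse of \<open>frag_eventD\<close>. Absence of double chords makes everything
  outside the unicyclic part acyclic, so the converse fails only on an event of vanishing
  probability.\<close>

lemma frag_eventI:
  assumes G: "graph_on n G" and nd: "\<not> double_chorded G" and H: "unicyclic_class h H" and F: "Frag G \<in> H"
  shows "frag_verts G \<subseteq> {1..n}" "card (frag_verts G) = h" "frag_event H (frag_verts G) G"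
proof -
  note sG = graph_on_simple[OF G]
  show "frag_verts G \<subseteq> {1..n}" using G by (auto simp: frag_verts_def graph_on_def)
  have "card (verts (Frag G)) = h" using H F unfolding unicyclic_class_def by blast
  then show "card (frag_verts G) = h" by (simp add: verts_Frag[OF sG])
  show "frag_event H (frag_verts G) G"
    unfolding frag_event_def using closed_in_frag_verts[OF sG] cycle_free_outside_frag[OF sG nd] F
    by (simp add: Frag_eq[OF sG])
qed

lemma tendsto_choose_power:
  fixes c :: real
  shows "(\<lambda>n. real (n choose h) * (c / real n) ^ h) \<longlonglongrightarrow> c ^ h / fact h"
proof (induction h)
  case (Suc h)
  have "(\<lambda>n. (real n - real h) * (c / real n)) \<longlonglongrightarrow> c" by real_asymp
  from tendsto_divide[OF tendsto_mult[OF Suc this] tendsto_const, of "real (Suc h)"]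
  have L: "(\<lambda>n. real (n choose h) * (c / real n) ^ h * ((real n - real h) * (c / real n)) / real (Suc h))
      \<longlonglongrightarrow> c ^ h / fact h * c / real (Suc h)" by simp
  have eqv: "c ^ h / fact h * c / real (Suc h) = c ^ Suc h / fact (Suc h)"
    by (simp add: field_simps)
  have E: "\<forall>\<^sub>F n in sequentially. real (n choose h) * (c / real n) ^ h * ((real n - real h) * (c / real n)) / real (Suc h)
      = real (n choose Suc h) * (c / real n) ^ Suc h"
  proof (rule eventually_sequentiallyI[of h])
    fix n assume n: "h \<le> n"
    have "Suc h * (n choose Suc h) = (n - h) * (n choose h)"
      by (simp only: binomial_absorption binomial_absorb_comp)
    then have "real (Suc h) * real (n choose Suc h) = (real n - real h) * real (n choose h)"
      using n by (metis of_nat_diff of_nat_mult)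
    then have "real (n choose Suc h) = (real n - real h) * real (n choose h) / real (Suc h)"
      by (simp add: field_simps)
    then show "real (n choose h) * (c / real n) ^ h * ((real n - real h) * (c / real n)) / real (Suc h)
      = real (n choose Suc h) * (c / real n) ^ Suc h" by (simp add: mult_ac)
  qed
  show ?case using Lim_transform_eventually[OF L E] unfolding eqv .
qed simp

text \<open>The probability that h vertices send no edge to the others. The power is written as a
  quotient of (1 - c/n)^n by the fixed power (1 - c/n)^h, whose limit is 1, and then raised to the
  power h.\<close>

lemma tendsto_isolation_power:
  fixes c :: real
  shows "(\<lambda>n. (1 - c / real n) ^ (h * (n - h))) \<longlonglongrightarrow> exp (- c) ^ h"
proof -
  have p0: "(\<lambda>n. 1 - c / real n) \<longlonglongrightarrow> 1" by real_asymp
  have "(\<lambda>n. (1 + (- c) / real n) ^ n) \<longlonglongrightarrow> exp (- c)" by (rule tendsto_exp_limit_sequentially)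
  then have L: "(\<lambda>n. ((1 - c / real n) ^ n / (1 - c / real n) ^ h) ^ h) \<longlonglongrightarrow> (exp (- c) / 1 ^ h) ^ h"
    by (intro tendsto_power tendsto_divide p0) simp_all
  have E: "\<forall>\<^sub>F n in sequentially. ((1 - c / real n) ^ n / (1 - c / real n) ^ h) ^ h = (1 - c / real n) ^ (h * (n - h))"
  proof -
    have "\<forall>\<^sub>F n in sequentially. 0 < 1 - c / real n" by (rule order_tendstoD(1)[OF p0]) simp
    then show ?thesis
      using eventually_ge_at_top[of h]
    proof eventually_elim
      case (elim n)
      have "1 - c / real n \<noteq> 0" using elim(1) by linarith
      from power_diff[OF this elim(2), symmetric]
      have "(1 - c / real n) ^ n / (1 - c / real n) ^ h = (1 - c / real n) ^ (n - h)" .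
      then show ?case by (metis mult.commute power_mult)
    qed
  qed
  show ?thesis using Lim_transform_eventually[OF L E] by simp
qed

lemma graph_iso_card_verts: "graph_iso G G' \<Longrightarrow> card (verts G) = card (verts G')"
  by (auto simp: graph_iso_iff iso_on_def intro: bij_betw_same_card)

section \<open>Asymptotic law of the unicyclic part\<close>

context subcritical
begin

lemma tendsto_edge_prob: "(\<lambda>n. c / real n) \<longlonglongrightarrow> 0" "(\<lambda>n. 1 - c / real n) \<longlonglongrightarrow> 1"
  by real_asymp+

text \<open>The expected number of closed vertex sets of size h that induce a member of
  \<open>H\<close>. The condition that the remaining graph is acyclic is kept as the separate factor
  \<open>prob_forest\<close>.\<close>

definition class_mass :: "nat \<Rightarrow> nat ugraph set \<Rightarrow> nat \<Rightarrow> real" where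
  "class_mass h H n = real (n choose h) * class_weight (c / real n) H {1..h} * (1 - c / real n) ^ (h * (n - h))"

definition prob_forest :: "nat \<Rightarrow> real" where
  "prob_forest n = gprob n (c / real n) cycle_free"

lemma class_mass_nonneg: "0 \<le> class_mass h H n"
  unfolding class_mass_def class_weight_def using edge_prob[of n]
  by (intro mult_nonneg_nonneg sum_nonneg) auto

text \<open>Every labelled member has at least h edges. Of its edge probabilities, h are combined
  with the binomial coefficient, which gives the limit c^h/h!; each surplus edge adds a factor that
  tends to 0.\<close>

lemma class_mass_convergent:
  assumes H: "unicyclic_class h H" shows "\<exists>a. class_mass h H \<longlonglongrightarrow> a"
proof -
  define FF where "FF = {F. F \<subseteq> pairs {1..h} \<and> UGraph {1..h} F \<in> H}"
  have ge: "h \<le> card F" if "F \<in> FF" for F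
  proof -
    have "UGraph {1..h} F \<in> H" using that by (simp add: FF_def)
    then have "simple_graph (UGraph {1..h} F)" "\<forall>K\<in>graph_components (UGraph {1..h} F). unicycle K"
      using H unfolding unicyclic_class_def by blast+
    from unicyclic_verts_le_edges[OF this] show ?thesis by simp
  qed
  have eq: "class_mass h H n = (\<Sum>F\<in>FF. (real (n choose h) * (c / real n) ^ h) * (c / real n) ^ (card F - h) *
      (1 - c / real n) ^ ((h choose 2) - card F) * (1 - c / real n) ^ (h * (n - h)))" for n
    unfolding class_mass_def class_weight_def FF_def[symmetric] sum_distrib_left sum_distrib_right
  proof (rule sum.cong[OF refl])
    fix F assume "F \<in> FF"
    then have "(c / real n) ^ card F = (c / real n) ^ h * (c / real n) ^ (card F - h)"
      using ge[of F] by (metis le_add_diff_inverse power_add)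
    then show "real (n choose h) * ((c / real n) ^ card F * (1 - c / real n) ^ ((card {1..h} choose 2) - card F)) *
        (1 - c / real n) ^ (h * (n - h)) = real (n choose h) * (c / real n) ^ h * (c / real n) ^ (card F - h) *
        (1 - c / real n) ^ ((h choose 2) - card F) * (1 - c / real n) ^ (h * (n - h))" by simp
  qed
  \<comment> \<open>The term \<open>0 ^ (card F - h)\<close> is 1 exactly for the graphs with h
    edges, so only these contribute to the limit.\<close>
  have "class_mass h H \<longlonglongrightarrow> (\<Sum>F\<in>FF. c ^ h / fact h * 0 ^ (card F - h) * 1 ^ ((h choose 2) - card F) * exp (- c) ^ h)"
    unfolding eq
    by (intro tendsto_sum tendsto_mult tendsto_power tendsto_choose_power tendsto_isolation_power tendsto_edge_prob)
  then show ?thesis by blast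
qed

text \<open>The events \<open>frag_event H S\<close> are disjoint, and each has the same weight
  times the probability \<open>Q S\<close> that the graph outside \<open>S\<close> is acyclic.
  Deleting \<open>S\<close> can destroy only cycles through \<open>S\<close>, so \<open>Q S\<close>
  exceeds \<open>prob_forest\<close> by a term of order 1/n. The upper bound also pays for double
  chords.\<close>

lemma prob_Frag_bounds:
  assumes n: "n > 0" and H: "unicyclic_class h H"
  shows "class_mass h H n * prob_forest n \<le> gprob n (c / real n) (\<lambda>G. Frag G \<in> H)"
    "gprob n (c / real n) (\<lambda>G. Frag G \<in> H) \<le>
      class_mass h H n * (prob_forest n + real h * (c / real n) / (1 - c)) + gprob n (c / real n) double_chorded"
proof -
  let ?p = "c / real n"
  define SS where "SS = {S. S \<subseteq> {1..n} \<and> card S = h}"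
  define Q where "Q S = gprob n ?p (\<lambda>G. cycle_free (induced_subgraph G (- S)))" for S
  define w where "w = class_weight ?p H {1..h} * (1 - ?p) ^ (h * (n - h))"
  have w0: "0 \<le> w" unfolding w_def class_weight_def using edge_prob[of n]
    by (intro mult_nonneg_nonneg sum_nonneg) auto
  have fin: "finite SS" by (simp add: SS_def)
  have cardSS: "card SS = n choose h" using n_subsets[of "{1..n}" h] by (simp add: SS_def)
  have mass: "class_mass h H n = real (card SS) * w" by (simp add: class_mass_def w_def cardSS)
  have S_event: "gprob n ?p (frag_event H S) = w * Q S" if "S \<in> SS" for S
  proof -
    have S: "S \<subseteq> {1..n}" "card S = h" "finite S" using that finite_subset by (auto simp: SS_def)
    have "class_weight ?p H S = class_weight ?p H {1..h}"
      by (rule class_weight_cong[OF H]) (use S in auto)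
    then show ?thesis using prob_frag_event[OF edge_prob S(1), where H = H] S(2) by (simp add: w_def Q_def)
  qed
  have total: "gprob n ?p (\<lambda>G. \<exists>S\<in>SS. frag_event H S G) = (\<Sum>S\<in>SS. w * Q S)"
  proof -
    have "gprob n ?p (\<lambda>G. \<exists>S\<in>SS. frag_event H S G) = (\<Sum>S\<in>SS. gprob n ?p (frag_event H S))"
    proof (rule gprob_Bex_eq[OF fin])
      fix S S' G assume a: "S \<in> SS" "S' \<in> SS" "graph_on n G" "frag_event H S G" "frag_event H S' G"
      have "frag_verts G = S" "frag_verts G = S'"
        using frag_eventD(1)[OF a(3) H] a by (simp_all add: SS_def)
      then show "S = S'" by simp
    qed
    also have "\<dots> = (\<Sum>S\<in>SS. w * Q S)" by (rule sum.cong) (auto simp: S_event)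
    finally show ?thesis .
  qed
  have Qlow: "prob_forest n \<le> Q S" for S
    unfolding prob_forest_def Q_def by (rule gprob_mono) (simp add: cycle_free_def is_cycle_induced)
  have Qup: "Q S \<le> prob_forest n + real h * ?p / (1 - c)" if "S \<in> SS" for S
  proof -
    have S: "finite S" "card S = h" using that finite_subset by (auto simp: SS_def)
    have "Q S \<le> prob_forest n + gprob n ?p (\<lambda>G. \<exists>xs. is_cycle G xs \<and> set xs \<inter> S \<noteq> {})"
      unfolding prob_forest_def Q_def
    proof (rule gprob_diff_le)
      fix G assume "cycle_free (induced_subgraph G (- S))"
      then show "cycle_free G \<or> (\<exists>xs. is_cycle G xs \<and> set xs \<inter> S \<noteq> {})"
        by (auto simp: cycle_free_def is_cycle_induced)
    qed
    then show ?thesis using prob_cycle_through[OF n S(1)] S(2) by simp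
  qed
  have "class_mass h H n * prob_forest n = (\<Sum>S\<in>SS. w * prob_forest n)" by (simp add: mass)
  also have "\<dots> \<le> (\<Sum>S\<in>SS. w * Q S)" by (intro sum_mono mult_left_mono Qlow w0)
  also have "\<dots> \<le> gprob n ?p (\<lambda>G. Frag G \<in> H)"
    unfolding total[symmetric]
    by (rule gprob_mono) (use frag_eventD(2)[OF _ H] in \<open>auto simp: SS_def\<close>)
  finally show "class_mass h H n * prob_forest n \<le> gprob n ?p (\<lambda>G. Frag G \<in> H)" .
  have "gprob n ?p (\<lambda>G. Frag G \<in> H) \<le> gprob n ?p (\<lambda>G. \<exists>S\<in>SS. frag_event H S G) + gprob n ?p double_chorded"
  proof (rule gprob_diff_le)
    fix G assume G: "graph_on n G" and F: "Frag G \<in> H"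
    show "(\<exists>S\<in>SS. frag_event H S G) \<or> double_chorded G"
    proof (cases "double_chorded G")
      case False
      note e = frag_eventI[OF G False H F]
      have "frag_verts G \<in> SS" using e(1,2) by (simp add: SS_def)
      then show ?thesis using e(3) by blast
    qed simp
  qed
  also have "gprob n ?p (\<lambda>G. \<exists>S\<in>SS. frag_event H S G) \<le> (\<Sum>S\<in>SS. w * (prob_forest n + real h * ?p / (1 - c)))"
    unfolding total by (intro sum_mono mult_left_mono Qup w0)
  also have "\<dots> = class_mass h H n * (prob_forest n + real h * ?p / (1 - c))" by (simp add: mass)
  finally show "gprob n ?p (\<lambda>G. Frag G \<in> H) \<le>
      class_mass h H n * (prob_forest n + real h * ?p / (1 - c)) + gprob n ?p double_chorded" by simp
qed

section \<open>Normalisation over the sizes of the unicyclic part\<close>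

definition unicyclic_of_size :: "nat \<Rightarrow> nat ugraph set" where
  "unicyclic_of_size h = {G. simple_graph G \<and> (\<forall>K\<in>graph_components G. unicycle K) \<and> card (verts G) = h}"

lemma unicyclic_class_of_size: "unicyclic_class h (unicyclic_of_size h)"
proof -
  have "G' \<in> unicyclic_of_size h"
    if "G \<in> unicyclic_of_size h" "simple_graph G'" "graph_iso G G'" for G G' :: "nat ugraph"
  proof -
    have G: "simple_graph G" "\<forall>K\<in>graph_components G. unicycle K" "card (verts G) = h"
      using that(1) by (auto simp: unicyclic_of_size_def)
    have "\<exists>f. iso_on f G G'" using that(3) by (simp add: graph_iso_iff)
    then obtain f where f: "iso_on f G G'" ..
    show ?thesis
      using iso_on_all_unicyclic[OF G(1) that(2) f G(2)] that(2) G(3) graph_iso_card_verts[OF that(3)]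
      by (simp add: unicyclic_of_size_def)
  qed
  then show ?thesis unfolding unicyclic_class_def unicyclic_of_size_def by blast
qed

text \<open>The empty unicyclic part alone has mass 1. This keeps the total mass away from 0 when
  \<open>prob_forest\<close> is recovered from a product.\<close>

lemma class_mass_0: "class_mass 0 (unicyclic_of_size 0) n = 1"
proof -
  have "pairs ({} :: nat set) = {}" by (auto simp: pairs_def)
  moreover have "UGraph {} {} \<in> unicyclic_of_size 0"
    by (simp add: unicyclic_of_size_def simple_graph_def graph_components_eq)
  ultimately have "{F. F \<subseteq> pairs {} \<and> UGraph {} F \<in> unicyclic_of_size 0} = {{}}" by auto
  then show ?thesis by (simp add: class_mass_def class_weight_def numeral_2_eq_2)
qed

lemma Frag_in_unicyclic_of_size:
  "graph_on n G \<Longrightarrow> Frag G \<in> unicyclic_of_size h \<longleftrightarrow> card (frag_verts G) = h"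
  using graph_on_simple[of n G]
  by (simp add: unicyclic_of_size_def simple_graph_Frag all_unicyclic_Frag verts_Frag)

text \<open>Summing \<open>class_mass h H n * prob_forest n\<close> over all sizes \<open>h \<le> M\<close> gives
  \<open>1\<close> up to an error that tightness makes small; this determines \<open>prob_forest n\<close> asymptotically
  without any Poisson approximation.\<close>

lemma prob_forest_convergent: "convergent prob_forest"
proof -
  have "\<exists>N. \<forall>m\<ge>N. \<forall>n\<ge>N. \<bar>prob_forest m - prob_forest n\<bar> < e" if e: "e > 0" for e
  proof -
    \<comment> \<open>The final estimate places two values in an interval of length 4 d =
      e/2.\<close>
    define d where "d = e / 8"
    have d: "d > 0" using e by (simp add: d_def)
    obtain M :: nat where M: "1 / (1 - c)\<^sup>2 / d < real M" using reals_Archimedean2 by blast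
    have Mpos: "real M > 0"
    proof -
      have "0 < 1 / (1 - c)\<^sup>2 / d" using c_less d by simp
      then show ?thesis using M by linarith
    qed
    have "1 / (1 - c)\<^sup>2 < d * real M" using M d by (simp only: pos_divide_less_eq mult.commute)
    then have tail: "1 / (1 - c)\<^sup>2 / real M < d" using Mpos by (simp only: pos_divide_less_eq)
    let ?H = unicyclic_of_size
    define A where "A n = (\<Sum>h<M. class_mass h (?H h) n)" for n
    define E where "E n = (\<Sum>h<M. class_mass h (?H h) n * (real h * (c / real n) / (1 - c)) +
        gprob n (c / real n) double_chorded)" for n
    obtain a where a: "\<And>h. class_mass h (?H h) \<longlonglongrightarrow> a h"
      using class_mass_convergent[OF unicyclic_class_of_size] by metis
    have A: "A \<longlonglongrightarrow> (\<Sum>h<M. a h)" unfolding A_def by (intro tendsto_sum a)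
    have A1: "1 \<le> A n" for n
    proof -
      have "class_mass 0 (?H 0) n \<le> A n"
        unfolding A_def by (rule member_le_sum) (use class_mass_nonneg Mpos in auto)
      then show ?thesis by (simp add: class_mass_0)
    qed
    then have a1: "1 \<le> (\<Sum>h<M. a h)" using LIMSEQ_le_const[OF A] by blast
    have "(\<lambda>n. \<Sum>h<M. class_mass h (?H h) n * (real h * (c / real n) / (1 - c)) + gprob n (c / real n) double_chorded)
        \<longlonglongrightarrow> (\<Sum>h<M. a h * (real h * 0 / (1 - c)) + 0)"
      by (intro tendsto_sum tendsto_add tendsto_mult a tendsto_divide tendsto_const tendsto_edge_prob prob_double_chorded)
        (use c_less in simp)
    then have E: "E \<longlonglongrightarrow> 0" unfolding E_def by simp
    have Q01: "0 \<le> prob_forest n" "prob_forest n \<le> 1" for n by (simp_all add: prob_forest_def)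
    have bounds: "A n * prob_forest n \<le> 1" "1 - d - E n \<le> A n * prob_forest n" if n: "n > 0" for n
    proof -
      let ?p = "c / real n"
      have eq: "(\<Sum>h<M. gprob n ?p (\<lambda>G. Frag G \<in> ?H h)) = gprob n ?p (\<lambda>G. card (frag_verts G) < M)"
      proof -
        have "(\<Sum>h<M. gprob n ?p (\<lambda>G. Frag G \<in> ?H h)) = gprob n ?p (\<lambda>G. \<exists>h\<in>{..<M}. Frag G \<in> ?H h)"
          by (rule gprob_Bex_eq[symmetric]) (auto simp: unicyclic_of_size_def)
        also have "\<dots> = gprob n ?p (\<lambda>G. card (frag_verts G) < M)"
          by (rule gprob_cong) (simp add: Frag_in_unicyclic_of_size)
        finally show ?thesis .
      qed
      have "A n * prob_forest n = (\<Sum>h<M. class_mass h (?H h) n * prob_forest n)"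
        by (simp add: A_def sum_distrib_right)
      also have "\<dots> \<le> (\<Sum>h<M. gprob n ?p (\<lambda>G. Frag G \<in> ?H h))"
        by (intro sum_mono prob_Frag_bounds(1)[OF n unicyclic_class_of_size])
      also have "\<dots> \<le> 1" unfolding eq by simp
      finally show "A n * prob_forest n \<le> 1" .
      have "1 - gprob n ?p (\<lambda>G. \<not> card (frag_verts G) < M) = gprob n ?p (\<lambda>G. card (frag_verts G) < M)"
        using gprob_compl[of n ?p "\<lambda>G. card (frag_verts G) < M"] by simp
      moreover have "gprob n ?p (\<lambda>G. \<not> card (frag_verts G) < M) \<le> 1 / (1 - c)\<^sup>2 / real M"
        using prob_large_frag[OF n Mpos] by (simp add: not_less)
      ultimately have "1 - d \<le> gprob n ?p (\<lambda>G. card (frag_verts G) < M)" using tail by linarith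
      also have "\<dots> = (\<Sum>h<M. gprob n ?p (\<lambda>G. Frag G \<in> ?H h))" by (simp add: eq)
      also have "\<dots> \<le> (\<Sum>h<M. class_mass h (?H h) n * (prob_forest n + real h * ?p / (1 - c)) + gprob n ?p double_chorded)"
        by (intro sum_mono prob_Frag_bounds(2)[OF n unicyclic_class_of_size])
      also have "\<dots> = A n * prob_forest n + E n"
        unfolding A_def E_def sum_distrib_right sum.distrib[symmetric] by (rule sum.cong) (simp_all add: distrib_left)
      finally show "1 - d - E n \<le> A n * prob_forest n" by simp
    qed
    define a' where "a' = (\<Sum>h<M. a h)"
    have ev: "\<forall>\<^sub>F n in sequentially. n > 0 \<and> \<bar>A n - a'\<bar> < d \<and> \<bar>E n\<bar> < d"
      using tendstoD[OF A d] tendstoD[OF E d] eventually_gt_at_top[of 0]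
      by eventually_elim (simp add: dist_real_def a'_def)
    then obtain N where N: "\<And>n. n \<ge> N \<Longrightarrow> n > 0 \<and> \<bar>A n - a'\<bar> < d \<and> \<bar>E n\<bar> < d"
      by (auto simp: eventually_sequentially)
    \<comment> \<open>Three errors of size d: the tail of large unicyclic parts, the correction
      \<open>E n\<close>, and the replacement of \<open>A n\<close> by its limit. Only the last one
      affects the upper bound.\<close>
    have close: "1 - 3 * d \<le> a' * prob_forest n \<and> a' * prob_forest n \<le> 1 + d" if "n \<ge> N" for n
    proof -
      have n: "n > 0" "\<bar>A n - a'\<bar> < d" "\<bar>E n\<bar> < d" using N[OF that] by auto
      have "\<bar>(A n - a') * prob_forest n\<bar> \<le> d * 1"
        unfolding abs_mult by (rule mult_mono) (use n Q01 d in auto)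
      then have "\<bar>A n * prob_forest n - a' * prob_forest n\<bar> \<le> d" by (simp add: left_diff_distrib)
      then show ?thesis using bounds[OF n(1)] n(3) by linarith
    qed
    have "\<bar>prob_forest m - prob_forest n\<bar> < e" if "m \<ge> N" "n \<ge> N" for m n
    proof -
      \<comment> \<open>Since \<open>a'\<close> is at least 1, removing this factor does not
        increase the difference.\<close>
      have "\<bar>prob_forest m - prob_forest n\<bar> * 1 \<le> \<bar>prob_forest m - prob_forest n\<bar> * a'"
        by (rule mult_left_mono) (use a1 in \<open>auto simp: a'_def\<close>)
      also have "\<dots> = \<bar>a' * prob_forest m - a' * prob_forest n\<bar>"
        using a1 by (simp add: a'_def[symmetric] abs_mult mult.commute flip: right_diff_distrib)
      also have "\<dots> \<le> 4 * d" using close[OF that(1)] close[OF that(2)] by linarith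
      also have "\<dots> < e" using e by (simp add: d_def)
      finally show ?thesis by simp
    qed
    then show ?thesis by blast
  qed
  then have "Cauchy prob_forest" by (intro metric_CauchyI) (simp add: dist_real_def)
  then show ?thesis by (simp add: Cauchy_convergent_iff)
qed

lemma prob_Frag_convergent:
  assumes H: "unicyclic_class h H"
  shows "convergent (\<lambda>n. gprob n (c / real n) (\<lambda>G. Frag G \<in> H))"
proof -
  obtain q where q: "prob_forest \<longlonglongrightarrow> q" using prob_forest_convergent by (auto simp: convergent_def)
  obtain a where a: "class_mass h H \<longlonglongrightarrow> a" using class_mass_convergent[OF H] by blast
  have low: "(\<lambda>n. class_mass h H n * prob_forest n) \<longlonglongrightarrow> a * q" by (intro tendsto_mult a q)
  have "(\<lambda>n. class_mass h H n * (prob_forest n + real h * (c / real n) / (1 - c)) + gprob n (c / real n) double_chorded)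
      \<longlonglongrightarrow> a * (q + real h * 0 / (1 - c)) + 0"
    by (intro tendsto_mult tendsto_add tendsto_divide a q tendsto_const tendsto_edge_prob prob_double_chorded)
      (use c_less in simp)
  then have up: "(\<lambda>n. class_mass h H n * (prob_forest n + real h * (c / real n) / (1 - c)) + gprob n (c / real n) double_chorded)
      \<longlonglongrightarrow> a * q" by simp
  have "(\<lambda>n. gprob n (c / real n) (\<lambda>G. Frag G \<in> H)) \<longlonglongrightarrow> a * q"
  proof (rule tendsto_sandwich[OF _ _ low up])
    show "\<forall>\<^sub>F n in sequentially. class_mass h H n * prob_forest n \<le> gprob n (c / real n) (\<lambda>G. Frag G \<in> H)"
      using eventually_gt_at_top[of 0] by eventually_elim (rule prob_Frag_bounds(1)[OF _ H])
    show "\<forall>\<^sub>F n in sequentially. gprob n (c / real n) (\<lambda>G. Frag G \<in> H) \<le>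
        class_mass h H n * (prob_forest n + real h * (c / real n) / (1 - c)) + gprob n (c / real n) double_chorded"
      using eventually_gt_at_top[of 0] by eventually_elim (rule prob_Frag_bounds(2)[OF _ H])
  qed
  then show ?thesis by (auto simp: convergent_def)
qed

end


subsection \<open>Small tree components\<close>

text \<open>The inequality of Chebyshev at distance mu/2 from the mean, hence the factor 4. In the
  second moment the diagonal contributes mu and the remaining pairs at most (card J)^2 r.\<close>

lemma second_moment:
  assumes J: "finite J" and q: "\<And>j. j \<in> J \<Longrightarrow> gprob n p (P j) = q"
    and r: "\<And>i j. i \<in> J \<Longrightarrow> j \<in> J \<Longrightarrow> i \<noteq> j \<Longrightarrow> gprob n p (\<lambda>G. P i G \<and> P j G) \<le> r" "0 \<le> r"
    and mu: "mu = real (card J) * q" "mu > 0"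
  shows "gprob n p (\<lambda>G. real (card {j \<in> J. P j G}) \<le> mu / 2) \<le> 4 * (mu + (real (card J))\<^sup>2 * r - mu\<^sup>2) / mu\<^sup>2"
proof -
  let ?M = "measure_pmf (gnp n p)"
  let ?u = "\<lambda>G. \<Sum>j\<in>J. indicator {G. P j G} G :: real"
  have u: "?u G = real (card {j \<in> J. P j G})" for G
    using J by (simp add: indicator_def sum.If_cases Int_def)
  have int: "integrable ?M f" for f :: "nat ugraph \<Rightarrow> real"
    by (rule integrable_measure_pmf_finite[OF finite_set_pmf_gnp])
  have Eu: "(\<integral>G. ?u G \<partial>?M) = mu"
    by (subst Bochner_Integration.integral_sum) (use q mu(1) in \<open>auto intro: int\<close>)
  have "(?u G)\<^sup>2 = (\<Sum>i\<in>J. \<Sum>j\<in>J. indicator {G. P i G \<and> P j G} G)" for G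
    unfolding power2_eq_square sum_product by (intro sum.cong refl) (simp add: indicator_def)
  then have "(\<integral>G. (?u G)\<^sup>2 \<partial>?M) = (\<integral>G. (\<Sum>i\<in>J. \<Sum>j\<in>J. indicator {G. P i G \<and> P j G} G) \<partial>?M)" by simp
  also have "\<dots> = (\<Sum>i\<in>J. \<integral>G. (\<Sum>j\<in>J. indicator {G. P i G \<and> P j G} G) \<partial>?M)"
    by (rule Bochner_Integration.integral_sum) (rule int)
  also have "\<dots> = (\<Sum>i\<in>J. \<Sum>j\<in>J. gprob n p (\<lambda>G. P i G \<and> P j G))"
    by (intro sum.cong refl, subst Bochner_Integration.integral_sum) (auto intro: int)
  also have "\<dots> \<le> (\<Sum>i\<in>J. q + real (card J) * r)"
  proof (rule sum_mono)
    fix i assume i: "i \<in> J"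
    have "(\<Sum>j\<in>J. gprob n p (\<lambda>G. P i G \<and> P j G)) =
      gprob n p (\<lambda>G. P i G \<and> P i G) + (\<Sum>j\<in>J - {i}. gprob n p (\<lambda>G. P i G \<and> P j G))"
      by (rule sum.remove[OF J i])
    also have "(\<Sum>j\<in>J - {i}. gprob n p (\<lambda>G. P i G \<and> P j G)) \<le> (\<Sum>j\<in>J - {i}. r)"
      by (rule sum_mono) (use r(1) i in auto)
    also have "\<dots> \<le> (\<Sum>j\<in>J. r)" by (rule sum_mono2) (use J r(2) in auto)
    finally show "(\<Sum>j\<in>J. gprob n p (\<lambda>G. P i G \<and> P j G)) \<le> q + real (card J) * r" using q[OF i] by simp
  qed
  also have "\<dots> = mu + (real (card J))\<^sup>2 * r" by (simp add: mu(1) power2_eq_square distrib_left mult.assoc)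
  finally have Eu2: "(\<integral>G. (?u G)\<^sup>2 \<partial>?M) \<le> mu + (real (card J))\<^sup>2 * r" .
  have "(\<integral>G. (?u G - mu)\<^sup>2 \<partial>?M) = (\<integral>G. ((?u G)\<^sup>2 + (- (2 * mu)) * ?u G) + mu\<^sup>2 \<partial>?M)"
    by (rule Bochner_Integration.integral_cong) (simp_all add: power2_diff)
  also have "\<dots> = (\<integral>G. (?u G)\<^sup>2 + (- (2 * mu)) * ?u G \<partial>?M) + (\<integral>G. mu\<^sup>2 \<partial>?M)"
    by (rule Bochner_Integration.integral_add) (rule int)+
  also have "(\<integral>G. (?u G)\<^sup>2 + (- (2 * mu)) * ?u G \<partial>?M) = (\<integral>G. (?u G)\<^sup>2 \<partial>?M) + (\<integral>G. (- (2 * mu)) * ?u G \<partial>?M)"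
    by (rule Bochner_Integration.integral_add) (rule int)+
  also have "(\<integral>G. (- (2 * mu)) * ?u G \<partial>?M) = (- (2 * mu)) * (\<integral>G. ?u G \<partial>?M)"
    by (rule integral_mult_right_zero)
  also have "(\<integral>G. mu\<^sup>2 \<partial>?M) = mu\<^sup>2" by simp
  finally have var: "(\<integral>G. (?u G - mu)\<^sup>2 \<partial>?M) \<le> mu + (real (card J))\<^sup>2 * r - mu\<^sup>2"
    using Eu2 unfolding Eu by (simp add: power2_eq_square)
  have "gprob n p (\<lambda>G. real (card {j \<in> J. P j G}) \<le> mu / 2) \<le> gprob n p (\<lambda>G. (mu / 2)\<^sup>2 \<le> (?u G - mu)\<^sup>2)"
  proof (rule gprob_mono)
    fix G assume "real (card {j \<in> J. P j G}) \<le> mu / 2"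
    then have "mu / 2 \<le> mu - ?u G" unfolding u by simp
    then have "(mu / 2)\<^sup>2 \<le> (mu - ?u G)\<^sup>2" using mu(2) by (intro power_mono) auto
    then show "(mu / 2)\<^sup>2 \<le> (?u G - mu)\<^sup>2" by (simp add: power2_commute)
  qed
  also have "\<dots> = measure_pmf.prob (gnp n p) {G \<in> space ?M. (mu / 2)\<^sup>2 \<le> (?u G - mu)\<^sup>2}" by simp
  also have "\<dots> \<le> (\<integral>G. (?u G - mu)\<^sup>2 \<partial>?M) / (mu / 2)\<^sup>2"
    by (rule integral_Markov_inequality_measure[where A = "{}"]) (use mu(2) int in auto)
  also have "\<dots> \<le> (mu + (real (card J))\<^sup>2 * r - mu\<^sup>2) / (mu / 2)\<^sup>2" by (rule divide_right_mono[OF var]) simp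
  also have "\<dots> = 4 * (mu + (real (card J))\<^sup>2 * r - mu\<^sup>2) / mu\<^sup>2" by (simp add: power_divide)
  finally show ?thesis .
qed

text \<open>Fixes the state of every pair that meets \<open>S\<close>. For connected (S, F) this
  says that this graph is a component, in a form to which \<open>gprob_pattern\<close>
  applies.\<close>

definition component_event :: "nat \<Rightarrow> nat set set \<Rightarrow> nat set \<Rightarrow> nat ugraph \<Rightarrow> bool" where
  "component_event n F S G \<longleftrightarrow> F \<subseteq> edges G \<and> ((pairs S - F) \<union> cross_edges n S) \<inter> edges G = {}"

lemma component_eventD:
  assumes G: "graph_on n G" and S: "S \<subseteq> {1..n}" and F: "F \<subseteq> pairs S" and conn: "graph_connected (UGraph S F)"
    and ev: "component_event n F S G" and u: "u \<in> S"
  shows "reach G u = S" "component G u = UGraph S F"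
proof -
  have cl: "closed_in G S"
    using ev by (simp add: closed_in_iff_cross_edges[OF G S] component_event_def Int_Un_distrib2)
  have "edges G \<inter> pairs S = F" using ev F by (auto simp: component_event_def)
  then have ind: "induced_subgraph G S = UGraph S F" using induced_subgraph_on(1)[OF G S] by simp
  have "S \<subseteq> reach (UGraph S F) u" using conn u by (auto simp: graph_connected_def reach_def)
  then have "S \<subseteq> reach G u" using reach_induced_closed[OF cl u] ind by simp
  then show R: "reach G u = S" using closed_in_imp_reach_subset[OF cl u] by simp
  show "component G u = UGraph S F" using ind by (simp add: component_def R)
qed

lemma prob_component_event:
  assumes p: "0 \<le> p" "p \<le> 1" and S: "S \<subseteq> {1..n}" and F: "F \<subseteq> pairs S"
  shows "gprob n p (component_event n F S) =
    p ^ card F * (1 - p) ^ (((card S choose 2) - card F) + card S * (n - card S))"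
proof -
  have finS: "finite S" by (rule finite_subset[OF S]) simp
  have fin: "finite S" "finite F" using finS finite_subset[OF F finite_pairs[OF finS]] by simp_all
  have "gprob n p (component_event n F S) = p ^ card F * (1 - p) ^ card ((pairs S - F) \<union> cross_edges n S)"
    unfolding component_event_def
    by (rule gprob_pattern[OF p])
      (use F pairs_subset_all_edges[OF S] cross_edges_subset[of n S] in \<open>auto simp: cross_edges_def pairs_def\<close>)
  also have "card ((pairs S - F) \<union> cross_edges n S) = card (pairs S - F) + card (cross_edges n S)"
    by (rule card_Un_disjoint)
      (use fin finite_subset[OF cross_edges_subset] in \<open>auto simp: cross_edges_def pairs_def\<close>)
  also have "\<dots> = ((card S choose 2) - card F) + card S * (n - card S)"
    using fin F by (simp add: card_Diff_subset card_pairs card_cross_edges[OF S])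
  finally show ?thesis .
qed

text \<open>The two cuts share only pairs between \<open>S\<close> and \<open>S'\<close>, at most
  h^2 of them. Counting these twice is corrected by the denominator, which tends to 1 for p = c/n;
  so disjoint positions are nearly independent.\<close>

lemma prob_two_component_events:
  assumes p: "0 \<le> p" "p < 1" and S: "S \<subseteq> {1..n}" "S' \<subseteq> {1..n}" "card S = h" "card S' = h" "S \<inter> S' = {}"
    and F: "F \<subseteq> pairs S" "F' \<subseteq> pairs S'" "card F = e" "card F' = e"
  shows "gprob n p (\<lambda>G. component_event n F S G \<and> component_event n F' S' G) \<le>
    (p ^ e * (1 - p) ^ (((h choose 2) - e) + h * (n - h)))\<^sup>2 / (1 - p) ^ (h * h)"
proof -
  let ?C = "cross_edges n S" and ?C' = "cross_edges n S'"
  let ?P = "pairs S - F" and ?P' = "pairs S' - F'"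
  let ?x = "(h choose 2) - e" and ?y = "h * (n - h)"
  have finS: "finite S" "finite S'" using finite_subset[OF S(1)] finite_subset[OF S(2)] by simp_all
  have fin: "finite S" "finite S'" "finite F" "finite F'" "finite ?C" "finite ?C'"
    using finS finite_subset[OF F(1) finite_pairs[OF finS(1)]] finite_subset[OF F(2) finite_pairs[OF finS(2)]]
      finite_subset[OF cross_edges_subset finite_all_edges] by simp_all
  have PP: "pairs S \<inter> pairs S' = {}"
  proof (rule ccontr)
    assume "pairs S \<inter> pairs S' \<noteq> {}"
    then obtain d where d: "d \<subseteq> S" "d \<subseteq> S'" "card d = 2" by (auto simp: pairs_def)
    then have "d = {}" using S(5) by auto
    then show False using d(3) by simp
  qed
  have PC: "(pairs S \<union> pairs S') \<inter> (?C \<union> ?C') = {}"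
    using S(5) by (auto simp: pairs_def cross_edges_def)
  \<comment> \<open>Two disjoint h-sets force 2 h to be at most n; this makes the natural number
    subtraction \<open>2 * ?y - h * h\<close> exact.\<close>
  have hn: "h * h \<le> 2 * ?y"
  proof -
    have "h + h = card (S \<union> S')" using S fin by (simp add: card_Un_disjoint)
    also have "\<dots> \<le> card {1..n}" by (rule card_mono) (use S in auto)
    finally have "h \<le> n - h" by simp
    then have "h * h \<le> h * (n - h)" by (rule mult_le_mono2)
    then show ?thesis by linarith
  qed
  have "?C \<inter> ?C' \<subseteq> (\<lambda>q. {fst q, snd q}) ` (S \<times> S')"
  proof
    fix d assume d: "d \<in> ?C \<inter> ?C'"
    then obtain x y where xy: "d = {x, y}" "x \<in> S" "y \<in> {1..n} - S" by (auto simp: cross_edges_image[OF S(1)])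
    have "d \<inter> S' \<noteq> {}" using d by (simp add: cross_edges_def)
    then have "y \<in> S'" using xy S(5) by auto
    then show "d \<in> (\<lambda>q. {fst q, snd q}) ` (S \<times> S')" using xy by (intro image_eqI[of _ _ "(x, y)"]) auto
  qed
  then have "card (?C \<inter> ?C') \<le> card (S \<times> S')" by (rule surj_card_le[rotated]) (use fin in simp)
  also have "\<dots> = h * h" using S by (simp add: card_cartesian_product)
  finally have CC: "card (?C \<inter> ?C') \<le> h * h" .
  have "card ?C + card ?C' = card (?C \<union> ?C') + card (?C \<inter> ?C')" by (rule card_Un_Int) (use fin in auto)
  moreover have "card ?C = ?y" "card ?C' = ?y" using card_cross_edges S by auto
  ultimately have CU: "2 * ?y - h * h \<le> card (?C \<union> ?C')" using CC by linarith
  have "card ((?P \<union> ?P') \<union> (?C \<union> ?C')) = card (?P \<union> ?P') + card (?C \<union> ?C')"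
    by (rule card_Un_disjoint) (use fin PC in auto)
  also have "card (?P \<union> ?P') = card ?P + card ?P'"
    by (rule card_Un_disjoint) (use fin PP in auto)
  also have "card ?P = ?x" using fin F S by (simp add: card_Diff_subset card_pairs)
  also have "card ?P' = ?x" using fin F S by (simp add: card_Diff_subset card_pairs)
  finally have B: "?x + ?x + (2 * ?y - h * h) \<le> card ((?P \<union> ?P') \<union> (?C \<union> ?C'))" using CU by linarith
  have A: "card (F \<union> F') = e + e" using card_Un_disjoint[of F F'] fin F PP by auto
  have "gprob n p (\<lambda>G. component_event n F S G \<and> component_event n F' S' G) =
      gprob n p (\<lambda>G. F \<union> F' \<subseteq> edges G \<and> ((?P \<union> ?P') \<union> (?C \<union> ?C')) \<inter> edges G = {})"
    by (rule arg_cong[where f = "measure _"]) (auto simp: component_event_def)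
  also have "\<dots> = p ^ card (F \<union> F') * (1 - p) ^ card ((?P \<union> ?P') \<union> (?C \<union> ?C'))"
  proof (rule gprob_pattern)
    show "F \<union> F' \<subseteq> all_edges n" "(?P \<union> ?P') \<union> (?C \<union> ?C') \<subseteq> all_edges n"
      using F(1,2) pairs_subset_all_edges[OF S(1)] pairs_subset_all_edges[OF S(2)]
        cross_edges_subset[of n S] cross_edges_subset[of n S'] by auto
    show "(F \<union> F') \<inter> ((?P \<union> ?P') \<union> (?C \<union> ?C')) = {}" using F(1,2) PP PC by auto
  qed (use p in auto)
  also have "\<dots> \<le> p ^ (e + e) * (1 - p) ^ (?x + ?x + (2 * ?y - h * h))"
    unfolding A by (intro mult_left_mono power_decreasing B) (use p in auto)
  also have "\<dots> = (p ^ e * (1 - p) ^ (?x + ?y))\<^sup>2 / (1 - p) ^ (h * h)"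
  proof -
    have "1 - p \<noteq> 0" using p by simp
    from power_diff[OF this hn] have "(1 - p) ^ (2 * ?y - h * h) = (1 - p) ^ (2 * ?y) / (1 - p) ^ (h * h)" .
    moreover have "(p ^ e * (1 - p) ^ (?x + ?y))\<^sup>2 = p ^ (e + e) * ((1 - p) ^ (?x + ?x) * (1 - p) ^ (2 * ?y))"
      by (simp add: power_mult_distrib power_add mult_2 power2_eq_square)
    ultimately show ?thesis by (simp add: power_add)
  qed
  finally show ?thesis .
qed

definition is_tree :: "'a ugraph \<Rightarrow> bool" where
  "is_tree T \<longleftrightarrow> simple_graph T \<and> graph_connected T \<and> cycle_free T"

lemma tree_edges_less: "is_tree T \<Longrightarrow> card (edges T) < card (verts T)"
  using cycle_if_edges_ge_verts[of T] unfolding is_tree_def cycle_free_def graph_connected_def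
  by (meson not_le)

lemma labelled_copy:
  assumes T: "simple_graph T" and S: "finite S" "card S = card (verts T)"
  shows "\<exists>F. F \<subseteq> pairs S \<and> card F = card (edges T) \<and> graph_iso T (UGraph S F)"
proof -
  have fT: "finite (verts T)" using T by (simp add: simple_graph_def)
  have eT: "edges T \<subseteq> pairs (verts T)" using T by (auto simp: simple_graph_def pairs_def)
  obtain f where f: "bij_betw f (verts T) S" using finite_same_card_bij[OF fT S(1)] S(2) by auto
  have inj: "inj_on f (verts T)" "f ` verts T = S" using f by (auto simp: bij_betw_def)
  note im = iso_on_image[OF inj(1) eT, unfolded inj(2)]
  have "graph_iso T (UGraph S ((`) f ` edges T))" using im(1) by (auto simp: graph_iso_iff)
  then show ?thesis using im(2,3) by blast
qed

context subcritical
begin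

text \<open>The expected number \<open>mu n\<close> of h-sets on which a chosen copy of
  \<open>T\<close> is a component grows like n^(h-e), and e < h for a tree. Overlapping sets exclude
  each other and disjoint ones are nearly independent, so \<open>second_moment\<close>
  applies.\<close>

lemma prob_few_tree_components:
  fixes T :: "nat ugraph"
  assumes T: "is_tree T"
  shows "(\<lambda>n. gprob n (c / real n) (\<lambda>G. card {K \<in> graph_components G. graph_iso K T} < k)) \<longlonglongrightarrow> 0"
proof -
  define h where "h = card (verts T)"
  define e where "e = card (edges T)"
  have sT: "simple_graph T" "graph_connected T" using T by (auto simp: is_tree_def)
  have eh: "e < h" using tree_edges_less[OF T] by (simp add: e_def h_def)
  \<comment> \<open>One labelled copy of \<open>T\<close> on each h-set is enough for a lower bound
    on the number of components isomorphic to \<open>T\<close>.\<close>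
  define F where "F S = (SOME F. F \<subseteq> pairs S \<and> card F = e \<and> graph_iso T (UGraph S F))" for S :: "nat set"
  have F: "F S \<subseteq> pairs S" "card (F S) = e" "graph_iso T (UGraph S (F S))" if "finite S" "card S = h" for S
    using someI_ex[OF labelled_copy[OF sT(1) that(1)]] that(2) unfolding F_def e_def h_def by auto
  have Fconn: "graph_connected (UGraph S (F S))" if "finite S" "card S = h" for S
    using F(3)[OF that] iso_on_graph_connected[OF sT(1) _ sT(2)] by (auto simp: graph_iso_iff)
  define q where "q n = (c / real n) ^ e * (1 - c / real n) ^ (((h choose 2) - e) + h * (n - h))" for n
  define mu where "mu n = real (n choose h) * q n" for n
  have bound: "gprob n (c / real n) (\<lambda>G. card {K \<in> graph_components G. graph_iso K T} < k) \<le>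
      4 / mu n + 4 * (1 / (1 - c / real n) ^ (h * h) - 1)" if n: "n > 0" and muk: "mu n \<ge> 2 * real k" "mu n > 0" for n
  proof -
    let ?p = "c / real n"
    have p: "0 \<le> ?p" "?p < 1" using c_pos c_less n by (auto simp: divide_less_eq)
    define SS where "SS = {S. S \<subseteq> {1..n} \<and> card S = h}"
    have SS: "S \<subseteq> {1..n}" "card S = h" "finite S" if "S \<in> SS" for S
      using that finite_subset by (auto simp: SS_def)
    have finSS: "finite SS" by (simp add: SS_def)
    have cardSS: "card SS = n choose h" using n_subsets[of "{1..n}" h] by (simp add: SS_def)
    define ev where "ev S = component_event n (F S) S" for S
    define r where "r = (q n)\<^sup>2 / (1 - ?p) ^ (h * h)"
    have evD: "reach G u = S" "component G u = UGraph S (F S)"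
      if "graph_on n G" "S \<in> SS" "ev S G" "u \<in> S" for G S u
      using component_eventD[OF that(1) SS(1)[OF that(2)] F(1)[OF SS(3,2)[OF that(2)]]
          Fconn[OF SS(3,2)[OF that(2)]] that(3)[unfolded ev_def] that(4)] by auto
    have evq: "gprob n ?p (ev S) = q n" if "S \<in> SS" for S
      using prob_component_event[OF edge_prob SS(1)[OF that] F(1)[OF SS(3,2)[OF that]]]
        F(2)[OF SS(3,2)[OF that]] SS(2)[OF that] by (simp add: ev_def q_def)
    have r0: "0 \<le> r" using p by (simp add: r_def)
    have joint: "gprob n ?p (\<lambda>G. ev S G \<and> ev S' G) \<le> r" if S: "S \<in> SS" "S' \<in> SS" "S \<noteq> S'" for S S'
    proof (cases "S \<inter> S' = {}")
      case True
      show ?thesis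
        unfolding r_def q_def ev_def
        by (rule prob_two_component_events[OF p SS(1)[OF S(1)] SS(1)[OF S(2)] SS(2)[OF S(1)] SS(2)[OF S(2)] True
            F(1)[OF SS(3,2)[OF S(1)]] F(1)[OF SS(3,2)[OF S(2)]] F(2)[OF SS(3,2)[OF S(1)]] F(2)[OF SS(3,2)[OF S(2)]]])
    next
      case False
      \<comment> \<open>The component of a common vertex would have to be equal to both
        sets.\<close>
      then obtain u where u: "u \<in> S" "u \<in> S'" by blast
      have "gprob n ?p (\<lambda>G. ev S G \<and> ev S' G) = gprob n ?p (\<lambda>G. False)"
      proof (rule gprob_cong)
        fix G assume G: "graph_on n G"
        show "(ev S G \<and> ev S' G) \<longleftrightarrow> False"
          using evD(1)[OF G S(1) _ u(1)] evD(1)[OF G S(2) _ u(2)] S(3) by auto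
      qed
      then show ?thesis using r0 by simp
    qed
    have "gprob n ?p (\<lambda>G. card {K \<in> graph_components G. graph_iso K T} < k) \<le>
        gprob n ?p (\<lambda>G. real (card {S \<in> SS. ev S G}) \<le> mu n / 2)"
    proof (rule gprob_mono)
      fix G assume G: "graph_on n G" and less: "card {K \<in> graph_components G. graph_iso K T} < k"
      have sub: "(\<lambda>S. UGraph S (F S)) ` {S \<in> SS. ev S G} \<subseteq> {K \<in> graph_components G. graph_iso K T}"
      proof
        fix K assume "K \<in> (\<lambda>S. UGraph S (F S)) ` {S \<in> SS. ev S G}"
        then obtain S where S: "S \<in> SS" "ev S G" "K = UGraph S (F S)" by blast
        have "S \<noteq> {}" using SS(2)[OF S(1)] eh by auto
        then obtain u where u: "u \<in> S" by blast
        have "u \<in> verts G" using u SS(1)[OF S(1)] G by (auto simp: graph_on_def)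
        then have "component G u \<in> graph_components G" by (rule component_in_graph_components)
        then have "K \<in> graph_components G" using evD(2)[OF G S(1,2) u] S(3) by simp
        moreover have "graph_iso K T" using graph_iso_sym[OF F(3)[OF SS(3,2)[OF S(1)]]] S(3) by simp
        ultimately show "K \<in> {K \<in> graph_components G. graph_iso K T}" by simp
      qed
      have "inj_on (\<lambda>S. UGraph S (F S)) {S \<in> SS. ev S G}" by (rule inj_onI) simp
      then have "card {S \<in> SS. ev S G} = card ((\<lambda>S. UGraph S (F S)) ` {S \<in> SS. ev S G})"
        by (rule card_image[symmetric])
      also have "\<dots> \<le> card {K \<in> graph_components G. graph_iso K T}"
        by (rule card_mono[OF _ sub]) (use G in \<open>simp add: graph_components_eq graph_on_def\<close>)
      finally have "real (card {S \<in> SS. ev S G}) \<le> real k" using less by linarith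
      then show "real (card {S \<in> SS. ev S G}) \<le> mu n / 2" using muk(1) by linarith
    qed
    also have "\<dots> \<le> 4 * (mu n + (real (card SS))\<^sup>2 * r - (mu n)\<^sup>2) / (mu n)\<^sup>2"
      by (rule second_moment[OF finSS evq joint r0 _ muk(2)]) (auto simp: mu_def cardSS)
    also have "(real (card SS))\<^sup>2 * r = (mu n)\<^sup>2 / (1 - ?p) ^ (h * h)"
      by (simp add: r_def mu_def cardSS power_mult_distrib)
    also have "4 * (mu n + (mu n)\<^sup>2 / (1 - ?p) ^ (h * h) - (mu n)\<^sup>2) / (mu n)\<^sup>2 =
        4 / mu n + 4 * (1 / (1 - ?p) ^ (h * h) - 1)"
    proof -
      have gen: "4 * (x + x\<^sup>2 / y - x\<^sup>2) / x\<^sup>2 = 4 / x + 4 * (1 / y - 1)" if "x \<noteq> 0" for x y :: real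
      proof -
        have "4 * (x + x\<^sup>2 / y - x\<^sup>2) / x\<^sup>2 = 4 * (x / x\<^sup>2 + (x\<^sup>2 / y) / x\<^sup>2 - x\<^sup>2 / x\<^sup>2)"
          by (simp add: add_divide_distrib diff_divide_distrib)
        then show ?thesis using that by (simp add: power2_eq_square)
      qed
      show ?thesis by (rule gen) (use muk(2) in simp)
    qed
    finally show ?thesis .
  qed
  have mu_top: "filterlim mu at_top sequentially"
  proof -
    \<comment> \<open>\<open>mu n\<close> is split into this factor with a positive limit and the
      diverging factor (n/c)^(h-e).\<close>
    have L: "(\<lambda>n. (real (n choose h) * (c / real n) ^ h) * ((1 - c / real n) ^ ((h choose 2) - e) *
        (1 - c / real n) ^ (h * (n - h)))) \<longlonglongrightarrow> c ^ h / fact h * (1 ^ ((h choose 2) - e) * exp (- c) ^ h)"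
      by (intro tendsto_mult tendsto_choose_power tendsto_power tendsto_edge_prob tendsto_isolation_power)
    have "filterlim (\<lambda>n. real n / c) at_top sequentially" using c_pos by real_asymp
    then have "filterlim (\<lambda>n. (real n / c) ^ (h - e)) at_top sequentially"
      by (rule filterlim_pow_at_top[rotated]) (use eh in simp)
    from filterlim_tendsto_pos_mult_at_top[OF L _ this]
    have L2: "filterlim (\<lambda>n. (real (n choose h) * (c / real n) ^ h) * ((1 - c / real n) ^ ((h choose 2) - e) *
        (1 - c / real n) ^ (h * (n - h))) * (real n / c) ^ (h - e)) at_top sequentially" using c_pos by simp
    have E2: "\<forall>\<^sub>F n in sequentially. (real (n choose h) * (c / real n) ^ h) * ((1 - c / real n) ^ ((h choose 2) - e) *
        (1 - c / real n) ^ (h * (n - h))) * (real n / c) ^ (h - e) = mu n"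
      using eventually_gt_at_top[of 0]
    proof eventually_elim
      case (elim n)
      have "(c / real n) ^ h = (c / real n) ^ e * (c / real n) ^ (h - e)" using eh by (simp flip: power_add)
      moreover have "(c / real n) ^ (h - e) * (real n / c) ^ (h - e) = 1"
        using elim c_pos by (simp flip: power_mult_distrib)
      ultimately have eq: "(c / real n) ^ h * (real n / c) ^ (h - e) = (c / real n) ^ e" by simp
      have rearr: "x * a * w * b = x * ((a * b) * w)" for x a w b :: real by (simp only: mult_ac)
      show ?case unfolding mu_def q_def power_add rearr eq ..
    qed
    show ?thesis using L2 unfolding filterlim_cong[OF refl refl E2] .
  qed
  have "(\<lambda>n. 4 / mu n) \<longlonglongrightarrow> 0" by (rule tendsto_divide_0[OF tendsto_const filterlim_at_top_imp_at_infinity[OF mu_top]])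
  moreover have "(\<lambda>n. 4 * (1 / (1 - c / real n) ^ (h * h) - 1)) \<longlonglongrightarrow> 4 * (1 / 1 ^ (h * h) - 1)"
    by (intro tendsto_mult tendsto_diff tendsto_divide tendsto_power tendsto_const tendsto_edge_prob) simp
  ultimately have lim: "(\<lambda>n. 4 / mu n + 4 * (1 / (1 - c / real n) ^ (h * h) - 1)) \<longlonglongrightarrow> 0"
    using tendsto_add[of "\<lambda>n. 4 / mu n" 0 sequentially] by fastforce
  show ?thesis
  proof (rule tendsto_sandwich[OF _ _ tendsto_const lim])
    show "\<forall>\<^sub>F n in sequentially. gprob n (c / real n) (\<lambda>G. card {K \<in> graph_components G. graph_iso K T} < k) \<le>
      4 / mu n + 4 * (1 / (1 - c / real n) ^ (h * h) - 1)"
      using eventually_gt_at_top[of 0] filterlim_at_top_dense[THEN iffD1, OF mu_top, rule_format, of "max 0 (2 * real k)"]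
      by eventually_elim (rule bound, auto)
  qed simp
qed

text \<open>\<open>tree_rich\<close> speaks about infinitely many trees. One representative for each
  of the finitely many \<open>k\<close>-round types reduces it to finitely many applications of
  \<open>prob_few_tree_components\<close>, since a component isomorphic to the representative is
  equivalent to every tree of that type.\<close>

lemma prob_not_tree_rich: "(\<lambda>n. gprob n (c / real n) (\<lambda>G. \<not> tree_rich k G)) \<longlonglongrightarrow> 0"
proof -
  obtain \<tau> N where \<tau>: "\<And>G l. \<tau> G l < (N :: nat)"
    "\<And>(G :: nat ugraph) l (G' :: nat ugraph) l'. length l = 0 \<Longrightarrow> length l' = 0 \<Longrightarrow>
       \<tau> G l = \<tau> G' l' \<Longrightarrow> ef k G G' (set (zip l l'))"
    using finitely_many_types[where 'a = nat and r = 0 and k = k] by auto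
  define I where "I = {i. i < N \<and> (\<exists>T. is_tree T \<and> \<tau> T [] = i)}"
  define rep where "rep i = (SOME T. is_tree T \<and> \<tau> T [] = i)" for i
  have rep: "is_tree (rep i)" "\<tau> (rep i) [] = i" if "i \<in> I" for i
    using that someI_ex[of "\<lambda>T. is_tree T \<and> \<tau> T [] = i"] by (auto simp: I_def rep_def)
  have fin: "finite I" by (simp add: I_def)
  let ?few = "\<lambda>i G. card {K \<in> graph_components G. graph_iso K (rep i)} < k"
  have rich: "tree_rich k G \<or> (\<exists>i\<in>I. ?few i G)" if G: "graph_on n G" for n G
  proof (rule disjCI)
    assume nf: "\<not> (\<exists>i\<in>I. ?few i G)"
    show "tree_rich k G"
      unfolding tree_rich_def
    proof (intro allI impI)
      fix T :: "nat ugraph" assume "simple_graph T \<and> graph_connected T \<and> cycle_free T"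
      then have T: "is_tree T" by (simp add: is_tree_def)
      define i where "i = \<tau> T []"
      have i: "i \<in> I" using T \<tau>(1) by (auto simp: I_def i_def)
      have efT: "ef k (rep i) T {}" using \<tau>(2)[of "[]" "[]" "rep i" T] rep(2)[OF i] by (simp add: i_def)
      have "{K \<in> graph_components G. graph_iso K (rep i)} \<subseteq> {K \<in> graph_components G. cycle_free K \<and> ef k K T {}}"
      proof
        fix K assume "K \<in> {K \<in> graph_components G. graph_iso K (rep i)}"
        then have K: "K \<in> graph_components G" "graph_iso K (rep i)" by auto
        have "cycle_free K" using K(2) rep(1)[OF i] iso_on_cycle_free by (auto simp: graph_iso_iff is_tree_def)
        moreover have "ef k K T {}" using ef_trans[OF graph_iso_imp_ef[OF K(2)] efT] by simp
        ultimately show "K \<in> {K \<in> graph_components G. cycle_free K \<and> ef k K T {}}" using K by simp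
      qed
      moreover have "finite {K \<in> graph_components G. cycle_free K \<and> ef k K T {}}"
        using G by (simp add: graph_components_eq graph_on_def)
      ultimately have "card {K \<in> graph_components G. graph_iso K (rep i)} \<le>
          card {K \<in> graph_components G. cycle_free K \<and> ef k K T {}}" by (intro card_mono)
      moreover have "k \<le> card {K \<in> graph_components G. graph_iso K (rep i)}" using nf i by (meson not_less)
      ultimately show "k \<le> card {K \<in> graph_components G. cycle_free K \<and> ef k K T {}}" by linarith
    qed
  qed
  have up: "gprob n (c / real n) (\<lambda>G. \<not> tree_rich k G) \<le> (\<Sum>i\<in>I. gprob n (c / real n) (?few i))" for n
  proof -
    have "gprob n (c / real n) (\<lambda>G. \<not> tree_rich k G) \<le> gprob n (c / real n) (\<lambda>G. \<exists>i\<in>I. ?few i G)"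
      by (rule gprob_mono) (use rich in blast)
    also have "\<dots> \<le> (\<Sum>i\<in>I. gprob n (c / real n) (?few i))" by (rule gprob_Bex_le[OF fin])
    finally show ?thesis .
  qed
  have "(\<lambda>n. \<Sum>i\<in>I. gprob n (c / real n) (?few i)) \<longlonglongrightarrow> (\<Sum>i\<in>I. 0)"
    by (intro tendsto_sum prob_few_tree_components rep)
  then have lim: "(\<lambda>n. \<Sum>i\<in>I. gprob n (c / real n) (?few i)) \<longlonglongrightarrow> 0" by simp
  show ?thesis
    by (rule tendsto_sandwich[OF _ _ tendsto_const lim]) (use up in auto)
qed

end


subsection \<open>Definable graph properties\<close>

text \<open>Keeps formulas implicit: properties are assembled by the closure lemmas while
  \<open>X\<close> tracks the free variables, and \<open>X = {}\<close> yields a sentence.\<close>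

definition definable :: "nat set \<Rightarrow> (nat ugraph \<Rightarrow> (nat \<Rightarrow> nat) \<Rightarrow> bool) \<Rightarrow> bool" where
  "definable X P \<longleftrightarrow> (\<exists>\<phi>. free_vars \<phi> \<subseteq> X \<and> (\<forall>G s. sat G s \<phi> \<longleftrightarrow> P G s))"

lemma definableI: "free_vars \<phi> \<subseteq> X \<Longrightarrow> (\<And>G s. sat G s \<phi> \<longleftrightarrow> P G s) \<Longrightarrow> definable X P"
  unfolding definable_def by blast

lemma definable_cong: "definable X P \<Longrightarrow> (\<And>G s. P G s \<longleftrightarrow> Q G s) \<Longrightarrow> definable X Q"
  unfolding definable_def by simp

lemma definable_Eq: "x \<in> X \<Longrightarrow> y \<in> X \<Longrightarrow> definable X (\<lambda>G s. s x = s y)"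
  by (rule definableI[of "Eq x y"]) auto

lemma definable_Adj: "x \<in> X \<Longrightarrow> y \<in> X \<Longrightarrow> definable X (\<lambda>G s. {s x, s y} \<in> edges G)"
  by (rule definableI[of "Adj x y"]) auto

lemma definable_not: "definable X P \<Longrightarrow> definable X (\<lambda>G s. \<not> P G s)"
proof -
  assume "definable X P"
  then obtain \<phi> where "free_vars \<phi> \<subseteq> X" "\<forall>G s. sat G s \<phi> \<longleftrightarrow> P G s" unfolding definable_def by blast
  then show ?thesis by (intro definableI[of "Neg \<phi>"]) auto
qed

lemma definable_conj:
  assumes "definable X P" "definable X Q" shows "definable X (\<lambda>G s. P G s \<and> Q G s)"
proof -
  obtain \<phi> where "free_vars \<phi> \<subseteq> X" "\<forall>G s. sat G s \<phi> \<longleftrightarrow> P G s"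
    using assms(1) unfolding definable_def by blast
  moreover obtain \<psi> where "free_vars \<psi> \<subseteq> X" "\<forall>G s. sat G s \<psi> \<longleftrightarrow> Q G s"
    using assms(2) unfolding definable_def by blast
  ultimately show ?thesis by (intro definableI[of "Conj \<phi> \<psi>"]) auto
qed

lemma definable_disj:
  assumes "definable X P" "definable X Q" shows "definable X (\<lambda>G s. P G s \<or> Q G s)"
  by (rule definable_cong[OF definable_not[OF definable_conj[OF definable_not[OF assms(1)] definable_not[OF assms(2)]]]])
    simp

text \<open>The tautology binds its only variable, so it is available for empty \<open>X\<close>
  too.\<close>

lemma definable_True: "definable X (\<lambda>G s. True)"
  by (rule definableI[of "Neg (Conj (Ex 0 (Eq 0 0)) (Neg (Ex 0 (Eq 0 0))))"]) auto

lemma definable_Ball: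
  assumes "finite I" "\<And>i. i \<in> I \<Longrightarrow> definable X (P i)"
  shows "definable X (\<lambda>G s. \<forall>i\<in>I. P i G s)"
  using assms
proof (induction I rule: finite_induct)
  case empty
  show ?case using definable_True[of X] by simp
next
  case (insert i I)
  have "definable X (\<lambda>G s. P i G s \<and> (\<forall>i\<in>I. P i G s))" by (rule definable_conj) (use insert in auto)
  then show ?case by simp
qed

lemma definable_Bex:
  assumes "finite I" "\<And>i. i \<in> I \<Longrightarrow> definable X (P i)"
  shows "definable X (\<lambda>G s. \<exists>i\<in>I. P i G s)"
proof -
  have "definable X (\<lambda>G s. \<forall>i\<in>I. \<not> P i G s)" by (rule definable_Ball[OF assms(1)]) (intro definable_not assms(2))
  from definable_not[OF this] show ?thesis by simp
qed

lemma definable_iff_const: "definable X P \<Longrightarrow> definable X (\<lambda>G s. P G s \<longleftrightarrow> b)"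
  using definable_not[of X P] by (cases b) simp_all

lemma definable_ex_vertex:
  assumes "definable (insert x X) P"
  shows "definable X (\<lambda>G s. \<exists>v\<in>verts G. P G (s(x := v)))"
proof -
  obtain \<phi> where "free_vars \<phi> \<subseteq> insert x X" "\<forall>G s. sat G s \<phi> \<longleftrightarrow> P G s"
    using assms unfolding definable_def by blast
  then show ?thesis by (intro definableI[of "Ex x \<phi>"]) auto
qed

text \<open>Quantifies m consecutive variables at once. Because \<open>t\<close> agrees with
  \<open>s\<close> off the block, the quantifier over assignments is only an iterated vertex
  quantifier.\<close>

lemma definable_ex_block:
  assumes "definable (X \<union> {a..<a + m}) P"
  shows "definable X (\<lambda>G s. \<exists>t. (\<forall>i\<in>{a..<a + m}. t i \<in> verts G) \<and> (\<forall>i. i \<notin> {a..<a + m} \<longrightarrow> t i = s i) \<and> P G t)"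
  using assms
proof (induction m arbitrary: P)
  case 0
  have "(\<exists>t. (\<forall>i\<in>{a..<a + 0}. t i \<in> verts G) \<and> (\<forall>i. i \<notin> {a..<a + 0} \<longrightarrow> t i = s i) \<and> P G t) \<longleftrightarrow> P G s"
    for G and s :: "nat \<Rightarrow> nat"
  proof
    assume "\<exists>t. (\<forall>i\<in>{a..<a + 0}. t i \<in> verts G) \<and> (\<forall>i. i \<notin> {a..<a + 0} \<longrightarrow> t i = s i) \<and> P G t"
    then obtain t where "\<forall>i. t i = s i" "P G t" by auto
    moreover from this have "t = s" by (intro ext) simp
    ultimately show "P G s" by simp
  qed auto
  moreover have "definable X P" using 0 by simp
  ultimately show ?case using definable_cong[of X P] by presburger
next
  case (Suc m)
  have "X \<union> {a..<a + Suc m} = insert (a + m) (X \<union> {a..<a + m})" by auto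
  then have "definable (X \<union> {a..<a + m}) (\<lambda>G s. \<exists>v\<in>verts G. P G (s(a + m := v)))"
    using Suc.prems by (intro definable_ex_vertex) simp
  note IH = Suc.IH[OF this]
  show ?case
  proof (rule definable_cong[OF IH])
    fix G and s :: "nat \<Rightarrow> nat"
    show "(\<exists>t. (\<forall>i\<in>{a..<a + m}. t i \<in> verts G) \<and> (\<forall>i. i \<notin> {a..<a + m} \<longrightarrow> t i = s i) \<and>
          (\<exists>v\<in>verts G. P G (t(a + m := v)))) \<longleftrightarrow>
        (\<exists>t. (\<forall>i\<in>{a..<a + Suc m}. t i \<in> verts G) \<and> (\<forall>i. i \<notin> {a..<a + Suc m} \<longrightarrow> t i = s i) \<and> P G t)"
      (is "?L \<longleftrightarrow> ?R")
    proof
      assume ?L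
      then obtain t v where t: "\<forall>i\<in>{a..<a + m}. t i \<in> verts G" "\<forall>i. i \<notin> {a..<a + m} \<longrightarrow> t i = s i"
        "v \<in> verts G" "P G (t(a + m := v))" by blast
      show ?R by (rule exI[of _ "t(a + m := v)"]) (use t in auto)
    next
      assume ?R
      then obtain t where t: "\<forall>i\<in>{a..<a + Suc m}. t i \<in> verts G" "\<forall>i. i \<notin> {a..<a + Suc m} \<longrightarrow> t i = s i" "P G t"
        by blast
      show ?L
      proof (intro exI conjI bexI)
        \<comment> \<open>The inner block must agree with \<open>s\<close> at \<open>a + m\<close>,
          so this coordinate is reset and its old value becomes the separate vertex.\<close>
        show "\<forall>i\<in>{a..<a + m}. (t(a + m := s (a + m))) i \<in> verts G" using t(1) by auto
        show "\<forall>i. i \<notin> {a..<a + m} \<longrightarrow> (t(a + m := s (a + m))) i = s i" using t(2) by auto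
        show "P G ((t(a + m := s (a + m)))(a + m := t (a + m)))" using t(3) by simp
        show "t (a + m) \<in> verts G" using t(1) by simp
      qed
    qed
  qed
qed

subsection \<open>Sentences recognising the unicyclic part\<close>

definition induced_copy :: "nat ugraph \<Rightarrow> nat list \<Rightarrow> nat ugraph \<Rightarrow> (nat \<Rightarrow> nat) \<Rightarrow> bool" where
  "induced_copy H xs G t \<longleftrightarrow> (\<forall>i\<in>{..<length xs}. \<forall>j\<in>{..<length xs}.
     (t i = t j \<longleftrightarrow> i = j) \<and> ({t i, t j} \<in> edges G \<longleftrightarrow> {xs ! i, xs ! j} \<in> edges H))"

text \<open>Stated as a negated existential, the shape that \<open>definable_ex_vertex\<close> and
  \<open>definable_not\<close> produce.\<close>

definition isolated_copy :: "nat \<Rightarrow> nat ugraph \<Rightarrow> (nat \<Rightarrow> nat) \<Rightarrow> bool" where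
  "isolated_copy h G t \<longleftrightarrow>
     \<not> (\<exists>v\<in>verts G. \<not> ((\<exists>i\<in>{..<h}. v = t i) \<or> (\<forall>i\<in>{..<h}. {t i, v} \<notin> edges G)))"

text \<open>The cycle occupies the variables \<open>h\<close>, ..., \<open>h + m - 1\<close>. It
  suffices that its first vertex avoids the copy: if the copy is isolated, the whole cycle then
  avoids it.\<close>

definition outside_cycle :: "nat \<Rightarrow> nat \<Rightarrow> nat ugraph \<Rightarrow> (nat \<Rightarrow> nat) \<Rightarrow> bool" where
  "outside_cycle h m G y \<longleftrightarrow> (\<forall>i\<in>{..<m}. \<forall>j\<in>{..<m}. y (h + i) = y (h + j) \<longleftrightarrow> i = j) \<and>
     (\<forall>i\<in>{..<m}. {y (h + i), y (h + Suc i mod m)} \<in> edges G) \<and> (\<forall>i\<in>{..<h}. y h \<noteq> y i)"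

text \<open>The bound \<open>K\<close> keeps this a finite conjunction; longer cycles are handled by
  their small probability.\<close>

definition no_outside_cycle :: "nat \<Rightarrow> nat \<Rightarrow> nat ugraph \<Rightarrow> (nat \<Rightarrow> nat) \<Rightarrow> bool" where
  "no_outside_cycle h K G t \<longleftrightarrow> (\<forall>m\<in>{3..<K}. \<not> (\<exists>y. (\<forall>i\<in>{h..<h + m}. y i \<in> verts G) \<and>
     (\<forall>i. i \<notin> {h..<h + m} \<longrightarrow> y i = t i) \<and> outside_cycle h m G y))"

definition frag_formula :: "nat \<Rightarrow> nat ugraph \<Rightarrow> nat list \<Rightarrow> nat ugraph \<Rightarrow> (nat \<Rightarrow> nat) \<Rightarrow> bool" where
  "frag_formula K H xs G s \<longleftrightarrow> (\<exists>t. (\<forall>i\<in>{0..<0 + length xs}. t i \<in> verts G) \<and>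
     (\<forall>i. i \<notin> {0..<0 + length xs} \<longrightarrow> t i = s i) \<and>
     (induced_copy H xs G t \<and> isolated_copy (length xs) G t \<and> no_outside_cycle (length xs) K G t))"

lemma definable_frag_formula: "definable {} (frag_formula K H xs)"
proof -
  define h where "h = length xs"
  have 1: "definable {..<h} (induced_copy H xs)"
    unfolding induced_copy_def h_def[symmetric]
    by (intro definable_Ball definable_conj definable_iff_const definable_Eq definable_Adj) auto
  have 2: "definable {..<h} (isolated_copy h)"
  proof -
    have "definable (insert h {..<h}) (\<lambda>G s. \<not> ((\<exists>i\<in>{..<h}. s h = s i) \<or> (\<forall>i\<in>{..<h}. {s i, s h} \<notin> edges G)))"
      by (intro definable_Ball definable_Bex definable_disj definable_not definable_Eq definable_Adj) auto
    from definable_not[OF definable_ex_vertex[OF this]] show ?thesis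
      by (rule definable_cong) (auto simp: isolated_copy_def)
  qed
  have 3: "definable {..<h} (no_outside_cycle h K)"
    unfolding no_outside_cycle_def
  proof (intro definable_Ball definable_not definable_ex_block)
    fix m assume m: "m \<in> {3..<K}"
    have h: "h + Suc i mod m < h + m" for i using m by simp
    show "definable ({..<h} \<union> {h..<h + m}) (outside_cycle h m)"
      unfolding outside_cycle_def
      by (intro definable_Ball definable_conj definable_not definable_iff_const definable_Eq definable_Adj)
        (use m h in auto)
  qed simp
  have "definable {..<h} (\<lambda>G t. induced_copy H xs G t \<and> isolated_copy h G t \<and> no_outside_cycle h K G t)"
    by (intro definable_conj 1 2 3)
  moreover have "{} \<union> {0..<0 + h} = {..<h}" by auto
  ultimately show ?thesis
    unfolding frag_formula_def[abs_def] h_def[symmetric] by (intro definable_ex_block) simp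
qed

text \<open>If all cycles are shorter than \<open>K\<close>, the formula excludes every cycle
  outside the isolated copy, and \<open>Frag_eq_if_decomposition\<close> identifies the copy as the
  unicyclic part.\<close>

lemma frag_formula_imp:
  assumes H: "simple_graph H" "\<forall>K\<in>graph_components H. unicycle K" and xs: "distinct xs" "set xs = verts H"
    and G: "simple_graph G" and short: "\<And>ys. is_cycle G ys \<Longrightarrow> length ys < K"
    and form: "frag_formula K H xs G s"
  shows "Frag G \<in> iso_class H"
proof -
  define h where "h = length xs"
  obtain t where tV: "\<forall>i\<in>{0..<0 + h}. t i \<in> verts G" and copy: "induced_copy H xs G t"
    and isol: "isolated_copy h G t" and nc: "no_outside_cycle h K G t"
    using form unfolding frag_formula_def h_def by blast
  define S where "S = t ` {..<h}"
  have SV: "S \<subseteq> verts G" using tV by (auto simp: S_def)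
  have inj: "inj_on t {..<h}" using copy by (auto simp: inj_on_def induced_copy_def h_def)
  have bt: "bij_betw t {..<h} S" using inj by (simp add: bij_betw_def S_def)
  have bx: "bij_betw ((!) xs) {..<h} (verts H)" using bij_betw_nth[OF xs(1)] xs(2) by (simp add: h_def)
  define f where "f = (!) xs \<circ> the_inv_into {..<h} t"
  have f_t: "f (t i) = xs ! i" if "i < h" for i using the_inv_into_f_f[OF inj, of i] that by (simp add: f_def)
  have "bij_betw f S (verts H)" unfolding f_def by (rule bij_betw_trans[OF bij_betw_the_inv_into[OF bt] bx])
  moreover have "{u, v} \<in> edges (induced_subgraph G S) \<longleftrightarrow> {f u, f v} \<in> edges H" if uv: "u \<in> S" "v \<in> S" for u v
  proof -
    obtain i j where ij: "i < h" "j < h" "u = t i" "v = t j" using uv by (auto simp: S_def)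
    have "{t i, t j} \<in> edges G \<longleftrightarrow> {xs ! i, xs ! j} \<in> edges H"
      using copy ij(1,2) by (simp add: induced_copy_def h_def)
    then show ?thesis using ij uv f_t by simp
  qed
  ultimately have "iso_on f (induced_subgraph G S) H" using SV by (simp add: iso_on_def Int_absorb1)
  then have iso: "graph_iso H (induced_subgraph G S)" using graph_iso_sym by (auto simp: graph_iso_iff)
  have sS: "simple_graph (induced_subgraph G S)" by (rule simple_graph_induced[OF G])
  obtain g where g: "iso_on g H (induced_subgraph G S)" using iso by (auto simp: graph_iso_iff)
  have uni: "\<forall>K\<in>graph_components (induced_subgraph G S). unicycle K"
    by (rule iso_on_all_unicyclic[OF H(1) sS g H(2)])
  have cl: "closed_in G S"
    unfolding closed_in_def
  proof (intro ballI allI impI)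
    fix u v assume u: "u \<in> S" and e: "{u, v} \<in> edges G"
    obtain i where i: "i < h" "u = t i" using u by (auto simp: S_def)
    have "v \<in> verts G" using simple_graph_edgeD[OF G e] by simp
    then have "(\<exists>i\<in>{..<h}. v = t i) \<or> (\<forall>i\<in>{..<h}. {t i, v} \<notin> edges G)" using isol by (simp add: isolated_copy_def)
    then show "v \<in> S" using e i by (auto simp: S_def)
  qed
  have "cycle_free (induced_subgraph G (- S))"
    unfolding cycle_free_def
  proof (intro allI notI)
    fix ys assume "is_cycle (induced_subgraph G (- S)) ys"
    then have ys: "is_cycle G ys" "set ys \<subseteq> - S" by (auto simp: is_cycle_induced)
    define m where "m = length ys"
    have m: "3 \<le> m" "m < K" using ys(1) short by (auto simp: is_cycle_def m_def)
    have dys: "distinct ys" "set ys \<subseteq> verts G" "cycle_edges ys \<subseteq> edges G" using ys(1) by (auto simp: is_cycle_def)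
    define y where "y i = (if i \<in> {h..<h + m} then ys ! (i - h) else t i)" for i
    have yh: "y (h + i) = ys ! i" if "i < m" for i using that by (simp add: y_def)
    have "outside_cycle h m G y"
      unfolding outside_cycle_def
    proof (intro conjI ballI)
      fix i j assume "i \<in> {..<m}" "j \<in> {..<m}"
      then show "y (h + i) = y (h + j) \<longleftrightarrow> i = j" using dys(1) by (simp add: yh m_def nth_eq_iff_index_eq)
    next
      fix i assume i: "i \<in> {..<m}"
      have "Suc i mod m < m" using m by simp
      then have "{y (h + i), y (h + Suc i mod m)} = {ys ! i, ys ! (Suc i mod m)}" using i yh by simp
      also have "\<dots> \<in> cycle_edges ys" using i by (auto simp: cycle_edges_def m_def)
      finally show "{y (h + i), y (h + Suc i mod m)} \<in> edges G" using dys(3) by blast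
    next
      fix i assume i: "i \<in> {..<h}"
      have "y h = ys ! 0" using yh[of 0] m by simp
      moreover have "ys ! 0 \<in> set ys" using m(1) unfolding m_def by (intro nth_mem) linarith
      ultimately have "y h \<notin> S" using ys(2) by auto
      moreover have "y i \<in> S" using i by (simp add: y_def S_def)
      ultimately show "y h \<noteq> y i" by auto
    qed
    moreover have "\<forall>i\<in>{h..<h + m}. y i \<in> verts G"
    proof
      fix i assume i: "i \<in> {h..<h + m}"
      then have "ys ! (i - h) \<in> set ys" unfolding m_def by (intro nth_mem) auto
      then show "y i \<in> verts G" using dys(2) i by (auto simp: y_def)
    qed
    moreover have "\<forall>i. i \<notin> {h..<h + m} \<longrightarrow> y i = t i" by (simp add: y_def)
    moreover have "m \<in> {3..<K}" using m by simp
    ultimately show False using nc unfolding no_outside_cycle_def by blast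
  qed
  from Frag_eq_if_decomposition(2)[OF G SV cl uni this]
  show ?thesis using iso sS by (simp add: iso_class_def)
qed

text \<open>The witness lists the unicyclic part along the isomorphism. \<open>K\<close> is
  arbitrary because without double chords no cycle of any length avoids the unicyclic part.\<close>

lemma frag_formula_if:
  assumes H: "simple_graph H" and xs: "distinct xs" "set xs = verts H"
    and G: "simple_graph G" and nd: "\<not> double_chorded G" and F: "Frag G \<in> iso_class H"
  shows "frag_formula K H xs G s"
proof -
  define h where "h = length xs"
  obtain f where f: "iso_on f H (Frag G)" using F by (auto simp: iso_class_def graph_iso_iff)
  define t where "t i = (if i < h then f (xs ! i) else s i)" for i
  have xsV: "xs ! i \<in> verts H" if "i < h" for i using nth_mem[of i xs] that xs(2) by (simp add: h_def)
  have bij: "inj_on f (verts H)" "f ` verts H = frag_verts G"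
    using f by (auto simp: iso_on_def bij_betw_def verts_Frag[OF G])
  have tS: "t i \<in> frag_verts G" if "i < h" for i
    using imageI[OF xsV[OF that], of f] bij(2) that by (simp add: t_def)
  have fvV: "frag_verts G \<subseteq> verts G" by (auto simp: frag_verts_def)
  have surj: "\<exists>i\<in>{..<h}. v = t i" if "v \<in> frag_verts G" for v
  proof -
    have "v \<in> f ` set xs" using that bij(2) xs(2) by simp
    then obtain x where "x \<in> set xs" "v = f x" by blast
    then obtain i where "i < h" "x = xs ! i" by (auto simp: in_set_conv_nth h_def)
    then show ?thesis using \<open>v = f x\<close> by (intro bexI[of _ i]) (auto simp: t_def)
  qed
  have "induced_copy H xs G t"
    unfolding induced_copy_def h_def[symmetric]
  proof (intro ballI conjI)
    fix i j assume "i \<in> {..<h}" "j \<in> {..<h}"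
    then have ij: "i < h" "j < h" by auto
    have "t i = t j \<longleftrightarrow> xs ! i = xs ! j" using inj_on_eq_iff[OF bij(1) xsV[OF ij(1)] xsV[OF ij(2)]] ij by (simp add: t_def)
    also have "\<dots> \<longleftrightarrow> i = j" using xs(1) ij by (simp add: h_def nth_eq_iff_index_eq)
    finally show "t i = t j \<longleftrightarrow> i = j" .
    have "{xs ! i, xs ! j} \<in> edges H \<longleftrightarrow> {t i, t j} \<in> edges (Frag G)"
      using iso_on_edge[OF f xsV[OF ij(1)] xsV[OF ij(2)]] ij by (simp add: t_def)
    also have "\<dots> \<longleftrightarrow> {t i, t j} \<in> edges G" using tS ij by (simp add: Frag_eq[OF G])
    finally show "{t i, t j} \<in> edges G \<longleftrightarrow> {xs ! i, xs ! j} \<in> edges H" by simp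
  qed
  moreover have "isolated_copy h G t"
    unfolding isolated_copy_def
  proof (rule notI, elim bexE)
    fix v assume v: "v \<in> verts G" "\<not> ((\<exists>i\<in>{..<h}. v = t i) \<or> (\<forall>i\<in>{..<h}. {t i, v} \<notin> edges G))"
    then obtain i where i: "i < h" "{t i, v} \<in> edges G" by auto
    have "v \<in> frag_verts G" using closed_in_frag_verts[OF G] tS[OF i(1)] i(2) by (auto simp: closed_in_def)
    then show False using surj v(2) by blast
  qed
  moreover have "no_outside_cycle h K G t"
    unfolding no_outside_cycle_def
  proof (rule ballI, rule notI, elim exE conjE)
    fix m y assume m: "m \<in> {3..<K}" and yV: "\<forall>i\<in>{h..<h + m}. y i \<in> verts G"
      and yt: "\<forall>i. i \<notin> {h..<h + m} \<longrightarrow> y i = t i" and oc: "outside_cycle h m G y"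
    define ys where "ys = map (\<lambda>i. y (h + i)) [0..<m]"
    have len: "length ys = m" by (simp add: ys_def)
    have nth: "ys ! i = y (h + i)" if "i < m" for i using that by (simp add: ys_def)
    have "distinct ys" using oc by (auto simp: ys_def distinct_map inj_on_def outside_cycle_def)
    moreover have "set ys \<subseteq> verts G" using yV by (auto simp: ys_def)
    moreover have "cycle_edges ys \<subseteq> edges G"
    proof
      fix d assume "d \<in> cycle_edges ys"
      then obtain i where i: "d = {ys ! i, ys ! (Suc i mod m)}" "i < m" by (auto simp: cycle_edges_def len)
      have "Suc i mod m < m" using m by simp
      then show "d \<in> edges G" using i oc by (simp add: nth outside_cycle_def)
    qed
    ultimately have cyc: "is_cycle G ys" using m by (simp add: is_cycle_def len)
    have "ys ! 0 = y h" using nth[of 0] m by simp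
    moreover have "y h \<notin> frag_verts G"
    proof
      assume "y h \<in> frag_verts G"
      then obtain i where "i < h" "y h = t i" using surj by blast
      then have "y h = y i" using yt by simp
      then show False using oc \<open>i < h\<close> by (auto simp: outside_cycle_def)
    qed
    ultimately have n0: "ys ! 0 \<in> - frag_verts G" by simp
    have mem0: "ys ! 0 \<in> set ys" using m len by (intro nth_mem) simp
    have "set ys \<subseteq> reach G (ys ! 0)" using cycle_reach[OF cyc mem0] by blast
    also have "\<dots> \<subseteq> - frag_verts G"
      by (rule closed_in_imp_reach_subset[OF closed_in_Compl[OF closed_in_frag_verts[OF G]] n0])
    finally have "is_cycle (induced_subgraph G (- frag_verts G)) ys" using cyc by (simp add: is_cycle_induced)
    then show False using cycle_free_outside_frag[OF G nd] by (simp add: cycle_free_def)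
  qed
  ultimately show ?thesis
    unfolding frag_formula_def h_def[symmetric]
    by (intro exI[of _ t]) (use tS fvV in \<open>auto simp: t_def\<close>)
qed

text \<open>The two implications bracket the event that the unicyclic part belongs to
  \<open>TT\<close>: a graph can be misclassified only if it has a double chord or a cycle of length
  at least \<open>K\<close>.\<close>

lemma ex_frag_sentence:
  assumes "finite TT" "TT \<subseteq> unicyclic_family"
  shows "\<exists>\<phi>. sentence \<phi> \<and>
    (\<forall>G :: nat ugraph. simple_graph G \<longrightarrow> \<not> double_chorded G \<longrightarrow> (\<exists>H\<in>TT. Frag G \<in> H) \<longrightarrow> models G \<phi>) \<and>
    (\<forall>G :: nat ugraph. simple_graph G \<longrightarrow> (\<forall>ys. is_cycle G ys \<longrightarrow> length ys < K) \<longrightarrow> models G \<phi> \<longrightarrow> (\<exists>H\<in>TT. Frag G \<in> H))"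
proof -
  have "\<forall>H\<in>TT. \<exists>q. H = iso_class (fst q) \<and> simple_graph (fst q) \<and>
      (\<forall>K\<in>graph_components (fst q). unicycle K) \<and> distinct (snd q) \<and> set (snd q) = verts (fst q)"
  proof
    fix H assume "H \<in> TT"
    then have "H \<in> unicyclic_family" using assms(2) by blast
    then obtain G where G: "H = iso_class G" "simple_graph G" "\<forall>K\<in>graph_components G. unicycle K"
      by (auto simp: unicyclic_family_def)
    moreover obtain xs where "set xs = verts G" "distinct xs"
      using finite_distinct_list[of "verts G"] G(2) by (auto simp: simple_graph_def)
    ultimately show "\<exists>q. H = iso_class (fst q) \<and> simple_graph (fst q) \<and>
      (\<forall>K\<in>graph_components (fst q). unicycle K) \<and> distinct (snd q) \<and> set (snd q) = verts (fst q)"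
      by (intro exI[of _ "(G, xs)"]) simp
  qed
  then obtain q where q: "\<forall>H\<in>TT. H = iso_class (fst (q H)) \<and> simple_graph (fst (q H)) \<and>
      (\<forall>K\<in>graph_components (fst (q H)). unicycle K) \<and> distinct (snd (q H)) \<and> set (snd (q H)) = verts (fst (q H))"
    by (rule bchoice[THEN exE])
  define g where "g H = fst (q H)" for H
  define l where "l H = snd (q H)" for H
  have gl: "\<And>H. H \<in> TT \<Longrightarrow> H = iso_class (g H)" "\<And>H. H \<in> TT \<Longrightarrow> simple_graph (g H)"
    "\<And>H. H \<in> TT \<Longrightarrow> \<forall>K\<in>graph_components (g H). unicycle K" "\<And>H. H \<in> TT \<Longrightarrow> distinct (l H)"
    "\<And>H. H \<in> TT \<Longrightarrow> set (l H) = verts (g H)"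
    using q by (simp_all add: g_def l_def)
  have "definable {} (\<lambda>G s. \<exists>H\<in>TT. frag_formula K (g H) (l H) G s)"
    by (intro definable_Bex assms(1) definable_frag_formula)
  then obtain \<phi> where \<phi>: "free_vars \<phi> \<subseteq> {}" "\<forall>G s. sat G s \<phi> \<longleftrightarrow> (\<exists>H\<in>TT. frag_formula K (g H) (l H) G s)"
    unfolding definable_def by blast
  have sen: "sentence \<phi>" using \<phi>(1) by (simp add: sentence_def)
  show ?thesis
  proof (intro exI conjI allI impI)
    show "sentence \<phi>" by (rule sen)
  next
    fix G :: "nat ugraph" assume G: "simple_graph G" "\<not> double_chorded G" and "\<exists>H\<in>TT. Frag G \<in> H"
    then obtain H where H: "H \<in> TT" "Frag G \<in> H" by blast
    have "Frag G \<in> iso_class (g H)" using H gl(1) by simp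
    then have "frag_formula K (g H) (l H) G s" for s
      by (rule frag_formula_if[OF gl(2)[OF H(1)] gl(4)[OF H(1)] gl(5)[OF H(1)] G])
    then show "models G \<phi>" using H(1) by (auto simp: models_def \<phi>(2))
  next
    fix G :: "nat ugraph" assume G: "simple_graph G" "\<forall>ys. is_cycle G ys \<longrightarrow> length ys < K" and "models G \<phi>"
    then have "sat G undefined \<phi>" by (simp add: models_def)
    then obtain H where H: "H \<in> TT" "frag_formula K (g H) (l H) G undefined" by (auto simp: \<phi>(2))
    have "Frag G \<in> iso_class (g H)"
      by (rule frag_formula_imp[OF gl(2)[OF H(1)] gl(3)[OF H(1)] gl(4)[OF H(1)] gl(5)[OF H(1)] G(1) _ H(2)])
        (use G(2) in blast)
    then have "Frag G \<in> H" using gl(1)[OF H(1)] by simp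
    then show "\<exists>H\<in>TT. Frag G \<in> H" using H(1) by blast
  qed
qed


subsection \<open>Limit probabilities\<close>

text \<open>Subsets correspond to points of the cube of 0-1 functions, compact by the theorem of
  Tychonoff. By the Weierstrass M-test with majorant \<open>f\<close> the finite partial sums
  converge uniformly, so the subsum is a continuous function on the cube.\<close>

lemma closed_subsums:
  fixes f :: "'i \<Rightarrow> real"
  assumes f: "f summable_on U" "\<And>x. x \<in> U \<Longrightarrow> 0 \<le> f x"
  shows "closed {infsum f T | T. T \<subseteq> U}"
proof -
  define Y where "Y = (PiE UNIV (\<lambda>_. {0, 1}) :: ('i \<Rightarrow> real) set)"
  define \<Phi> where "\<Phi> y = (\<Sum>\<^sub>\<infinity>x\<in>U. f x * y x)" for y
  have "compactin (product_topology (\<lambda>_. euclidean) UNIV) Y"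
    unfolding Y_def by (simp add: compactin_PiE finite_imp_compact)
  then have comp: "compact Y" by (simp only: euclidean_product_topology compactin_euclidean_iff)
  have "uniform_limit Y (\<lambda>X y. \<Sum>x\<in>X. f x * y x) \<Phi> (finite_subsets_at_top U)"
    unfolding \<Phi>_def[abs_def]
  proof (rule Weierstrass_m_test_general[OF _ f(1)])
    fix x y assume x: "x \<in> U" and "y \<in> Y"
    then have "y x = 0 \<or> y x = 1" by (auto simp: Y_def PiE_def Pi_def)
    then show "norm (f x * y x) \<le> f x" using f(2)[OF x] by auto
  qed
  moreover have "\<forall>\<^sub>F X in finite_subsets_at_top U. continuous_on Y (\<lambda>y. \<Sum>x\<in>X. f x * y x)"
    by (intro always_eventually allI continuous_on_sum continuous_on_mult continuous_on_const
        continuous_on_subset[OF continuous_on_product_coordinates]) simp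
  ultimately have "continuous_on Y \<Phi>" by (intro uniform_limit_theorem) auto
  then have "closed (\<Phi> ` Y)" by (intro compact_imp_closed compact_continuous_image comp)
  moreover have "\<Phi> ` Y = {infsum f T | T. T \<subseteq> U}"
  proof (intro set_eqI iffI)
    fix r assume "r \<in> \<Phi> ` Y"
    then obtain y where y: "y \<in> Y" "r = \<Phi> y" by blast
    have y01: "y x = 0 \<or> y x = 1" for x using y(1) by (auto simp: Y_def PiE_def Pi_def)
    have "\<Phi> y = infsum f {x \<in> U. y x = 1}"
      unfolding \<Phi>_def by (rule infsum_cong_neutral) (use y01 in auto)
    then show "r \<in> {infsum f T | T. T \<subseteq> U}" using y(2) by blast
  next
    fix r assume "r \<in> {infsum f T | T. T \<subseteq> U}"
    then obtain T where T: "r = infsum f T" "T \<subseteq> U" by blast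
    let ?y = "\<lambda>x. if x \<in> T then 1 else 0 :: real"
    have "\<Phi> ?y = infsum f T"
      unfolding \<Phi>_def by (rule infsum_cong_neutral) (use T(2) in auto)
    moreover have "?y \<in> Y" by (simp add: Y_def PiE_def Pi_def)
    ultimately show "r \<in> \<Phi> ` Y" using T(1) by (intro image_eqI[of _ _ ?y]) auto
  qed
  ultimately show ?thesis by simp
qed

section \<open>Sizes of isomorphism classes\<close>

definition class_size :: "nat ugraph set \<Rightarrow> nat" where
  "class_size H = card (verts (SOME G. G \<in> H))"

lemma unicyclic_family_nonempty: "H \<in> unicyclic_family \<Longrightarrow> \<exists>G. G \<in> H"
  unfolding unicyclic_family_def using iso_class_self by blast

lemma class_size_eq:
  assumes "H \<in> unicyclic_family" "G \<in> H" shows "card (verts G) = class_size H"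
proof -
  have G': "(SOME G. G \<in> H) \<in> H" using assms(2) by (rule someI)
  then have "(SOME G. G \<in> H) \<in> iso_class G" using iso_class_memD(3)[OF assms] by simp
  then have "graph_iso G (SOME G. G \<in> H)" by (simp add: iso_class_def)
  then show ?thesis unfolding class_size_def by (rule graph_iso_card_verts)
qed

lemma unicyclic_class_family:
  assumes H: "H \<in> unicyclic_family" shows "unicyclic_class (class_size H) H"
  unfolding unicyclic_class_def
proof (intro conjI ballI allI impI)
  fix G assume G: "G \<in> H"
  show "simple_graph G" by (rule iso_class_memD(1)[OF H G])
  show "unicycle K" if "K \<in> graph_components G" for K using iso_class_memD(2)[OF H G] that by simp
  show "card (verts G) = class_size H" by (rule class_size_eq[OF H G])
next
  fix G G' :: "nat ugraph" assume G: "G \<in> H" and G': "simple_graph G'" "graph_iso G G'"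
  then show "G' \<in> H" using iso_class_memD(3)[OF H G] by (simp add: iso_class_def)
qed

text \<open>Each class has a representative on an initial segment \<open>{1..h}\<close>.\<close>

lemma finite_classes_of_bounded_size: "finite {H \<in> unicyclic_family. class_size H < M}"
proof (rule finite_subset)
  let ?X = "Sigma {..<M} (\<lambda>h. Pow (pairs {1..h :: nat}))"
  show "finite ((\<lambda>q. iso_class (UGraph {1..fst q} (snd q))) ` ?X)" by simp
  show "{H \<in> unicyclic_family. class_size H < M} \<subseteq> (\<lambda>q. iso_class (UGraph {1..fst q} (snd q))) ` ?X"
  proof
    fix H assume "H \<in> {H \<in> unicyclic_family. class_size H < M}"
    then have H: "H \<in> unicyclic_family" "class_size H < M" by auto
    obtain G where G: "G \<in> H" using unicyclic_family_nonempty[OF H(1)] by blast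
    define h where "h = card (verts G)"
    have h: "h < M" using class_size_eq[OF H(1) G] H(2) by (simp add: h_def)
    obtain F where F: "F \<subseteq> pairs {1..h}" "graph_iso G (UGraph {1..h} F)"
      using labelled_copy[OF iso_class_memD(1)[OF H(1) G], of "{1..h}"] by (auto simp: h_def)
    have "H = iso_class (UGraph {1..h} F)" using iso_class_memD(3)[OF H(1) G] iso_class_eqI[OF F(2)] by simp
    then show "H \<in> (\<lambda>q. iso_class (UGraph {1..fst q} (snd q))) ` ?X"
      using F(1) h by (intro image_eqI[of _ _ "(h, F)"]) auto
  qed
qed

section \<open>Limits for families of classes and for sentences\<close>

context subcritical
begin

lemma frag_prob_tendsto:
  assumes "H \<in> unicyclic_family"
  shows "(\<lambda>n. gprob n (c / real n) (\<lambda>G. Frag G \<in> H)) \<longlonglongrightarrow> frag_prob c H"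
  using prob_Frag_convergent[OF unicyclic_class_family[OF assms]]
  unfolding frag_prob_def by (simp add: convergent_LIMSEQ_iff)

lemma frag_prob_nonneg: "H \<in> unicyclic_family \<Longrightarrow> 0 \<le> frag_prob c H"
  by (rule LIMSEQ_le_const[OF frag_prob_tendsto]) auto

definition frag_in :: "nat ugraph set set \<Rightarrow> nat ugraph \<Rightarrow> bool" where
  "frag_in TT G \<longleftrightarrow> (\<exists>H\<in>TT. Frag G \<in> H)"

lemma prob_frag_in_finite:
  assumes F: "finite F" "F \<subseteq> unicyclic_family"
  shows "(\<lambda>n. gprob n (c / real n) (frag_in F)) \<longlonglongrightarrow> (\<Sum>H\<in>F. frag_prob c H)"
proof -
  have "gprob n (c / real n) (frag_in F) = (\<Sum>H\<in>F. gprob n (c / real n) (\<lambda>G. Frag G \<in> H))" for n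
    unfolding frag_in_def
  proof (rule gprob_Bex_eq[OF F(1)])
    fix H H' G assume a: "H \<in> F" "H' \<in> F" "Frag G \<in> H" "Frag G \<in> H'"
    then have "H \<in> unicyclic_family" "H' \<in> unicyclic_family" using F(2) by auto
    then show "H = H'" using iso_class_memD(3) a(3,4) by metis
  qed
  moreover have "(\<lambda>n. \<Sum>H\<in>F. gprob n (c / real n) (\<lambda>G. Frag G \<in> H)) \<longlonglongrightarrow> (\<Sum>H\<in>F. frag_prob c H)"
    by (intro tendsto_sum frag_prob_tendsto) (use F(2) in auto)
  ultimately show ?thesis by simp
qed

lemma frag_prob_sum_le_1:
  assumes "finite F" "F \<subseteq> unicyclic_family" shows "(\<Sum>H\<in>F. frag_prob c H) \<le> 1"
  by (rule LIMSEQ_le_const2[OF prob_frag_in_finite[OF assms]]) auto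

lemma frag_prob_summable: "frag_prob c summable_on unicyclic_family"
proof (rule nonneg_bounded_partial_sums_imp_summable_on)
  show "\<forall>\<^sub>F F in finite_subsets_at_top unicyclic_family. (\<Sum>H\<in>F. frag_prob c H) \<le> 1"
    by (rule eventually_finite_subsets_at_top_weakI) (rule frag_prob_sum_le_1)
qed (rule frag_prob_nonneg)

lemma card_frag_verts:
  assumes "graph_on n G" "H \<in> unicyclic_family" "Frag G \<in> H"
  shows "card (frag_verts G) = class_size H"
  using class_size_eq[OF assms(2,3)] verts_Frag[OF graph_on_simple[OF assms(1)]] by simp

lemma prob_frag_in_large:
  assumes TT: "TT \<subseteq> unicyclic_family" "\<And>H. H \<in> TT \<Longrightarrow> M \<le> class_size H" and M: "M > 0" and n: "n > 0"
  shows "gprob n (c / real n) (frag_in TT) \<le> 1 / (1 - c)\<^sup>2 / real M"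
proof -
  have "gprob n (c / real n) (frag_in TT) \<le> gprob n (c / real n) (\<lambda>G. real M \<le> real (card (frag_verts G)))"
  proof (rule gprob_mono)
    fix G assume G: "graph_on n G" "frag_in TT G"
    then obtain H where H: "H \<in> TT" "Frag G \<in> H" by (auto simp: frag_in_def)
    have "H \<in> unicyclic_family" using H(1) TT(1) by blast
    from card_frag_verts[OF G(1) this H(2)] show "real M \<le> real (card (frag_verts G))" using TT(2)[OF H(1)] by simp
  qed
  also have "\<dots> \<le> 1 / (1 - c)\<^sup>2 / real M" by (rule prob_large_frag[OF n]) (use M in simp)
  finally show ?thesis .
qed

text \<open>The tightness bound for large classes is uniform in n, so it passes to the limit for
  every finite family of them and hence bounds the tail of the series.\<close>

lemma infsum_frag_prob_approx:
  assumes TT: "TT \<subseteq> unicyclic_family" and M: "M > 0"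
  defines "TM \<equiv> {H \<in> TT. class_size H < M}"
  shows "finite TM" "(\<Sum>H\<in>TM. frag_prob c H) \<le> infsum (frag_prob c) TT"
    "infsum (frag_prob c) TT \<le> (\<Sum>H\<in>TM. frag_prob c H) + 1 / (1 - c)\<^sup>2 / real M"
proof -
  show fin: "finite TM"
    by (rule finite_subset[OF _ finite_classes_of_bounded_size[of M]]) (use TT in \<open>auto simp: TM_def\<close>)
  have sum: "frag_prob c summable_on TT" by (rule summable_on_subset_banach[OF frag_prob_summable TT])
  have nn: "0 \<le> frag_prob c H" if "H \<in> TT" for H using that TT frag_prob_nonneg by blast
  have TMsub: "TM \<subseteq> TT" by (auto simp: TM_def)
  show "(\<Sum>H\<in>TM. frag_prob c H) \<le> infsum (frag_prob c) TT"
    by (rule finite_sum_le_infsum[OF sum fin TMsub]) (use nn in auto)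
  show "infsum (frag_prob c) TT \<le> (\<Sum>H\<in>TM. frag_prob c H) + 1 / (1 - c)\<^sup>2 / real M"
  proof (rule infsum_le_finite_sums[OF sum])
    fix F assume F: "finite F" "F \<subseteq> TT"
    have split: "F = (F \<inter> TM) \<union> (F - TM)" by blast
    have "(\<Sum>H\<in>F. frag_prob c H) = (\<Sum>H\<in>F \<inter> TM. frag_prob c H) + (\<Sum>H\<in>F - TM. frag_prob c H)"
      by (subst split, rule sum.union_disjoint) (use F in auto)
    also have "(\<Sum>H\<in>F \<inter> TM. frag_prob c H) \<le> (\<Sum>H\<in>TM. frag_prob c H)"
      by (rule sum_mono2[OF fin]) (use nn TMsub in auto)
    also have "(\<Sum>H\<in>F - TM. frag_prob c H) \<le> 1 / (1 - c)\<^sup>2 / real M"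
    proof (rule LIMSEQ_le_const2)
      show "(\<lambda>n. gprob n (c / real n) (frag_in (F - TM))) \<longlonglongrightarrow> (\<Sum>H\<in>F - TM. frag_prob c H)"
        by (rule prob_frag_in_finite) (use F TT in auto)
      have "gprob n (c / real n) (frag_in (F - TM)) \<le> 1 / (1 - c)\<^sup>2 / real M" if "n \<ge> 1" for n
        by (rule prob_frag_in_large) (use F TT M that in \<open>auto simp: TM_def not_less\<close>)
      then show "\<exists>N. \<forall>n\<ge>N. gprob n (c / real n) (frag_in (F - TM)) \<le> 1 / (1 - c)\<^sup>2 / real M" by blast
    qed
    finally show "(\<Sum>H\<in>F. frag_prob c H) \<le> (\<Sum>H\<in>TM. frag_prob c H) + 1 / (1 - c)\<^sup>2 / real M" by simp
  qed
qed

lemma ex_size_bound: "e > 0 \<Longrightarrow> \<exists>M::nat. M > 0 \<and> 1 / (1 - c)\<^sup>2 / real M < e"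
proof -
  assume e: "e > 0"
  obtain M :: nat where M: "1 / (1 - c)\<^sup>2 / e < real M" using reals_Archimedean2 by blast
  have "0 < 1 / (1 - c)\<^sup>2 / e" using c_less e by simp
  then have Mpos: "0 < real M" using M by linarith
  have "1 / (1 - c)\<^sup>2 < e * real M" using M e by (simp only: pos_divide_less_eq mult.commute)
  then have "1 / (1 - c)\<^sup>2 / real M < e" using Mpos by (simp only: pos_divide_less_eq)
  then show ?thesis using Mpos by auto
qed

text \<open>Interchanges the limit with the infinite sum: tightness controls the classes of size at
  least \<open>M\<close> uniformly in n, and finitely many classes remain.\<close>

lemma prob_frag_in_tendsto:
  assumes TT: "TT \<subseteq> unicyclic_family"
  shows "(\<lambda>n. gprob n (c / real n) (frag_in TT)) \<longlonglongrightarrow> infsum (frag_prob c) TT"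
proof (rule tendstoI)
  fix e :: real assume e: "e > 0"
  obtain M :: nat where M: "M > 0" "1 / (1 - c)\<^sup>2 / real M < e / 3" using ex_size_bound[of "e / 3"] e by auto
  define TM where "TM = {H \<in> TT. class_size H < M}"
  note approx = infsum_frag_prob_approx[OF TT M(1), folded TM_def]
  have "TM \<subseteq> unicyclic_family" using TT by (auto simp: TM_def)
  from tendstoD[OF prob_frag_in_finite[OF approx(1) this], of "e / 3"] e
  have "\<forall>\<^sub>F n in sequentially. dist (gprob n (c / real n) (frag_in TM)) (\<Sum>H\<in>TM. frag_prob c H) < e / 3" by simp
  then show "\<forall>\<^sub>F n in sequentially. dist (gprob n (c / real n) (frag_in TT)) (infsum (frag_prob c) TT) < e"
    using eventually_gt_at_top[of 0]
  proof eventually_elim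
    case (elim n)
    have low: "gprob n (c / real n) (frag_in TM) \<le> gprob n (c / real n) (frag_in TT)"
      by (rule gprob_mono) (auto simp: frag_in_def TM_def)
    have "gprob n (c / real n) (frag_in TT) \<le> gprob n (c / real n) (frag_in TM) + gprob n (c / real n) (frag_in (TT - TM))"
      by (rule gprob_diff_le) (auto simp: frag_in_def)
    also have "gprob n (c / real n) (frag_in (TT - TM)) \<le> 1 / (1 - c)\<^sup>2 / real M"
      by (rule prob_frag_in_large) (use TT M elim in \<open>auto simp: TM_def\<close>)
    finally have up: "gprob n (c / real n) (frag_in TT) \<le> gprob n (c / real n) (frag_in TM) + 1 / (1 - c)\<^sup>2 / real M" by simp
    show ?case using low up elim(1) approx(2,3) M(2) unfolding dist_real_def by linarith
  qed
qed

text \<open>Among graphs that are tree-rich and free of double chords, truth of the sentence depends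
  only on the isomorphism class of the unicyclic part; all other graphs have vanishing
  probability.\<close>

lemma prob_models_tendsto:
  assumes \<phi>: "sentence \<phi>"
  shows "\<exists>TT. TT \<subseteq> unicyclic_family \<and>
    (\<lambda>n. gprob n (c / real n) (\<lambda>G. models G \<phi>)) \<longlonglongrightarrow> infsum (frag_prob c) TT"
proof -
  define k where "k = quantifier_rank \<phi>"
  define good where "good G \<longleftrightarrow> simple_graph G \<and> \<not> double_chorded G \<and> tree_rich k G" for G
  \<comment> \<open>One good graph satisfying the sentence puts its class into \<open>TT\<close>; by
    \<open>ef_if_iso_Frag\<close> it then speaks for all good graphs with this unicyclic
    part.\<close>
  define TT where "TT = {H \<in> unicyclic_family. \<exists>G. good G \<and> Frag G \<in> H \<and> models G \<phi>}"
  have eq: "models G \<phi> \<longleftrightarrow> frag_in TT G" if G: "good G" for G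
  proof
    have sG: "simple_graph G" using G by (simp add: good_def)
    assume "models G \<phi>"
    then have "iso_class (Frag G) \<in> TT"
      using G iso_class_Frag[OF sG] iso_class_self[OF simple_graph_Frag[OF sG]] by (auto simp: TT_def)
    then show "frag_in TT G" using iso_class_self[OF simple_graph_Frag[OF sG]] by (auto simp: frag_in_def)
  next
    assume "frag_in TT G"
    then obtain H G' where H: "H \<in> unicyclic_family" "Frag G \<in> H" and G': "good G'" "Frag G' \<in> H" "models G' \<phi>"
      by (auto simp: frag_in_def TT_def)
    have "Frag G' \<in> iso_class (Frag G)" using iso_class_memD(3)[OF H] G'(2) by simp
    then have "graph_iso (Frag G) (Frag G')" by (simp add: iso_class_def)
    then have "ef k G G' {}" by (intro ef_if_iso_Frag) (use G G'(1) in \<open>auto simp: good_def\<close>)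
    then show "models G \<phi>" using models_ef[OF \<phi>, of k G G'] G'(3) by (simp add: k_def)
  qed
  have TT: "TT \<subseteq> unicyclic_family" by (auto simp: TT_def)
  let ?bad = "\<lambda>n. gprob n (c / real n) double_chorded + gprob n (c / real n) (\<lambda>G. \<not> tree_rich k G)"
  have bad0: "?bad \<longlonglongrightarrow> 0" using tendsto_add[OF prob_double_chorded prob_not_tree_rich[of k]] by simp
  have close: "norm (gprob n (c / real n) (\<lambda>G. models G \<phi>) - gprob n (c / real n) (frag_in TT)) \<le> ?bad n" for n
  proof -
    let ?B = "\<lambda>G. double_chorded G \<or> \<not> tree_rich k G"
    have g: "good G \<or> ?B G" if "graph_on n G" for G using graph_on_simple[OF that] by (auto simp: good_def)
    have "gprob n (c / real n) (\<lambda>G. models G \<phi>) \<le> gprob n (c / real n) (frag_in TT) + gprob n (c / real n) ?B"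
      by (rule gprob_diff_le) (use eq g in blast)
    moreover have "gprob n (c / real n) (frag_in TT) \<le> gprob n (c / real n) (\<lambda>G. models G \<phi>) + gprob n (c / real n) ?B"
      by (rule gprob_diff_le) (use eq g in blast)
    moreover have "gprob n (c / real n) ?B \<le> ?bad n" by (rule gprob_disj_le)
    ultimately show ?thesis by (simp add: abs_le_iff)
  qed
  have "(\<lambda>n. gprob n (c / real n) (\<lambda>G. models G \<phi>) - gprob n (c / real n) (frag_in TT)) \<longlonglongrightarrow> 0"
    by (rule Lim_null_comparison[OF _ bad0]) (use close in auto)
  from tendsto_add[OF this prob_frag_in_tendsto[OF TT]]
  have "(\<lambda>n. gprob n (c / real n) (\<lambda>G. models G \<phi>)) \<longlonglongrightarrow> infsum (frag_prob c) TT" by simp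
  then show ?thesis using TT by blast
qed

lemma fo_limits_subset: "fo_limits c \<subseteq> frag_sums c"
proof
  fix r assume "r \<in> fo_limits c"
  then obtain \<phi> where \<phi>: "sentence \<phi>" "r = lim (\<lambda>n. gprob n (c / real n) (\<lambda>G. models G \<phi>))"
    by (auto simp: fo_limits_def)
  obtain TT where TT: "TT \<subseteq> unicyclic_family"
    "(\<lambda>n. gprob n (c / real n) (\<lambda>G. models G \<phi>)) \<longlonglongrightarrow> infsum (frag_prob c) TT"
    using prob_models_tendsto[OF \<phi>(1)] by blast
  have "r = infsum (frag_prob c) TT" using limI[OF TT(2)] \<phi>(2) by simp
  then show "r \<in> frag_sums c" using TT(1) unfolding frag_sums_def by blast
qed

text \<open>Truncating \<open>TT\<close> at size \<open>M\<close> costs less than e/3, and so do the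
  cycles of length at least \<open>K\<close> that the sentence cannot see; double chords disappear
  in the limit.\<close>

lemma frag_sums_approx:
  assumes TT: "TT \<subseteq> unicyclic_family" and e: "e > 0"
  shows "\<exists>r\<in>fo_limits c. dist r (infsum (frag_prob c) TT) < e"
proof -
  obtain M :: nat where M: "M > 0" "1 / (1 - c)\<^sup>2 / real M < e / 3" using ex_size_bound[of "e / 3"] e by auto
  define TM where "TM = {H \<in> TT. class_size H < M}"
  note approx = infsum_frag_prob_approx[OF TT M(1), folded TM_def]
  have TMU: "TM \<subseteq> unicyclic_family" using TT by (auto simp: TM_def)
  have "(\<lambda>k. c ^ k / (1 - c)) \<longlonglongrightarrow> 0 / (1 - c)"
    by (intro tendsto_divide LIMSEQ_realpow_zero tendsto_const) (use c_pos c_less in auto)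
  then have "\<forall>\<^sub>F k in sequentially. c ^ k / (1 - c) < e / 3"
    by (rule order_tendstoD(2)) (use e in simp)
  then obtain K where K: "c ^ K / (1 - c) < e / 3" by (auto simp: eventually_sequentially)
  obtain \<phi> where \<phi>: "sentence \<phi>"
    "\<forall>G. simple_graph G \<longrightarrow> \<not> double_chorded G \<longrightarrow> (\<exists>H\<in>TM. Frag G \<in> H) \<longrightarrow> models G \<phi>"
    "\<forall>G. simple_graph G \<longrightarrow> (\<forall>ys. is_cycle G ys \<longrightarrow> length ys < K) \<longrightarrow> models G \<phi> \<longrightarrow> (\<exists>H\<in>TM. Frag G \<in> H)"
    using ex_frag_sentence[OF approx(1) TMU, of K] by blast
  let ?P = "\<lambda>n. gprob n (c / real n) (\<lambda>G. models G \<phi>)"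
  let ?Q = "\<lambda>n. gprob n (c / real n) (frag_in TM)"
  obtain l where l: "?P \<longlonglongrightarrow> l" using prob_models_tendsto[OF \<phi>(1)] by blast
  have Q: "?Q \<longlonglongrightarrow> (\<Sum>H\<in>TM. frag_prob c H)" by (rule prob_frag_in_finite[OF approx(1) TMU])
  have up: "?P n \<le> ?Q n + c ^ K / (1 - c)" if n: "n > 0" for n
  proof -
    have "?P n \<le> ?Q n + gprob n (c / real n) (\<lambda>G. \<exists>xs. is_cycle G xs \<and> K \<le> length xs)"
    proof (rule gprob_diff_le)
      fix G assume G: "graph_on n G" and m: "models G \<phi>"
      show "frag_in TM G \<or> (\<exists>xs. is_cycle G xs \<and> K \<le> length xs)"
        using \<phi>(3)[rule_format, OF graph_on_simple[OF G] _ m] unfolding frag_in_def by (meson not_less)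
    qed
    then show ?thesis using prob_long_cycle[OF n, of K] by linarith
  qed
  have low: "?Q n \<le> ?P n + gprob n (c / real n) double_chorded" for n
  proof (rule gprob_diff_le)
    fix G assume G: "graph_on n G" and m: "frag_in TM G"
    show "models G \<phi> \<or> double_chorded G"
      using \<phi>(2)[rule_format, OF graph_on_simple[OF G]] m unfolding frag_in_def by blast
  qed
  have l_up: "l \<le> (\<Sum>H\<in>TM. frag_prob c H) + c ^ K / (1 - c)"
    by (rule LIMSEQ_le[OF l tendsto_add[OF Q tendsto_const]]) (use up in \<open>auto intro!: exI[of _ 1]\<close>)
  have l_low: "(\<Sum>H\<in>TM. frag_prob c H) \<le> l"
    using LIMSEQ_le[OF Q tendsto_add[OF l prob_double_chorded]] low by simp
  have "dist l (infsum (frag_prob c) TT) < e"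
    using l_up l_low approx(2,3) K M(2) e unfolding dist_real_def by linarith
  moreover have "l \<in> fo_limits c"
    unfolding fo_limits_def using \<phi>(1) limI[OF l] by blast
  ultimately show ?thesis by blast
qed

end

theorem theorem14:
  fixes c :: real
  assumes "0 < c" and "c < 1"
  shows "closure (fo_limits c) = frag_sums c"
proof
  interpret subcritical c using assms by unfold_locales
  have "closed (frag_sums c)"
    unfolding frag_sums_def by (rule closed_subsums[OF frag_prob_summable frag_prob_nonneg])
  then show "closure (fo_limits c) \<subseteq> frag_sums c"
    by (rule closure_minimal[OF fo_limits_subset])
  show "frag_sums c \<subseteq> closure (fo_limits c)"
    unfolding frag_sums_def closure_approachable[abs_def]
    using frag_sums_approx by (auto simp: closure_approachable)
qed

end
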